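(* Let $B=\mathbb C[x_1,\dots,x_n]$ with $S_n$ permuting the variables. A canonical basis of $B^{ann}$ is the same (up to scaling the basis vectors) as a Young basis of the $S_n$-representation $B^{ann}$. In particular, the canonical basis vectors are common eigenvectors of the Jucys–Murphy elements in $\mathbb C[S_n]$.
   Context: $\mathcal D_B$ is the Weyl algebra on $B$, graded by $\deg x_i=1$, $\deg\partial_i=-1$. For $1\le i\le n$, $S_i$ permutes $x_1,\dots,x_i$ and fixes the other variables, $\mathcal D_i=\mathcal D_B^{S_i}$, $\mathcal D_i^-$ is the sum of its parts of strictly negative degree, $\mathrm{Ann}_{\mathcal D_i^-}(N)=\{y\in N:\mathcal D_i^-y=0\}$, $B_i^{ann}=\mathrm{Ann}_{\mathcal D_i^-}(B)$, and $B^{ann}=B_n^{ann}$. Put $\nabla_j=x_j\partial_j$ and $R_i=\mathbb C[\nabla_1,\dots,\nabla_i]^{S_i}\subset\mathcal D_i^0$ (the degree $0$ part). Canonical basis: $B_1^{ann}=\mathbb C$ has basis $C_1=\{1\}$. Given a basis $C_{i-1}=\{v_j\}$ of $B_{i-1}^{ann}$ so constructed, for each $j$ the $R_i$-module $\mathrm{Ann}_{\mathcal D_i^-}(\mathcal D_{i-1}v_j)$ is a finite direct sum of pairwise non-isomorphic one-dimensional $R_i$-modules; choose a nonzero vector in each of these one-dimensional summands, and let $C_i$ be the set of all vectors thus obtained for all $j$; $C_i$ is a basis of $B_i^{ann}$. A canonical basis of $B^{ann}$ is a basis $C_n$ obtained this way; it is unique up to scalars. Young basis: the Jucys–Murphy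 elements are $L_i=\sum_{j=1}^{i-1}(j\ i)\in\mathbb C[S_n]$, $2\le i\le n$ ($(j\ i)$ a transposition), generating the commutative algebra $A(n)$. A Young basis of an irreducible $S_n$-representation $V_\lambda$ is a basis $\{w_T\}$ such that each $\mathbb Cw_T$ is an $A(n)$-submodule and $\mathbb Cw_{T_1}\not\cong\mathbb Cw_{T_2}$ as $A(n)$-modules for $T_1\ne T_2$; it is unique up to scalars. The $S_n$-representation $B^{ann}$ is a direct sum of pairwise non-isomorphic irreducible representations $V_\lambda$, hence canonically decomposed, and a Young basis of $B^{ann}$ is the union of Young bases of these $V_\lambda$. *)

theory Defs
  imports
    Complex_Main
    "HOL-Library.Poly_Mapping"
    "HOL-Library.Function_Algebras"
    "HOL-Combinatorics.Permutations"
begin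

section \<open>Polynomials and linear operators on them\<close>

text \<open>
  Polynomials live in the polynomial ring over the complex numbers in variables indexed by all
  natural numbers; the ring of the paper, with variables indexed by 1 to n, is the subset
  \<open>polys n\<close>.
\<close>

type_synonym mpoly = "(nat \<Rightarrow>\<^sub>0 nat) \<Rightarrow>\<^sub>0 complex"

type_synonym mop = "mpoly \<Rightarrow> mpoly"

definition polys :: "nat \<Rightarrow> mpoly set" where
  "polys n = {p. \<forall>m\<in>Poly_Mapping.keys p. Poly_Mapping.keys m \<subseteq> {1..n}}"

definition pscale :: "complex \<Rightarrow> mpoly \<Rightarrow> mpoly" where
  "pscale c p = Poly_Mapping.single 0 c * p"

definition oscale :: "complex \<Rightarrow> mop \<Rightarrow> mop" where
  "oscale c d = (\<lambda>p. pscale c (d p))"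

global_interpretation pv: vector_space pscale
  defines pspan = pv.span and psubspace = pv.subspace and pdependent = pv.dependent
  by unfold_locales
    (simp_all add: pscale_def distrib_left distrib_right single_add mult_single
      flip: mult.assoc)

global_interpretation ov: vector_space oscale
  defines ospan = ov.span
  by unfold_locales
    (simp_all add: oscale_def fun_eq_iff pv.scale_right_distrib pv.scale_left_distrib)

definition mulx :: "nat \<Rightarrow> mop" where
  "mulx j p = Poly_Mapping.single (Poly_Mapping.single j 1) 1 * p"

definition pdiff :: "nat \<Rightarrow> mop" where
  "pdiff j p = (\<Sum>m\<in>Poly_Mapping.keys p.
     Poly_Mapping.single (m - Poly_Mapping.single j 1)
       (of_nat (Poly_Mapping.lookup m j) * Poly_Mapping.lookup p m))"

text \<open>
  For a permutation \<open>\<sigma>\<close>, the coefficient of \<open>perm_act \<sigma> p\<close> at the exponent \<open>m\<close> is the coefficient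
  of \<open>p\<close> at \<open>m \<circ> \<sigma>\<close>. This is the left action by ring automorphisms that sends the
  \<open>j\<close>-th variable to the \<open>\<sigma> j\<close>-th one.
\<close>

definition perm_act :: "(nat \<Rightarrow> nat) \<Rightarrow> mop" where
  "perm_act \<sigma> p = Poly_Mapping.map_key (Poly_Mapping.map_key \<sigma>) p"

lemma pdiff_single:
  "pdiff j (Poly_Mapping.single m c) =
     Poly_Mapping.single (m - Poly_Mapping.single j 1) (of_nat (Poly_Mapping.lookup m j) * c)"
  by (cases "c = 0") (simp_all add: pdiff_def)

lemma map_key_single_perm:
  assumes "bij \<sigma>"
  shows "Poly_Mapping.map_key \<sigma> (Poly_Mapping.single (\<sigma> j) c) = Poly_Mapping.single j c"
  using map_key_single[OF bij_is_inj[OF assms]] .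

lemma perm_act_variable:
  assumes "bij \<sigma>"
  shows "perm_act \<sigma> (Poly_Mapping.single (Poly_Mapping.single j 1) 1) =
    Poly_Mapping.single (Poly_Mapping.single (\<sigma> j) 1) 1"
proof -
  have "inj (Poly_Mapping.map_key \<sigma> :: (nat \<Rightarrow>\<^sub>0 nat) \<Rightarrow> _)"
  proof (rule injI)
    fix x y :: "nat \<Rightarrow>\<^sub>0 nat"
    assume "Poly_Mapping.map_key \<sigma> x = Poly_Mapping.map_key \<sigma> y"
    then have "Poly_Mapping.lookup x (\<sigma> k) = Poly_Mapping.lookup y (\<sigma> k)" for k
      by (metis map_key.rep_eq[OF bij_is_inj[OF assms]] comp_apply)
    then show "x = y"
      using assms by (metis bij_pointE poly_mapping_eqI)
  qed
  from map_key_single[OF this, of "Poly_Mapping.single (\<sigma> j) 1" 1] show ?thesis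
    unfolding perm_act_def map_key_single_perm[OF assms] .
qed

definition op_algebra :: "mop set \<Rightarrow> mop set" where
  "op_algebra G = ospan {foldr (\<circ>) ws id |ws. ws \<in> lists G}"

definition sym_invariants :: "nat \<Rightarrow> mop set \<Rightarrow> mop set" where
  "sym_invariants i A =
     {d \<in> A. \<forall>\<sigma>. \<sigma> permutes {1..i} \<longrightarrow> perm_act \<sigma> \<circ> d \<circ> perm_act (inv \<sigma>) = d}"

section \<open>The Weyl algebra, its invariants and annihilators\<close>

text \<open>
  In characteristic 0 the Weyl algebra acts faithfully on polynomials, so it is realised as the
  algebra of operators generated by multiplications by variables and partial derivatives. The
  action of a permutation on it is then conjugation. The generators are listed with
  their degrees.
\<close>

definition weyl_gens :: "nat \<Rightarrow> (mop \<times> int) set" where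
  "weyl_gens n = (\<lambda>j. (mulx j, 1)) ` {1..n} \<union> (\<lambda>j. (pdiff j, -1)) ` {1..n}"

definition weyl :: "nat \<Rightarrow> mop set" where
  "weyl n = op_algebra (fst ` weyl_gens n)"

definition weyl_part :: "nat \<Rightarrow> int \<Rightarrow> mop set" where
  "weyl_part n k = ospan {foldr (\<circ>) (map fst ws) id |ws.
     ws \<in> lists (weyl_gens n) \<and> sum_list (map snd ws) = k}"

definition weyl_inv :: "nat \<Rightarrow> nat \<Rightarrow> mop set" where
  "weyl_inv n i = sym_invariants i (weyl n)"

definition weyl_inv_neg :: "nat \<Rightarrow> nat \<Rightarrow> mop set" where
  "weyl_inv_neg n i = ospan (\<Union>k\<in>{..<0}. weyl_inv n i \<inter> weyl_part n k)"

definition ann_neg :: "nat \<Rightarrow> nat \<Rightarrow> mpoly set \<Rightarrow> mpoly set" where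
  "ann_neg n i N = {y \<in> N. \<forall>d\<in>weyl_inv_neg n i. d y = 0}"

definition B_ann :: "nat \<Rightarrow> mpoly set" where
  "B_ann n = ann_neg n n (polys n)"

definition nabla :: "nat \<Rightarrow> mop" where
  "nabla j = mulx j \<circ> pdiff j"

definition R_alg :: "nat \<Rightarrow> mop set" where
  "R_alg i = sym_invariants i (op_algebra (nabla ` {1..i}))"

section \<open>Modules inside the polynomial ring\<close>

text \<open>Here \<open>A\<close> is a set of operators: an algebra, or the image of a group.\<close>

definition submod :: "mop set \<Rightarrow> mpoly set \<Rightarrow> bool" where
  "submod A V \<longleftrightarrow> psubspace V \<and> (\<forall>a\<in>A. \<forall>v\<in>V. a v \<in> V)"

definition mod_iso :: "mop set \<Rightarrow> mpoly set \<Rightarrow> mpoly set \<Rightarrow> bool" where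
  "mod_iso A V W \<longleftrightarrow> (\<exists>\<phi>. bij_betw \<phi> V W
     \<and> (\<forall>u\<in>V. \<forall>v\<in>V. \<phi> (u + v) = \<phi> u + \<phi> v)
     \<and> (\<forall>c. \<forall>v\<in>V. \<phi> (pscale c v) = pscale c (\<phi> v))
     \<and> (\<forall>a\<in>A. \<forall>v\<in>V. \<phi> (a v) = a (\<phi> v)))"

definition irreducible_mod :: "mop set \<Rightarrow> mpoly set \<Rightarrow> bool" where
  "irreducible_mod A V \<longleftrightarrow> submod A V \<and> V \<noteq> {0}
     \<and> (\<forall>W. W \<subseteq> V \<and> submod A W \<longrightarrow> W = {0} \<or> W = V)"

definition direct_sum :: "mpoly set set \<Rightarrow> mpoly set \<Rightarrow> bool" where
  "direct_sum \<V> M \<longleftrightarrow> pspan (\<Union>\<V>) = M \<and> (\<forall>V\<in>\<V>. V \<inter> pspan (\<Union>(\<V> - {V})) = {0})"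

text \<open>
  \<open>C\<close> is a basis of \<open>M\<close> whose lines are pairwise non-isomorphic \<open>A\<close>-modules; equivalently, \<open>M\<close> is
  the direct sum of pairwise non-isomorphic one-dimensional \<open>A\<close>-modules and \<open>C\<close> consists
  of one nonzero vector from each of them.
\<close>

definition simple_line_basis :: "mop set \<Rightarrow> mpoly set \<Rightarrow> mpoly set \<Rightarrow> bool" where
  "simple_line_basis A M C \<longleftrightarrow> \<not> pdependent C \<and> pspan C = M
     \<and> (\<forall>v\<in>C. submod A (pspan {v}))
     \<and> (\<forall>v\<in>C. \<forall>w\<in>C. v \<noteq> w \<longrightarrow> \<not> mod_iso A (pspan {v}) (pspan {w}))"

section \<open>Canonical bases\<close>

text \<open>\<open>canonical_upto n i C\<close>: the set \<open>C\<close> arises at stage \<open>i\<close> of the construction.\<close>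

inductive canonical_upto :: "nat \<Rightarrow> nat \<Rightarrow> mpoly set \<Rightarrow> bool" for n :: nat where
  base: "canonical_upto n 1 {1}"
| step: "canonical_upto n (Suc i) (\<Union>v\<in>C. F v)"
    if "canonical_upto n i C" and "Suc i \<le> n"
      and "\<And>v. v \<in> C \<Longrightarrow> finite (F v) \<and>
        simple_line_basis (R_alg (Suc i)) (ann_neg n (Suc i) ((\<lambda>d. d v) ` weyl_inv n i)) (F v)"

definition canonical_basis :: "nat \<Rightarrow> mpoly set \<Rightarrow> bool" where
  "canonical_basis n C \<longleftrightarrow> canonical_upto n n C"

section \<open>Young bases\<close>

definition sym_ops :: "nat \<Rightarrow> mop set" where
  "sym_ops n = perm_act ` {\<sigma>. \<sigma> permutes {1..n}}"

definition jucys_murphy :: "nat \<Rightarrow> mop" where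
  "jucys_murphy i p = (\<Sum>j = 1..i - 1. perm_act (transpose j i) p)"

text \<open>
  The algebra generated by the Jucys-Murphy elements, through its (faithful) action on polynomials.
\<close>

definition jm_algebra :: "nat \<Rightarrow> mop set" where
  "jm_algebra n = op_algebra (jucys_murphy ` {2..n})"

definition young_basis_irr :: "nat \<Rightarrow> mpoly set \<Rightarrow> mpoly set \<Rightarrow> bool" where
  "young_basis_irr n V Y \<longleftrightarrow> irreducible_mod (sym_ops n) V \<and> simple_line_basis (jm_algebra n) V Y"

definition young_basis :: "nat \<Rightarrow> mpoly set \<Rightarrow> bool" where
  "young_basis n Y \<longleftrightarrow> (\<exists>\<V> F. direct_sum \<V> (B_ann n)
     \<and> (\<forall>V\<in>\<V>. \<forall>W\<in>\<V>. V \<noteq> W \<longrightarrow> \<not> mod_iso (sym_ops n) V W)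
     \<and> (\<forall>V\<in>\<V>. young_basis_irr n V (F V))
     \<and> Y = (\<Union>V\<in>\<V>. F V))"

definition same_up_to_scaling :: "mpoly set \<Rightarrow> mpoly set \<Rightarrow> bool" where
  "same_up_to_scaling C Y \<longleftrightarrow>
     (\<exists>f. bij_betw f C Y \<and> (\<forall>v\<in>C. \<exists>c. c \<noteq> 0 \<and> f v = pscale c v))"

definition eigenvector :: "mop \<Rightarrow> mpoly \<Rightarrow> bool" where
  "eigenvector d v \<longleftrightarrow> v \<noteq> 0 \<and> (\<exists>c. d v = pscale c v)"

end

theory Submission
  imports Defs "HOL-Computational_Algebra.Polynomial"
begin

text \<open>
  The first step replaces the invariant differential operators by arbitrary linear operators.
  The Weyl algebra acts densely on polynomials, and averaging over the symmetric group of the first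
  \<open>i\<close> variables turns a dense algebra of operators into a dense subalgebra of the commutant of that
  group. Hence the orbit of a polynomial \<open>v\<close> under the \<open>i\<close>-th invariant algebra is the set of all \<open>T v\<close>
  with \<open>T\<close> in the commutant (\<open>weyl_inv_orbit\<close>), and a vector is annihilated by the invariants of negative
  degree iff it is killed by everything in the commutant that lowers the degree.

  In the commutant one can use operators that are not differential. As a vector space the polynomial
  ring in \<open>i\<close> variables is a tensor power of the ring in one variable, and the matrix units
  \<open>x^b \<mapsto> x^a\<close>, summed over the variables, give an action of a general linear Lie algebra (\<open>shift_op\<close>).
  The vectors annihilated by negative degree are exactly the highest weight vectors of this action
  (\<open>hw_vectors_iff\<close>); a weight is a multiset of exponents, called the type of a monomial. As in the
  theory of highest weight modules, moving degree-lowering factors to the right shows that a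
  degree-preserving element of the commutant multiplies a highest weight vector of a single type by a
  scalar (\<open>symm_munit_hw_vectors\<close>, \<open>hw_vectors_scalar\<close>). Together with averaged projections this
  makes the highest weight vectors of one type an irreducible representation, makes different types
  non-isomorphic, and shows that the orbit of a highest weight vector \<open>u\<close> of a single type contains no
  highest weight vector outside the line of \<open>u\<close>.

  The highest weight equations determine the scalar by which the sum of all transpositions acts
  (\<open>transp_sum_hw_vectors\<close>); a Jucys-Murphy element is a difference of two such sums. Symmetric
  polynomials in the Euler operators separate the types, so every canonical basis vector has a type.
  When \<open>v\<close> arises from \<open>u\<close> in the step from \<open>i\<close> to \<open>i + 1\<close>, the leading coefficient of \<open>v\<close> in the new
  variable is a multiple of \<open>u\<close>, so the type of \<open>v\<close> is that of \<open>u\<close> with one exponent \<open>c\<close> added, and the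
  new Jucys-Murphy element acts on \<open>v\<close> by the multiplicity of \<open>c\<close> in the type of \<open>u\<close> minus \<open>c\<close>: the
  content of the box added to a Young diagram with these row lengths. Multiplicities decrease in the
  exponent (\<open>hw_vectors_count_antimono\<close>), so different \<open>c\<close> give different eigenvalues. By induction a
  canonical basis consists of joint eigenvectors of the Jucys-Murphy elements with pairwise distinct
  joint eigenvalues (\<open>canonical_jm_basis\<close>). Such a basis is a Young basis, and by distinctness each
  joint eigenvector is a multiple of a member of the basis, which gives uniqueness.
\<close>

abbreviation "lookup \<equiv> Poly_Mapping.lookup"
abbreviation "keys \<equiv> Poly_Mapping.keys"

section \<open>Polynomials as functions on exponents\<close>

abbreviation plinear :: "mop \<Rightarrow> bool" where
  "plinear \<equiv> Vector_Spaces.linear pscale pscale"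

global_interpretation pp: vector_space_pair pscale pscale ..

lemma lookup_pscale [simp]: "lookup (pscale c p) m = c * lookup p m"
  unfolding pscale_def mult_map_scale_conv_mult[symmetric] by transfer (auto simp: when_def)

lemma plinearI:
  assumes "\<And>p q. T (p + q) = T p + T q" and "\<And>c p. T (pscale c p) = pscale c (T p)"
  shows "plinear T"
  using assms by unfold_locales auto

lemma plinear_compose: "plinear S \<Longrightarrow> plinear T \<Longrightarrow> plinear (\<lambda>p. S (T p))"
  by (rule plinearI) (simp_all only: pp.linear_add[of S] pp.linear_add[of T] pp.linear_scale[of S] pp.linear_scale[of T])

lemma keys_pscale: "keys (pscale c p) \<subseteq> keys p"
  by (auto simp: in_keys_iff)

definition mon :: "(nat \<Rightarrow>\<^sub>0 nat) \<Rightarrow> mpoly" where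
  "mon m = Poly_Mapping.single m 1"

lemma lookup_mon: "lookup (mon m) m' = (if m' = m then 1 else 0)"
  by (auto simp: mon_def lookup_single when_def)

lemma keys_mon [simp]: "keys (mon m) = {m}"
  by (simp add: mon_def)

lemma poly_expand:
  assumes "finite A" "keys p \<subseteq> A"
  shows "p = (\<Sum>m\<in>A. pscale (lookup p m) (mon m))"
proof (rule poly_mapping_eqI)
  fix k
  have "(\<Sum>m\<in>A. lookup p m * (if k = m then 1 else 0)) = (\<Sum>m\<in>A. if k = m then lookup p k else 0)"
    by (rule sum.cong) auto
  then show "lookup p k = lookup (\<Sum>m\<in>A. pscale (lookup p m) (mon m)) k"
    using assms by (auto simp: lookup_sum lookup_mon in_keys_iff)
qed

definition lin_ext :: "((nat \<Rightarrow>\<^sub>0 nat) \<Rightarrow> mpoly) \<Rightarrow> mop" where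
  "lin_ext g p = (\<Sum>m\<in>keys p. pscale (lookup p m) (g m))"

lemma lin_ext_superset:
  assumes "finite A" "keys p \<subseteq> A"
  shows "lin_ext g p = (\<Sum>m\<in>A. pscale (lookup p m) (g m))"
  unfolding lin_ext_def
  by (rule sum.mono_neutral_left) (use assms in \<open>auto simp: in_keys_iff\<close>)

lemma linear_lin_ext: "plinear (lin_ext g)"
proof (rule plinearI)
  fix p q :: mpoly
  let ?A = "keys p \<union> keys q"
  have "lin_ext g (p + q) = (\<Sum>m\<in>?A. pscale (lookup (p + q) m) (g m))"
    by (rule lin_ext_superset) (use Poly_Mapping.keys_add[of p q] in auto)
  also have "\<dots> = lin_ext g p + lin_ext g q"
    by (simp add: lin_ext_superset[of ?A] lookup_add pv.scale_left_distrib sum.distrib)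
  finally show "lin_ext g (p + q) = lin_ext g p + lin_ext g q" .
next
  fix c and p :: mpoly
  show "lin_ext g (pscale c p) = pscale c (lin_ext g p)"
    by (subst lin_ext_superset[of "keys p"])
       (auto simp: lin_ext_def pv.scale_sum_right keys_pscale)
qed

lemma lin_ext_mon [simp]: "lin_ext g (mon m) = g m"
  by (simp add: lin_ext_def lookup_mon)

lemma lookup_lin_ext: "lookup (lin_ext g p) k = (\<Sum>m\<in>keys p. lookup p m * lookup (g m) k)"
  by (simp add: lin_ext_def lookup_sum)

lemma plinear_expand:
  assumes "plinear T" "finite A" "keys p \<subseteq> A"
  shows "T p = (\<Sum>m\<in>A. pscale (lookup p m) (T (mon m)))"
proof -
  have "T p = T (\<Sum>m\<in>A. pscale (lookup p m) (mon m))"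
    by (rule arg_cong[OF poly_expand[OF assms(2,3)]])
  then show ?thesis
    by (simp add: pp.linear_sum[OF assms(1)] pp.linear_scale[OF assms(1)])
qed

lemma plinear_eqI:
  assumes "plinear S" "plinear T" "\<And>m. S (mon m) = T (mon m)"
  shows "S = T"
proof
  fix p
  show "S p = T p"
    by (simp add: plinear_expand[OF assms(1) finite_keys order_refl, of p]
       plinear_expand[OF assms(2) finite_keys order_refl, of p] assms(3))
qed

lemma mon_in_polys_iff [simp]: "mon m \<in> polys n \<longleftrightarrow> keys m \<subseteq> {1..n}"
  by (simp add: polys_def)

lemma polys_lookup: "p \<in> polys n \<Longrightarrow> lookup p m \<noteq> 0 \<Longrightarrow> keys m \<subseteq> {1..n}"
  by (auto simp: polys_def in_keys_iff)

lemma subspace_polys: "psubspace (polys n)"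
  by (rule pv.subspaceI)
     (auto simp: polys_def dest!: set_mp[OF Poly_Mapping.keys_add] set_mp[OF keys_pscale])

lemma polys_mono: "i \<le> n \<Longrightarrow> polys i \<subseteq> polys n"
  by (fastforce simp: polys_def)

section \<open>Coefficient filters\<close>

definition coeff_filter :: "((nat \<Rightarrow>\<^sub>0 nat) \<Rightarrow> bool) \<Rightarrow> mop" where
  "coeff_filter P = lin_ext (\<lambda>m. if P m then mon m else 0)"

lemma linear_coeff_filter: "plinear (coeff_filter P)"
  by (simp add: coeff_filter_def linear_lin_ext)

lemma lookup_coeff_filter [simp]: "lookup (coeff_filter P p) k = (if P k then lookup p k else 0)"
proof -
  have "lookup (coeff_filter P p) k = (\<Sum>m\<in>keys p. if k = m then (if P k then lookup p k else 0) else 0)"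
    unfolding coeff_filter_def lookup_lin_ext by (rule sum.cong) (auto simp: lookup_mon)
  then show ?thesis
    by (simp add: in_keys_iff)
qed

lemma coeff_filter_mon: "coeff_filter P (mon m) = (if P m then mon m else 0)"
  by (simp add: coeff_filter_def)

lemma keys_coeff_filter: "keys (coeff_filter P p) = {m \<in> keys p. P m}"
  by (auto simp: in_keys_iff split: if_splits)

lemma coeff_filter_polys: "p \<in> polys n \<Longrightarrow> coeff_filter P p \<in> polys n"
  by (auto simp: polys_def keys_coeff_filter)

lemma coeff_filter_id: "(\<And>m. m \<in> keys p \<Longrightarrow> P m) \<Longrightarrow> coeff_filter P p = p"
  by (rule poly_mapping_eqI) (auto simp: in_keys_iff)

lemma coeff_filter_eq_0: "(\<And>m. m \<in> keys p \<Longrightarrow> \<not> P m) \<Longrightarrow> coeff_filter P p = 0"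
  by (rule poly_mapping_eqI) (auto simp: in_keys_iff)

section \<open>Exponents and permutations\<close>

definition override :: "nat set \<Rightarrow> (nat \<Rightarrow> nat) \<Rightarrow> (nat \<Rightarrow>\<^sub>0 nat) \<Rightarrow> (nat \<Rightarrow>\<^sub>0 nat)" where
  "override J a m = Abs_poly_mapping (\<lambda>j. if j \<in> J then a j else lookup m j)"

lemma lookup_override: "finite J \<Longrightarrow> lookup (override J a m) j = (if j \<in> J then a j else lookup m j)"
proof -
  assume J: "finite J"
  have "finite {j. (if j \<in> J then a j else lookup m j) \<noteq> 0}"
    by (rule finite_subset[of _ "J \<union> keys m"]) (auto simp: in_keys_iff J)
  then show ?thesis
    by (simp add: override_def)
qed

abbreviation upd :: "(nat \<Rightarrow>\<^sub>0 nat) \<Rightarrow> nat \<Rightarrow> nat \<Rightarrow> (nat \<Rightarrow>\<^sub>0 nat)" where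
  "upd m l c \<equiv> override {l} (\<lambda>_. c) m"

lemma lookup_upd: "lookup (upd m l c) j = (if j = l then c else lookup m j)"
  by (simp add: lookup_override)

abbreviation mperm :: "(nat \<Rightarrow> nat) \<Rightarrow> (nat \<Rightarrow>\<^sub>0 nat) \<Rightarrow> (nat \<Rightarrow>\<^sub>0 nat)" where
  "mperm \<equiv> Poly_Mapping.map_key"

lemma lookup_mperm: "bij \<sigma> \<Longrightarrow> lookup (mperm \<sigma> m) j = lookup m (\<sigma> j)"
  by (simp add: map_key.rep_eq bij_is_inj)

lemma mperm_inv: assumes "bij \<sigma>"
  shows "mperm \<sigma> (mperm (inv \<sigma>) m) = m" "mperm (inv \<sigma>) (mperm \<sigma> m) = m"
  using assms bij_imp_bij_inv[OF assms]
  by (auto intro!: poly_mapping_eqI simp: lookup_mperm bij_is_surj bij_is_inj surj_f_inv_f inv_f_f)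

lemma bij_mperm: "bij \<sigma> \<Longrightarrow> bij (mperm \<sigma>)"
  by (rule o_bij[of "mperm (inv \<sigma>)"]) (auto simp: mperm_inv)

lemma lookup_perm_act: "bij \<sigma> \<Longrightarrow> lookup (perm_act \<sigma> p) m = lookup p (mperm \<sigma> m)"
  by (simp add: perm_act_def map_key.rep_eq bij_mperm bij_is_inj)

lemma linear_perm_act: "bij \<sigma> \<Longrightarrow> plinear (perm_act \<sigma>)"
  by (rule plinearI; rule poly_mapping_eqI) (auto simp: lookup_perm_act lookup_add)

lemma mperm_compose: "bij \<sigma> \<Longrightarrow> bij \<tau> \<Longrightarrow> mperm \<tau> (mperm \<sigma> m) = mperm (\<sigma> \<circ> \<tau>) m"
  by (rule poly_mapping_eqI) (auto simp: lookup_mperm bij_comp)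

lemma perm_act_compose:
  "bij \<sigma> \<Longrightarrow> bij \<tau> \<Longrightarrow> perm_act \<sigma> (perm_act \<tau> p) = perm_act (\<sigma> \<circ> \<tau>) p"
  by (rule poly_mapping_eqI) (auto simp: lookup_perm_act bij_comp mperm_compose)

lemma perm_act_inv: assumes "bij \<sigma>"
  shows "perm_act \<sigma> (perm_act (inv \<sigma>) p) = p" "perm_act (inv \<sigma>) (perm_act \<sigma> p) = p"
  by (rule poly_mapping_eqI, use assms in \<open>simp add: lookup_perm_act mperm_inv bij_imp_bij_inv\<close>)+

lemma perm_act_mon: "bij \<sigma> \<Longrightarrow> perm_act \<sigma> (mon m) = mon (mperm (inv \<sigma>) m)"
  by (rule poly_mapping_eqI) (metis lookup_mon lookup_perm_act mperm_inv)

lemma keys_perm_act: "bij \<sigma> \<Longrightarrow> m \<in> keys (perm_act \<sigma> p) \<longleftrightarrow> mperm \<sigma> m \<in> keys p"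
  by (simp add: in_keys_iff lookup_perm_act)

lemma keys_mperm_subset:
  assumes "\<sigma> permutes {1..i}" "i \<le> n"
  shows "keys (mperm \<sigma> m) \<subseteq> {1..n} \<longleftrightarrow> keys m \<subseteq> {1..n}"
proof -
  have "\<sigma> permutes {1..n}"
    by (rule permutes_subset[OF assms(1)]) (use assms(2) in auto)
  have "keys (mperm \<sigma> m) = \<sigma> -` keys m"
    by (simp add: keys_map_key permutes_inj[OF assms(1)])
  then show ?thesis
    using \<open>\<sigma> permutes {1..n}\<close> permutes_in_image[OF \<open>\<sigma> permutes {1..n}\<close>]
      permutes_surj[OF \<open>\<sigma> permutes {1..n}\<close>]
    by (metis permutes_image permutes_inj surj_image_vimage_eq vimage_mono image_mono inj_vimage_image_eq)
qed

lemma perm_act_polys: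
  assumes "\<sigma> permutes {1..i}" "i \<le> n" "p \<in> polys n"
  shows "perm_act \<sigma> p \<in> polys n"
  unfolding polys_def mem_Collect_eq
proof (intro ballI)
  fix m assume "m \<in> keys (perm_act \<sigma> p)"
  then have "mperm \<sigma> m \<in> keys p"
    by (simp add: keys_perm_act permutes_bij[OF assms(1)])
  then show "keys m \<subseteq> {1..n}"
    using assms(3) keys_mperm_subset[OF assms(1,2), of m] unfolding polys_def by blast
qed

(* Keeps the bounds of the intervals {1..i} in this form during simplification. *)
declare One_nat_def [simp del]

section \<open>The commutant of a symmetric group and averaging\<close>

abbreviation perms :: "nat \<Rightarrow> (nat \<Rightarrow> nat) set" where
  "perms i \<equiv> {\<sigma>. \<sigma> permutes {1..i}}"

lemma finite_perms [simp]: "finite (perms i)"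
  by (simp add: finite_permutations)

lemma perms_mono: "\<sigma> permutes {1..i} \<Longrightarrow> i \<le> n \<Longrightarrow> \<sigma> permutes {1..n::nat}"
  by (rule permutes_subset[of \<sigma> "{1..i}"]) auto

definition equivariant :: "nat \<Rightarrow> mop \<Rightarrow> bool" where
  "equivariant i T \<longleftrightarrow> plinear T \<and>
     (\<forall>\<sigma> p. \<sigma> permutes {1..i} \<longrightarrow> T (perm_act \<sigma> p) = perm_act \<sigma> (T p))"

text \<open>
  The operators commuting with the permutations of the first \<open>i\<close> variables. They are defined on polynomials in
  infinitely many variables, so it has to be required that they preserve those in \<open>n\<close> variables.
\<close>

definition commutant :: "nat \<Rightarrow> nat \<Rightarrow> mop set" where
  "commutant n i = {T. equivariant i T \<and> (\<forall>p\<in>polys n. T p \<in> polys n)}"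

lemma commutant_linear: "T \<in> commutant n i \<Longrightarrow> plinear T"
  and commutant_perm: "T \<in> commutant n i \<Longrightarrow> \<sigma> permutes {1..i} \<Longrightarrow> T (perm_act \<sigma> p) = perm_act \<sigma> (T p)"
  and commutant_polys: "T \<in> commutant n i \<Longrightarrow> p \<in> polys n \<Longrightarrow> T p \<in> polys n"
  by (auto simp: commutant_def equivariant_def)

lemma commutantI:
  assumes "plinear T" "\<And>\<sigma> p. \<sigma> permutes {1..i} \<Longrightarrow> T (perm_act \<sigma> p) = perm_act \<sigma> (T p)"
    "\<And>p. p \<in> polys n \<Longrightarrow> T p \<in> polys n"
  shows "T \<in> commutant n i"
  using assms by (auto simp: commutant_def equivariant_def)

lemma commutant_compose: "S \<in> commutant n i \<Longrightarrow> T \<in> commutant n i \<Longrightarrow> (\<lambda>p. S (T p)) \<in> commutant n i"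
  by (rule commutantI) (auto simp: commutant_perm commutant_polys intro: plinear_compose commutant_linear)

lemma commutant_id: "(\<lambda>p. p) \<in> commutant n i"
  by (rule commutantI) (auto intro: plinearI)

lemma commutant_diff:
  assumes "S \<in> commutant n i" "T \<in> commutant n i" shows "(\<lambda>p. S p - T p) \<in> commutant n i"
proof (rule commutantI)
  show "plinear (\<lambda>p. S p - T p)"
    by (rule pp.linear_compose_sub) (use assms commutant_linear in auto)
  show "S p - T p \<in> polys n" if "p \<in> polys n" for p
    by (rule pv.subspace_diff[OF subspace_polys]) (use that assms commutant_polys in auto)
  show "S (perm_act \<sigma> p) - T (perm_act \<sigma> p) = perm_act \<sigma> (S p - T p)" if "\<sigma> permutes {1..i}" for \<sigma> p
    using commutant_perm[OF assms(1) that] commutant_perm[OF assms(2) that]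
      pp.linear_diff[OF linear_perm_act[OF permutes_bij[OF that]]] by simp
qed

definition symm :: "nat \<Rightarrow> mop \<Rightarrow> mop" where
  "symm i X f = (\<Sum>\<sigma>\<in>perms i. perm_act \<sigma> (X (perm_act (inv \<sigma>) f)))"

definition average :: "nat \<Rightarrow> mop \<Rightarrow> mop" where
  "average i X f = pscale (1 / of_nat (card (perms i))) (symm i X f)"

lemma card_perms_pos: "card (perms i) > 0"
  by (simp add: card_permutations[of "{1..i}" i])

lemma symm_perm_act:
  assumes X: "plinear X" and \<tau>: "\<tau> permutes {1..i}"
  shows "symm i X (perm_act \<tau> f) = perm_act \<tau> (symm i X f)"
proof -
  have "symm i X (perm_act \<tau> f) =
      (\<Sum>\<sigma>\<in>perms i. perm_act (\<tau> \<circ> \<sigma>) (X (perm_act (inv (\<tau> \<circ> \<sigma>)) (perm_act \<tau> f))))"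
    unfolding symm_def by (rule setum_permutations_compose_left[OF \<tau>])
  also have "\<dots> = (\<Sum>\<sigma>\<in>perms i. perm_act \<tau> (perm_act \<sigma> (X (perm_act (inv \<sigma>) f))))"
  proof (rule sum.cong[OF refl])
    fix \<sigma> assume "\<sigma> \<in> perms i"
    then have b: "bij \<sigma>" "bij \<tau>" "bij (inv \<sigma>)" "bij (inv \<tau>)"
      using \<tau> by (auto simp: permutes_bij bij_imp_bij_inv)
    have "perm_act (inv (\<tau> \<circ> \<sigma>)) (perm_act \<tau> f) = perm_act (inv \<sigma>) f"
      by (simp only: o_inv_distrib[OF b(2,1)] perm_act_compose[OF b(3,4), symmetric]
          perm_act_inv[OF b(2)])
    then show "perm_act (\<tau> \<circ> \<sigma>) (X (perm_act (inv (\<tau> \<circ> \<sigma>)) (perm_act \<tau> f)))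
        = perm_act \<tau> (perm_act \<sigma> (X (perm_act (inv \<sigma>) f)))"
      by (simp only: perm_act_compose[OF b(2,1), symmetric])
  qed
  also have "\<dots> = perm_act \<tau> (symm i X f)"
    unfolding symm_def by (rule pp.linear_sum[OF linear_perm_act, symmetric]) (rule permutes_bij[OF \<tau>])
  finally show ?thesis .
qed

lemma linear_symm: "plinear X \<Longrightarrow> plinear (symm i X)"
  unfolding symm_def
  by (rule pp.linear_compose_sum)
     (auto intro!: plinear_compose[of X "perm_act (inv _)"] plinear_compose[of "perm_act _"]
        linear_perm_act permutes_bij bij_imp_bij_inv)

lemma average_equivariant: "plinear X \<Longrightarrow> equivariant i (average i X)"
  unfolding equivariant_def average_def
  by (auto intro!: pp.linear_compose_scale_right linear_symm
      simp: symm_perm_act pp.linear_scale[OF linear_perm_act[OF permutes_bij]])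

lemma average_eqI:
  assumes "\<And>\<sigma>. \<sigma> permutes {1..i} \<Longrightarrow> perm_act \<sigma> (X (perm_act (inv \<sigma>) f)) = g"
  shows "average i X f = g"
proof -
  have "symm i X f = (\<Sum>\<sigma>\<in>perms i. g)"
    unfolding symm_def by (rule sum.cong) (auto simp: assms)
  also have "\<dots> = pscale (of_nat (card (perms i))) g"
    by (rule pv.sum_constant_scale)
  finally have "average i X f = pscale (1 / of_nat (card (perms i)) * of_nat (card (perms i))) g"
    by (simp only: average_def pv.scale_scale)
  moreover have "of_nat (card (perms i)) \<noteq> (0::complex)"
    using card_perms_pos[of i] by (simp only: of_nat_eq_0_iff)
  ultimately show ?thesis
    by (simp only: mult_1 times_divide_eq_left divide_self[OF \<open>of_nat (card (perms i)) \<noteq> (0::complex)\<close>] pv.scale_one)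
qed

text \<open>
  Averaging a linear projection over the group keeps it a projection, since the subspace is
  stable; this is complete reducibility.
\<close>

lemma equivariant_projection:
  assumes W: "psubspace W" "\<And>\<sigma> w. \<sigma> permutes {1..i} \<Longrightarrow> w \<in> W \<Longrightarrow> perm_act \<sigma> w \<in> W"
  obtains P where "equivariant i P" "\<And>p. P p \<in> W" "\<And>w. w \<in> W \<Longrightarrow> P w = w"
proof -
  have "plinear (\<lambda>p. p)" by (rule plinearI) auto
  from pp.linear_exists_left_inverse_on[OF this W(1)]
  obtain P0 where P0: "plinear P0" "\<And>p. P0 p \<in> W" "\<And>w. w \<in> W \<Longrightarrow> P0 w = w"
    by auto
  show thesis
  proof
    show "equivariant i (average i P0)" by (rule average_equivariant[OF P0(1)])
    show "average i P0 p \<in> W" for p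
      unfolding average_def symm_def
      by (intro pv.subspace_scale[OF W(1)] pv.subspace_sum[OF W(1)] W(2) P0(2)) simp
    show "average i P0 w = w" if "w \<in> W" for w
      by (rule average_eqI) (simp add: P0(3) W(2) that permutes_inv perm_act_inv permutes_bij)
  qed
qed

lemma commutant_coeff_filter:
  assumes "i \<le> n" "\<And>\<sigma> m. \<sigma> permutes {1..i} \<Longrightarrow> P (mperm \<sigma> m) = P m"
  shows "coeff_filter P \<in> commutant n i"
proof (rule commutantI)
  show "coeff_filter P (perm_act \<sigma> p) = perm_act \<sigma> (coeff_filter P p)" if "\<sigma> permutes {1..i}" for \<sigma> p
    by (rule poly_mapping_eqI) (simp add: lookup_perm_act permutes_bij[OF that] assms(2)[OF that])
qed (auto simp: linear_coeff_filter coeff_filter_polys)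

text \<open>
  The commutant is a von Neumann regular ring: any linear map \<open>M\<close> has a generalised inverse \<open>S0\<close> with
  \<open>M \<circ> S0 \<circ> M = M\<close>, and averaging \<open>S0\<close> preserves this identity because \<open>M\<close> commutes with the group.
  This replaces arguments with kernels, images and complements of equivariant maps.
\<close>

lemma commutant_regular:
  assumes "i \<le> n" and M: "M \<in> commutant n i"
  obtains S where "S \<in> commutant n i" "\<And>p. p \<in> polys n \<Longrightarrow> M (S (M p)) = M p"
proof -
  (* A generalised inverse need not preserve the polynomials in n variables, so it is cut down by the
     projection onto them. *)
  let ?r = "coeff_filter (\<lambda>m. keys m \<subseteq> {1..n})"
  have r: "?r \<in> commutant n i"
    by (rule commutant_coeff_filter[OF assms(1)]) (simp add: keys_mperm_subset[OF _ assms(1)])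
  have rp: "?r p = p" if "p \<in> polys n" for p
    by (rule coeff_filter_id) (use that in \<open>auto simp: polys_def\<close>)
  have rin: "?r p \<in> polys n" for p
    by (auto simp: polys_def keys_coeff_filter)
  let ?M = "\<lambda>p. M (?r p)"
  have M': "?M \<in> commutant n i" by (rule commutant_compose[OF M r])
  from pp.linear_exists_right_inverse_on[OF commutant_linear[OF M'] pv.subspace_UNIV]
  obtain S0 where S0: "plinear S0" "\<And>p. ?M (S0 (?M p)) = ?M p"
    by auto
  show thesis
  proof
    show "(\<lambda>p. ?r (average i S0 p)) \<in> commutant n i"
    proof (rule commutantI)
      show "plinear (\<lambda>p. ?r (average i S0 p))"
        using average_equivariant[OF S0(1), of i] linear_coeff_filter
        by (auto simp: equivariant_def intro: plinear_compose)
      show "?r (average i S0 (perm_act \<sigma> p)) = perm_act \<sigma> (?r (average i S0 p))"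
        if "\<sigma> permutes {1..i}" for \<sigma> p
        using average_equivariant[OF S0(1), of i] that by (simp add: equivariant_def commutant_perm[OF r])
    qed (rule rin)
    fix p assume p: "p \<in> polys n"
    have "M (?r (average i S0 (M p))) = average i (\<lambda>q. ?M (S0 (?M q))) p"
    proof -
      have "?M (symm i S0 (?M p)) = symm i (\<lambda>q. ?M (S0 (?M q))) p"
        unfolding symm_def pp.linear_sum[OF commutant_linear[OF M']]
      proof (rule sum.cong[OF refl])
        fix \<sigma> assume "\<sigma> \<in> perms i"
        then have \<sigma>: "\<sigma> permutes {1..i}" "inv \<sigma> permutes {1..i}" by (auto intro: permutes_inv)
        show "?M (perm_act \<sigma> (S0 (perm_act (inv \<sigma>) (?M p)))) =
            perm_act \<sigma> (?M (S0 (?M (perm_act (inv \<sigma>) p))))"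
          by (simp only: commutant_perm[OF M' \<sigma>(1)] commutant_perm[OF M' \<sigma>(2)])
      qed
      then show ?thesis
        by (simp add: average_def pp.linear_scale[OF commutant_linear[OF M']] rp[OF p])
    qed
    also have "\<dots> = average i ?M p"
      by (simp add: S0(2))
    also have "\<dots> = M p"
      by (rule average_eqI)
         (simp only: commutant_perm[OF M', symmetric] perm_act_inv permutes_bij rp[OF p])
    finally show "M (?r (average i S0 (M p))) = M p" .
  qed
qed

section \<open>Degrees\<close>

text \<open>
  Only the variables 1 to \<open>n\<close> are counted, so that multiplication by one of them and its derivative
  change the degree of every monomial by exactly 1.
\<close>

definition deg :: "nat \<Rightarrow> (nat \<Rightarrow>\<^sub>0 nat) \<Rightarrow> nat" where
  "deg n m = (\<Sum>j\<in>{1..n}. lookup m j)"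

lemma deg_mperm:
  assumes "\<sigma> permutes {1..i}" "i \<le> n" shows "deg n (mperm \<sigma> m) = deg n m"
proof -
  have s: "\<sigma> permutes {1..n}" using perms_mono[OF assms] .
  show ?thesis
    unfolding deg_def lookup_mperm[OF permutes_bij[OF s]]
    using sum.permute[OF s, of "lookup m"] by (simp add: o_def)
qed

definition homog :: "nat \<Rightarrow> int \<Rightarrow> mop \<Rightarrow> bool" where
  "homog n k T \<longleftrightarrow> (\<forall>m m'. lookup (T (mon m)) m' \<noteq> 0 \<longrightarrow> int (deg n m') = int (deg n m) + k)"

lemma homogD: "homog n k T \<Longrightarrow> lookup (T (mon m)) m' \<noteq> 0 \<Longrightarrow> int (deg n m') = int (deg n m) + k"
  by (auto simp: homog_def)

lemma homog_apply:
  assumes "homog n k T" "plinear T" "\<And>m. m \<in> keys p \<Longrightarrow> deg n m = d" "m' \<in> keys (T p)"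
  shows "int (deg n m') = int d + k"
proof -
  have "lookup (T p) m' = (\<Sum>m\<in>keys p. lookup p m * lookup (T (mon m)) m')"
    by (subst plinear_expand[OF assms(2) finite_keys order_refl]) (simp add: lookup_sum)
  moreover have "lookup (T p) m' \<noteq> 0" using assms(4) by (simp add: in_keys_iff)
  ultimately obtain m where "m \<in> keys p" "lookup (T (mon m)) m' \<noteq> 0"
    by (metis (no_types, lifting) mult_zero_right sum.neutral)
  then show ?thesis
    using assms(1,3) by (auto dest: homogD)
qed

abbreviation deg_part :: "nat \<Rightarrow> nat \<Rightarrow> mop" where
  "deg_part n d \<equiv> coeff_filter (\<lambda>m. deg n m = d)"

lemma commutant_deg_part: "i \<le> n \<Longrightarrow> deg_part n d \<in> commutant n i"
  by (rule commutant_coeff_filter) (simp_all add: deg_mperm)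

lemma homog_deg_part:
  assumes "plinear T" shows "homog n (int e - int d) (\<lambda>p. deg_part n e (T (deg_part n d p)))"
  by (auto simp: homog_def coeff_filter_mon pp.linear_0[OF assms] split: if_splits)

section \<open>Matrix units in several variables\<close>

text \<open>
  The tensor product, over the positions \<open>j\<close> in \<open>J\<close>, of the one-variable matrix units that send the
  power \<open>\<beta> j\<close> to the power \<open>\<alpha> j\<close> and all other powers to 0.
\<close>

definition munit :: "nat set \<Rightarrow> (nat \<Rightarrow> nat) \<Rightarrow> (nat \<Rightarrow> nat) \<Rightarrow> mop" where
  "munit J \<alpha> \<beta> = lin_ext (\<lambda>m. if \<forall>j\<in>J. lookup m j = \<beta> j then mon (override J \<alpha> m) else 0)"

lemma linear_munit: "plinear (munit J \<alpha> \<beta>)"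
  by (simp add: munit_def linear_lin_ext)

lemma lookup_munit:
  assumes "finite J"
  shows "lookup (munit J \<alpha> \<beta> p) m = (if \<forall>j\<in>J. lookup m j = \<alpha> j then lookup p (override J \<beta> m) else 0)"
proof -
  have *: "((\<forall>j\<in>J. lookup k j = \<beta> j) \<and> m = override J \<alpha> k) \<longleftrightarrow>
      (\<forall>j\<in>J. lookup m j = \<alpha> j) \<and> k = override J \<beta> m" for k
    by (auto simp: poly_mapping_eq_iff fun_eq_iff lookup_override[OF assms])
  have "lookup (munit J \<alpha> \<beta> p) m = (\<Sum>k\<in>keys p. if k = override J \<beta> m then
      (if \<forall>j\<in>J. lookup m j = \<alpha> j then lookup p k else 0) else 0)"
    unfolding munit_def lookup_lin_ext
    by (rule sum.cong) (use * in \<open>auto simp: lookup_mon\<close>)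
  then show ?thesis
    by (simp add: in_keys_iff)
qed

lemma munit_cong:
  assumes "finite J" "\<And>j. j \<in> J \<Longrightarrow> \<alpha> j = \<alpha>' j" "\<And>j. j \<in> J \<Longrightarrow> \<beta> j = \<beta>' j"
  shows "munit J \<alpha> \<beta> = munit J \<alpha>' \<beta>'"
proof
  fix p
  have "override J \<beta> m = override J \<beta>' m" for m
    by (rule poly_mapping_eqI) (simp add: lookup_override assms)
  then show "munit J \<alpha> \<beta> p = munit J \<alpha>' \<beta>' p"
    by (intro poly_mapping_eqI) (simp add: lookup_munit assms)
qed

lemma munit_conj:
  assumes "finite J" "bij \<tau>"
  shows "perm_act \<tau> (munit J \<alpha> \<beta> (perm_act (inv \<tau>) p)) = munit (\<tau> ` J) (\<alpha> \<circ> inv \<tau>) (\<beta> \<circ> inv \<tau>) p"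
proof (rule poly_mapping_eqI)
  fix m
  have b: "bij (inv \<tau>)" by (rule bij_imp_bij_inv[OF assms(2)])
  have i: "inv \<tau> (\<tau> x) = x" "\<tau> (inv \<tau> x) = x" for x
    using assms(2) by (simp_all add: bij_is_inj bij_is_surj surj_f_inv_f)
  have mem: "inv \<tau> k \<in> J \<longleftrightarrow> k \<in> \<tau> ` J" for k
    using i by (metis image_iff)
  have "mperm (inv \<tau>) (override J \<beta> (mperm \<tau> m)) = override (\<tau> ` J) (\<beta> \<circ> inv \<tau>) m"
    by (rule poly_mapping_eqI) (simp add: lookup_mperm assms b lookup_override i mem)
  then show "lookup (perm_act \<tau> (munit J \<alpha> \<beta> (perm_act (inv \<tau>) p))) m =
      lookup (munit (\<tau> ` J) (\<alpha> \<circ> inv \<tau>) (\<beta> \<circ> inv \<tau>) p) m"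
    by (simp add: lookup_perm_act lookup_munit lookup_mperm assms b i)
qed

text \<open>
  The action of the matrix unit with indices \<open>a\<close>, \<open>b\<close> of the general linear Lie algebra on a tensor
  power: in the variables 1 to \<open>i\<close>, one exponent \<open>b\<close> is changed to \<open>a\<close> in all possible ways.
\<close>

definition shift_op :: "nat \<Rightarrow> nat \<Rightarrow> nat \<Rightarrow> mop" where
  "shift_op i a b p = (\<Sum>l\<in>{1..i}. munit {l} (\<lambda>_. a) (\<lambda>_. b) p)"

lemma linear_shift_op: "plinear (shift_op i a b)"
  unfolding shift_op_def by (rule pp.linear_compose_sum) (simp add: linear_munit)

lemma lookup_shift_op:
  "lookup (shift_op i a b p) m = (\<Sum>l\<in>{1..i}. if lookup m l = a then lookup p (upd m l b) else 0)"
  by (simp add: shift_op_def lookup_sum lookup_munit)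

lemma shift_op_perm_act:
  assumes "\<sigma> permutes {1..i}"
  shows "shift_op i a b (perm_act \<sigma> p) = perm_act \<sigma> (shift_op i a b p)"
proof (rule poly_mapping_eqI)
  fix m
  have b: "bij \<sigma>" by (rule permutes_bij[OF assms])
  have "upd (mperm \<sigma> m) l b = mperm \<sigma> (upd m (\<sigma> l) b)" for l
    by (rule poly_mapping_eqI) (simp add: lookup_mperm b lookup_upd bij_is_inj inj_eq)
  then have "lookup (perm_act \<sigma> (shift_op i a b p)) m =
     (\<Sum>l\<in>{1..i}. (\<lambda>l. if lookup m l = a then lookup p (mperm \<sigma> (upd m l b)) else 0) (\<sigma> l))"
    by (simp add: lookup_perm_act lookup_shift_op lookup_mperm b cong: if_cong)
  also have "\<dots> = (\<Sum>l\<in>{1..i}. if lookup m l = a then lookup p (mperm \<sigma> (upd m l b)) else 0)"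
    using sum.permute[OF assms, of "\<lambda>l. if lookup m l = a then lookup p (mperm \<sigma> (upd m l b)) else 0"]
    by (simp add: o_def)
  finally show "lookup (shift_op i a b (perm_act \<sigma> p)) m = lookup (perm_act \<sigma> (shift_op i a b p)) m"
    by (simp add: lookup_perm_act lookup_shift_op lookup_mperm b cong: if_cong)
qed

text \<open>
  Either the shifted position lies outside \<open>J\<close>, and the tensor product gets one more factor, or it lies
  in \<open>J\<close> and two matrix units in the same variable are multiplied. The extra terms of the second kind
  have fewer factors, which drives the reordering argument in \<open>symm_munit_hw_vectors\<close>.
\<close>

lemma munit_shift_op:
  assumes "finite J"
  shows "munit J \<alpha> \<beta> (shift_op i a b f) =
    (\<Sum>l\<in>{1..i}-J. munit (insert l J) (\<alpha>(l := a)) (\<beta>(l := b)) f) +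
    (\<Sum>l\<in>{l\<in>{1..i} \<inter> J. \<beta> l = a}. munit J \<alpha> (\<beta>(l := b)) f)"
proof (rule poly_mapping_eqI)
  fix m
  let ?A = "\<forall>j\<in>J. lookup m j = \<alpha> j"
  let ?g = "\<lambda>l. if lookup (override J \<beta> m) l = a then lookup f (upd (override J \<beta> m) l b) else 0"
  have 1: "(if ?A then ?g l else 0) = lookup (munit (insert l J) (\<alpha>(l := a)) (\<beta>(l := b)) f) m"
    if "l \<in> {1..i} - J" for l
  proof -
    have "upd (override J \<beta> m) l b = override (insert l J) (\<beta>(l := b)) m"
      by (rule poly_mapping_eqI) (use that in \<open>auto simp: lookup_override assms\<close>)
    then show ?thesis
      using that by (auto simp: lookup_munit assms lookup_override)
  qed
  have 2: "(if ?A then ?g l else 0) = (if \<beta> l = a then lookup (munit J \<alpha> (\<beta>(l := b)) f) m else 0)"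
    if "l \<in> {1..i} \<inter> J" for l
  proof -
    have "upd (override J \<beta> m) l b = override J (\<beta>(l := b)) m"
      by (rule poly_mapping_eqI) (use that in \<open>auto simp: lookup_override assms\<close>)
    then show ?thesis
      using that by (auto simp: lookup_munit assms lookup_override)
  qed
  have "lookup (munit J \<alpha> \<beta> (shift_op i a b f)) m = (\<Sum>l\<in>{1..i}. if ?A then ?g l else 0)"
    unfolding lookup_munit[OF assms] lookup_shift_op
    by (cases ?A) (simp_all only: if_P if_not_P if_True if_False sum.neutral_const)
  also have "\<dots> = (\<Sum>l\<in>{1..i}-J. if ?A then ?g l else 0) + (\<Sum>l\<in>{1..i}\<inter>J. if ?A then ?g l else 0)"
    by (subst sum.Int_Diff[of _ _ J]) (simp_all add: add.commute)
  also have "(\<Sum>l\<in>{1..i}-J. if ?A then ?g l else 0) =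
      (\<Sum>l\<in>{1..i}-J. lookup (munit (insert l J) (\<alpha>(l := a)) (\<beta>(l := b)) f) m)"
    by (rule sum.cong) (use 1 in auto)
  also have "(\<Sum>l\<in>{1..i}\<inter>J. if ?A then ?g l else 0) =
      (\<Sum>l\<in>{1..i}\<inter>J. if \<beta> l = a then lookup (munit J \<alpha> (\<beta>(l := b)) f) m else 0)"
    by (rule sum.cong) (use 2 in auto)
  also have "\<dots> = (\<Sum>l\<in>{l\<in>{1..i}\<inter>J. \<beta> l = a}. lookup (munit J \<alpha> (\<beta>(l := b)) f) m)"
    by (rule sum.inter_filter[symmetric]) simp
  finally show "lookup (munit J \<alpha> \<beta> (shift_op i a b f)) m =
      lookup ((\<Sum>l\<in>{1..i}-J. munit (insert l J) (\<alpha>(l := a)) (\<beta>(l := b)) f) +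
    (\<Sum>l\<in>{l\<in>{1..i} \<inter> J. \<beta> l = a}. munit J \<alpha> (\<beta>(l := b)) f)) m"
    by (simp only: lookup_add lookup_sum)
qed

lemma symm_conj:
  assumes "\<tau> permutes {1..i}"
  shows "symm i (\<lambda>f. perm_act \<tau> (X (perm_act (inv \<tau>) f))) f = symm i X f"
proof -
  have "symm i X f = (\<Sum>\<sigma>\<in>perms i. perm_act (\<sigma> \<circ> \<tau>) (X (perm_act (inv (\<sigma> \<circ> \<tau>)) f)))"
    unfolding symm_def by (rule sum_permutations_compose_right[OF assms])
  also have "\<dots> = (\<Sum>\<sigma>\<in>perms i. perm_act \<sigma> (perm_act \<tau> (X (perm_act (inv \<tau>) (perm_act (inv \<sigma>) f)))))"
  proof (rule sum.cong[OF refl])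
    fix \<sigma> assume "\<sigma> \<in> perms i"
    then have b: "bij \<sigma>" "bij \<tau>" "bij (inv \<sigma>)" "bij (inv \<tau>)"
      using assms by (auto simp: permutes_bij bij_imp_bij_inv)
    show "perm_act (\<sigma> \<circ> \<tau>) (X (perm_act (inv (\<sigma> \<circ> \<tau>)) f)) =
       perm_act \<sigma> (perm_act \<tau> (X (perm_act (inv \<tau>) (perm_act (inv \<sigma>) f))))"
      by (simp only: o_inv_distrib[OF b(1,2)] perm_act_compose b)
  qed
  finally show ?thesis by (simp add: symm_def)
qed

text \<open>
  After symmetrization it does not matter which variable carries a factor.
\<close>

lemma symm_munit_transpose:
  assumes "finite J" "k \<in> {1..i}" "k \<notin> J" "l \<in> {1..i}" "l \<notin> J"
  shows "symm i (munit (insert l J) (\<alpha>(l := a)) (\<beta>(l := b))) f = symm i (munit (insert k J) (\<alpha>(k := a)) (\<beta>(k := b))) f"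
proof -
  let ?\<tau> = "transpose k l"
  have \<tau>: "?\<tau> permutes {1..i}" by (rule permutes_swap_id[OF assms(2,4)])
  have im: "?\<tau> ` insert k J = insert l J"
    using assms(3,5) by (force simp: transpose_def image_iff)
  have "munit (insert l J) (\<alpha>(l := a)) (\<beta>(l := b)) =
     munit (?\<tau> ` insert k J) (\<alpha>(k := a) \<circ> inv ?\<tau>) (\<beta>(k := b) \<circ> inv ?\<tau>)"
    unfolding im
    by (rule munit_cong) (use assms in \<open>auto simp: transpose_def\<close>)
  also have "\<dots> = (\<lambda>f. perm_act ?\<tau> (munit (insert k J) (\<alpha>(k := a)) (\<beta>(k := b)) (perm_act (inv ?\<tau>) f)))"
    by (rule ext, rule munit_conj[symmetric]) (use assms \<tau> in \<open>auto intro: permutes_bij\<close>)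
  finally show ?thesis
    using symm_conj[OF \<tau>] by simp
qed

section \<open>Types of exponents\<close>

text \<open>
  The multiset of exponents is the weight of a monomial for the action by \<open>shift_op\<close>; it determines the
  orbit of a monomial in these variables under permutations.
\<close>

definition exp_type :: "nat \<Rightarrow> (nat \<Rightarrow>\<^sub>0 nat) \<Rightarrow> nat multiset" where
  "exp_type i m = image_mset (lookup m) (mset_set {1..i})"

definition typed :: "nat \<Rightarrow> nat multiset \<Rightarrow> mpoly \<Rightarrow> bool" where
  "typed i t f \<longleftrightarrow> (\<forall>m\<in>keys f. exp_type i m = t)"

lemma exp_type_mperm:
  assumes "\<sigma> permutes {1..i}" shows "exp_type i (mperm \<sigma> m) = exp_type i m"
proof -
  have "exp_type i (mperm \<sigma> m) = image_mset (lookup m) (image_mset \<sigma> (mset_set {1..i}))"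
  proof -
    have "lookup (mperm \<sigma> m) = lookup m \<circ> \<sigma>"
      by (rule ext) (simp add: lookup_mperm permutes_bij[OF assms])
    then show ?thesis
      by (simp only: exp_type_def multiset.map_comp)
  qed
  also have "image_mset \<sigma> (mset_set {1..i}) = mset_set {1..i}"
    using assms by (simp add: image_mset_mset_set permutes_inj_on permutes_image)
  finally show ?thesis by (simp add: exp_type_def)
qed

lemma same_exp_type_perm:
  assumes "exp_type i m = exp_type i m'" "keys m \<subseteq> {1..i}" "keys m' \<subseteq> {1..i}"
  obtains \<tau> where "\<tau> permutes {1..i}" "mperm \<tau> m = m'"
proof -
  have "image_mset (lookup m') (mset_set {1..i}) = image_mset (lookup m) (mset_set {1..i})"
    using assms(1) by (simp only: exp_type_def)
  then obtain p where p: "p permutes {1..i}" "\<forall>x\<in>{1..i}. lookup m' x = lookup m (p x)"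
    by (rule image_mset_eq_implies_permutes[OF finite_atLeastAtMost])
  have "mperm p m = m'"
  proof (rule poly_mapping_eqI)
    fix x
    show "lookup (mperm p m) x = lookup m' x"
    proof (cases "x \<in> {1..i}")
      case False
      then have "p x \<notin> {1..i}" using permutes_in_image[OF p(1)] by blast
      then show ?thesis
        using False assms(2,3)
        by (metis in_keys_iff lookup_mperm permutes_bij[OF p(1)] subset_iff)
    qed (use p in \<open>simp add: lookup_mperm permutes_bij[OF p(1)]\<close>)
  qed
  with p(1) show thesis ..
qed

lemma deg_exp_type: "keys m \<subseteq> {1..i} \<Longrightarrow> i \<le> n \<Longrightarrow> deg n m = sum_mset (exp_type i m)"
proof -
  assume "keys m \<subseteq> {1..i}" "i \<le> n"
  then have "deg n m = (\<Sum>j\<in>{1..i}. lookup m j)"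
    unfolding deg_def by (intro sum.mono_neutral_right) (auto simp: in_keys_iff)
  then show ?thesis by (simp add: exp_type_def sum_unfold_sum_mset)
qed

section \<open>Highest weight vectors and the commutant\<close>

text \<open>
  For \<open>a < b\<close> the operator \<open>shift_op i a b\<close> lowers the degree; these are the positive root vectors of
  the general linear Lie algebra.
\<close>

definition hw_vectors :: "nat \<Rightarrow> mpoly set" where
  "hw_vectors i = {f \<in> polys i. \<forall>a b. a < b \<longrightarrow> shift_op i a b f = 0}"

lemma hw_vectors_polys: "f \<in> hw_vectors i \<Longrightarrow> f \<in> polys i"
  and hw_vectors_shift_op: "f \<in> hw_vectors i \<Longrightarrow> a < b \<Longrightarrow> shift_op i a b f = 0"
  by (auto simp: hw_vectors_def)

lemma subspace_hw_vectors: "psubspace (hw_vectors i)"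
proof (rule pv.subspaceI)
  show "0 \<in> hw_vectors i"
    by (simp add: hw_vectors_def pv.subspace_0[OF subspace_polys] pp.linear_0[OF linear_shift_op])
  show "x + y \<in> hw_vectors i" if "x \<in> hw_vectors i" "y \<in> hw_vectors i" for x y
    using that by (simp add: hw_vectors_def pv.subspace_add[OF subspace_polys] pp.linear_add[OF linear_shift_op])
  show "pscale c x \<in> hw_vectors i" if "x \<in> hw_vectors i" for c x
    using that by (simp add: hw_vectors_def pv.subspace_scale[OF subspace_polys] pp.linear_scale[OF linear_shift_op])
qed

lemma hw_vectors_perm_act:
  assumes "\<sigma> permutes {1..i}" "f \<in> hw_vectors i" shows "perm_act \<sigma> f \<in> hw_vectors i"
  using assms
  by (auto simp: hw_vectors_def shift_op_perm_act pp.linear_0[OF linear_perm_act[OF permutes_bij]] perm_act_polys)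

text \<open>
  A symmetrized diagonal operator multiplies the coefficient at an exponent by a number that depends only
  on its type.
\<close>

lemma symm_munit_diag:
  assumes "finite J" "f \<in> polys i" "typed i t f"
  shows "\<exists>c. symm i (munit J \<alpha> \<alpha>) f = pscale c f"
proof -
  define N where "N m = card {\<sigma>\<in>perms i. \<forall>j\<in>J. lookup m (\<sigma> j) = \<alpha> j}" for m :: "nat \<Rightarrow>\<^sub>0 nat"
  have L: "lookup (symm i (munit J \<alpha> \<alpha>) f) m = of_nat (N m) * lookup f m" for m
  proof -
    have "lookup (perm_act \<sigma> (munit J \<alpha> \<alpha> (perm_act (inv \<sigma>) f))) m =
        (if \<forall>j\<in>J. lookup m (\<sigma> j) = \<alpha> j then lookup f m else 0)" if "\<sigma> permutes {1..i}" for \<sigma>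
    proof -
      have b: "bij \<sigma>" "bij (inv \<sigma>)" using that by (auto simp: permutes_bij bij_imp_bij_inv)
      have "override J \<alpha> (mperm \<sigma> m) = mperm \<sigma> m" if "\<forall>j\<in>J. lookup m (\<sigma> j) = \<alpha> j"
        by (rule poly_mapping_eqI) (use that in \<open>auto simp: lookup_override assms lookup_mperm b\<close>)
      then show ?thesis
        by (auto simp: lookup_perm_act b lookup_munit assms lookup_mperm mperm_inv)
    qed
    then have "lookup (symm i (munit J \<alpha> \<alpha>) f) m =
        (\<Sum>\<sigma>\<in>perms i. if \<forall>j\<in>J. lookup m (\<sigma> j) = \<alpha> j then lookup f m else 0)"
      unfolding symm_def lookup_sum by (intro sum.cong) auto
    also have "\<dots> = of_nat (N m) * lookup f m"
      unfolding N_def by (subst sum.inter_filter[symmetric]) simp_all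
    finally show ?thesis .
  qed
  show ?thesis
  proof (cases "f = 0")
    case True
    show ?thesis by (intro exI[of _ 0] poly_mapping_eqI) (simp only: L lookup_pscale, simp add: True)
  next
    case False
    then obtain m0 where m0: "m0 \<in> keys f" by (metis keys_eq_empty ex_in_conv)
    have "N m = N m0" if m: "m \<in> keys f" for m
    proof -
      have "exp_type i m0 = exp_type i m" "keys m \<subseteq> {1..i}" "keys m0 \<subseteq> {1..i}"
        using assms(2,3) m m0 by (auto simp: typed_def polys_def)
      then obtain \<tau> where \<tau>: "\<tau> permutes {1..i}" "mperm \<tau> m0 = m" by (metis same_exp_type_perm)
      have "N m = card ((\<lambda>\<sigma>. \<tau> \<circ> \<sigma>) ` {\<sigma>\<in>perms i. \<forall>j\<in>J. lookup m (\<sigma> j) = \<alpha> j})"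
        unfolding N_def
        by (rule card_image[symmetric], rule inj_onI)
           (use permutes_inj[OF \<tau>(1)] in \<open>auto simp: fun_eq_iff inj_eq\<close>)
      also have "(\<lambda>\<sigma>. \<tau> \<circ> \<sigma>) ` {\<sigma>\<in>perms i. \<forall>j\<in>J. lookup m (\<sigma> j) = \<alpha> j} = {\<sigma>\<in>perms i. \<forall>j\<in>J. lookup m0 (\<sigma> j) = \<alpha> j}"
      proof (intro equalityI subsetI)
        fix \<sigma> assume "\<sigma> \<in> {\<sigma>\<in>perms i. \<forall>j\<in>J. lookup m0 (\<sigma> j) = \<alpha> j}"
        then show "\<sigma> \<in> (\<lambda>\<sigma>. \<tau> \<circ> \<sigma>) ` {\<sigma>\<in>perms i. \<forall>j\<in>J. lookup m (\<sigma> j) = \<alpha> j}"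
          using \<tau> permutes_inverses[OF \<tau>(1)]
          by (intro image_eqI[of _ _ "inv \<tau> \<circ> \<sigma>"])
             (auto simp: fun_eq_iff lookup_mperm permutes_bij permutes_compose permutes_inv)
      qed (use \<tau> in \<open>auto simp: lookup_mperm permutes_bij permutes_compose\<close>)
      finally show ?thesis by (simp add: N_def)
    qed
    then show ?thesis
      by (intro exI[of _ "of_nat (N m0)"] poly_mapping_eqI) (auto simp: L in_keys_iff)
  qed
qed

text \<open>
  The reordering argument of highest weight theory, for symmetrized tensor products of matrix units,
  to which elements of the commutant reduce on any given polynomial. If no factor lowers its exponent, the degree condition makes all factors
  diagonal. Otherwise a lowering factor at \<open>k\<close> is split off to the right, where it kills \<open>f\<close>; what
  remains has fewer factors and the same total degree, so induction applies.
  Positions outside \<open>{1..i}\<close> only carry factors that do not lower the exponent, so the lowering factor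
  always lies among the permuted variables.
\<close>

lemma symm_munit_hw_vectors:
  assumes f: "f \<in> hw_vectors i" and X: "psubspace X" and "finite J"
    and "\<And>j. j \<in> J - {1..i} \<Longrightarrow> \<beta> j \<le> \<alpha> j" and "sum \<alpha> J \<le> sum \<beta> J"
    and "sum \<alpha> J < sum \<beta> J \<or> typed i t f \<and> f \<in> X"
  shows "symm i (munit J \<alpha> \<beta>) f \<in> X"
  using assms(3-)
proof (induction "card (J \<inter> {1..i})" arbitrary: J \<alpha> \<beta> rule: less_induct)
  case less
  show ?case
  proof (cases "\<exists>k\<in>J. \<alpha> k < \<beta> k")
    case False
    then have le: "\<beta> j \<le> \<alpha> j" if "j \<in> J" for j using that by auto
    then have "sum \<beta> J \<le> sum \<alpha> J" by (rule sum_mono)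
    with less.prems have eq: "sum \<beta> J = sum \<alpha> J" and t: "typed i t f" "f \<in> X" by auto
    have "\<beta> j = \<alpha> j" if "j \<in> J" for j
    proof (rule ccontr)
      assume "\<beta> j \<noteq> \<alpha> j"
      then have "sum \<beta> J < sum \<alpha> J"
        using le that by (intro sum_strict_mono_ex1[OF less.prems(1)]) (auto simp: order.strict_iff_order)
      with eq show False by simp
    qed
    then have "munit J \<alpha> \<beta> = munit J \<alpha> \<alpha>" by (intro munit_cong less.prems(1)) auto
    then show ?thesis
      using symm_munit_diag[OF less.prems(1) hw_vectors_polys[OF f] t(1), of \<alpha>] pv.subspace_scale[OF X t(2)] by auto
  next
    case True
    then obtain k where k: "k \<in> J" "\<alpha> k < \<beta> k" by auto
    (* By assumption no factor outside {1..i} lowers its exponent. *)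
    then have ki: "k \<in> {1..i}" using less.prems(2)[of k] by (meson DiffI leD)
    define K where "K = J - {k}"
    have K: "finite K" "k \<notin> K" "J = insert k K" using less.prems(1) k by (auto simp: K_def)
    define A where "A = {l\<in>{1..i} \<inter> K. \<beta> l = \<alpha> k}"
    (* The highest weight equation for the factor at k, multiplied by the remaining factors. *)
    have "0 = symm i (\<lambda>g. munit K \<alpha> \<beta> (shift_op i (\<alpha> k) (\<beta> k) g)) f"
    proof -
      have "perm_act \<sigma> (munit K \<alpha> \<beta> (shift_op i (\<alpha> k) (\<beta> k) (perm_act (inv \<sigma>) f))) = 0"
        if "\<sigma> permutes {1..i}" for \<sigma>
        using that permutes_bij[OF that] permutes_bij[OF permutes_inv[OF that]]
        by (simp add: shift_op_perm_act permutes_inv hw_vectors_shift_op[OF f k(2)] pp.linear_0[OF linear_perm_act]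
            pp.linear_0[OF linear_munit])
      then show ?thesis unfolding symm_def by simp
    qed
    also have "\<dots> = (\<Sum>l\<in>{1..i}-K. symm i (munit (insert l K) (\<alpha>(l := \<alpha> k)) (\<beta>(l := \<beta> k))) f) +
        (\<Sum>l\<in>A. symm i (munit K \<alpha> (\<beta>(l := \<beta> k))) f)"
    proof -
      have "perm_act \<sigma> (munit K \<alpha> \<beta> (shift_op i (\<alpha> k) (\<beta> k) (perm_act (inv \<sigma>) f))) =
        (\<Sum>l\<in>{1..i}-K. perm_act \<sigma> (munit (insert l K) (\<alpha>(l := \<alpha> k)) (\<beta>(l := \<beta> k)) (perm_act (inv \<sigma>) f))) +
        (\<Sum>l\<in>A. perm_act \<sigma> (munit K \<alpha> (\<beta>(l := \<beta> k)) (perm_act (inv \<sigma>) f)))"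
        if "\<sigma> permutes {1..i}" for \<sigma>
        unfolding munit_shift_op[OF K(1)] A_def
        by (simp only: pp.linear_add[OF linear_perm_act[OF permutes_bij[OF that]]]
            pp.linear_sum[OF linear_perm_act[OF permutes_bij[OF that]]])
      then show ?thesis
        unfolding symm_def sum.swap[of _ "perms i"]
        by (simp add: sum.distrib[symmetric])
    qed
    also have "(\<Sum>l\<in>{1..i}-K. symm i (munit (insert l K) (\<alpha>(l := \<alpha> k)) (\<beta>(l := \<beta> k))) f) =
        (\<Sum>l\<in>{1..i}-K. symm i (munit J \<alpha> \<beta>) f)"
    proof (rule sum.cong[OF refl])
      fix l assume "l \<in> {1..i}-K"
      then show "symm i (munit (insert l K) (\<alpha>(l := \<alpha> k)) (\<beta>(l := \<beta> k))) f = symm i (munit J \<alpha> \<beta>) f"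
        using symm_munit_transpose[OF K(1) ki K(2), of l \<alpha> "\<alpha> k" \<beta> "\<beta> k" f] K(3) by simp
    qed
    also have "\<dots> = pscale (of_nat (card ({1..i}-K))) (symm i (munit J \<alpha> \<beta>) f)"
      by (rule pv.sum_constant_scale)
    finally have z: "0 = pscale (of_nat (card ({1..i}-K))) (symm i (munit J \<alpha> \<beta>) f) +
        (\<Sum>l\<in>A. symm i (munit K \<alpha> (\<beta>(l := \<beta> k))) f)" .
    have e: "pscale (of_nat (card ({1..i}-K))) (symm i (munit J \<alpha> \<beta>) f) =
        - (\<Sum>l\<in>A. symm i (munit K \<alpha> (\<beta>(l := \<beta> k))) f)"
      by (simp only: eq_neg_iff_add_eq_0 z[symmetric])
    have "symm i (munit K \<alpha> (\<beta>(l := \<beta> k))) f \<in> X" if "l \<in> A" for l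
    proof (rule less.hyps)
      have l: "l \<in> {1..i}" "l \<in> K" "\<beta> l = \<alpha> k" using that by (auto simp: A_def)
      show "card (K \<inter> {1..i}) < card (J \<inter> {1..i})"
        by (rule psubset_card_mono) (use K ki in auto)
      show "finite K" by fact
      show "(\<beta>(l := \<beta> k)) j \<le> \<alpha> j" if "j \<in> K - {1..i}" for j
        using that less.prems(2)[of j] l K by auto
      have "sum (\<beta>(l := \<beta> k)) K = \<beta> k + sum \<beta> (K - {l})"
        using K(1) l(2) by (subst sum.remove[of K l]) (auto intro!: sum.cong)
      moreover have "sum \<beta> K = \<beta> l + sum \<beta> (K - {l})"
        using K(1) l(2) by (rule sum.remove)
      moreover have "sum \<alpha> J = \<alpha> k + sum \<alpha> K" "sum \<beta> J = \<beta> k + sum \<beta> K"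
        using K by auto
      ultimately show "sum \<alpha> K \<le> sum (\<beta>(l := \<beta> k)) K"
        and "sum \<alpha> K < sum (\<beta>(l := \<beta> k)) K \<or> typed i t f \<and> f \<in> X"
        using less.prems(3,4) l(3) by auto
    qed
    then have "- (\<Sum>l\<in>A. symm i (munit K \<alpha> (\<beta>(l := \<beta> k))) f) \<in> X"
      by (intro pv.subspace_neg[OF X] pv.subspace_sum[OF X])
    moreover have "of_nat (card ({1..i}-K)) \<noteq> (0::complex)"
      using ki K(2) by auto
    ultimately show ?thesis
      using e pv.subspace_scale[OF X, of _ "inverse (of_nat (card ({1..i}-K)))"]
      by (metis pv.scale_scale left_inverse pv.scale_one)
  qed
qed

lemma lookup_munit_full:
  assumes "g \<in> polys n" "keys b \<subseteq> {1..n}" "keys m \<subseteq> {1..n}"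
  shows "munit {1..n} (lookup m) (lookup b) g = pscale (lookup g b) (mon m)"
proof (rule poly_mapping_eqI)
  fix k
  show "lookup (munit {1..n} (lookup m) (lookup b) g) k = lookup (pscale (lookup g b) (mon m)) k"
  proof (cases "keys k \<subseteq> {1..n}")
    case True
    then have 1: "(\<forall>j\<in>{1..n}. lookup k j = lookup m j) \<longleftrightarrow> k = m"
      using assms(3) unfolding poly_mapping_eq_iff fun_eq_iff by (metis in_keys_iff subset_iff)
    have "override {1..n} (lookup b) m = b"
    proof (rule poly_mapping_eqI)
      fix j
      have "lookup b j = 0" "lookup m j = 0" if "j \<notin> {1..n}"
        using that assms(2,3) by (metis in_keys_iff subset_iff)+
      then show "lookup (override {1..n} (lookup b) m) j = lookup b j"
        by (cases "j \<in> {1..n}") (simp_all only: lookup_override[OF finite_atLeastAtMost] if_True if_False not_False_eq_True simp_thms)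
    qed
    with 1 show ?thesis
      unfolding lookup_munit[OF finite_atLeastAtMost] lookup_pscale lookup_mon by auto
  next
    case False
    then obtain j where j: "j \<in> keys k" "j \<notin> {1..n}" by (meson subsetI)
    then have "j \<in> keys (override {1..n} (lookup b) k)"
      by (simp only: in_keys_iff lookup_override[OF finite_atLeastAtMost] if_False simp_thms)
    with j have "\<not> keys (override {1..n} (lookup b) k) \<subseteq> {1..n}" by blast
    then have "lookup g (override {1..n} (lookup b) k) = 0" using polys_lookup[OF assms(1)] by blast
    moreover have "k \<noteq> m" using False assms(3) by auto
    ultimately show ?thesis
      unfolding lookup_munit[OF finite_atLeastAtMost] lookup_pscale lookup_mon by simp
  qed
qed

text \<open>
  An element of the commutant equals its own average, and expanding it on monomials writes this average as
  a combination of symmetrized matrix units. Both consequences below come from the choice of the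
  subspace \<open>X\<close>: zero in negative degree, the line of \<open>f\<close> in degree 0.
\<close>

lemma hw_vectors_homog_apply:
  assumes f: "f \<in> hw_vectors i" and "i \<le> n" and T: "T \<in> commutant n i" and "homog n k T"
    and X: "psubspace X" and k: "k < 0 \<or> k = 0 \<and> typed i t f \<and> f \<in> X"
  shows "T f \<in> X"
proof -
  define M where "M = (\<Union>\<sigma>\<in>perms i. keys (perm_act (inv \<sigma>) f))"
  have M: "finite M" by (simp add: M_def)
  have pi: "perm_act (inv \<sigma>) f \<in> polys i" if "\<sigma> permutes {1..i}" for \<sigma>
    by (rule perm_act_polys[OF permutes_inv[OF that] order_refl hw_vectors_polys[OF f]])
  have Mb: "keys b \<subseteq> {1..i}" if "b \<in> M" for b
    using that pi by (auto simp: M_def polys_def)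
  have Mbn: "keys b \<subseteq> {1..n}" if "b \<in> M" for b
    using Mb[OF that] \<open>i \<le> n\<close> by fastforce
  have Tb: "keys m \<subseteq> {1..n}" if "b \<in> M" "m \<in> keys (T (mon b))" for b m
    using commutant_polys[OF T, of "mon b"] Mbn[OF that(1)] that(2) by (auto simp: polys_def)
  let ?c = "\<lambda>b m. lookup (T (mon b)) m"
  let ?U = "\<lambda>b m. munit {1..n} (lookup m) (lookup b)"
  have Tg: "T (perm_act (inv \<sigma>) f) =
      (\<Sum>b\<in>M. \<Sum>m\<in>keys (T (mon b)). pscale (?c b m) (?U b m (perm_act (inv \<sigma>) f)))"
    if "\<sigma> permutes {1..i}" for \<sigma>
  proof -
    let ?g = "perm_act (inv \<sigma>) f"
    have gn: "?g \<in> polys n" using pi[OF that] polys_mono[OF \<open>i \<le> n\<close>] by auto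
    have "T ?g = (\<Sum>b\<in>M. pscale (lookup ?g b) (T (mon b)))"
      by (rule plinear_expand[OF commutant_linear[OF T] M]) (use that in \<open>auto simp: M_def\<close>)
    also have "\<dots> = (\<Sum>b\<in>M. \<Sum>m\<in>keys (T (mon b)). pscale (?c b m) (?U b m ?g))"
    proof (rule sum.cong[OF refl])
      fix b assume b: "b \<in> M"
      have "pscale (lookup ?g b) (T (mon b)) =
          (\<Sum>m\<in>keys (T (mon b)). pscale (lookup ?g b) (pscale (?c b m) (mon m)))"
        unfolding pv.scale_sum_right[symmetric]
        by (rule arg_cong[OF poly_expand[OF finite_keys order_refl]])
      also have "\<dots> = (\<Sum>m\<in>keys (T (mon b)). pscale (?c b m) (?U b m ?g))"
        by (rule sum.cong[OF refl])
           (simp only: lookup_munit_full[OF gn Mbn[OF b] Tb[OF b]] pv.scale_left_commute)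
      finally show "pscale (lookup ?g b) (T (mon b)) =
          (\<Sum>m\<in>keys (T (mon b)). pscale (?c b m) (?U b m ?g))" .
    qed
    finally show ?thesis .
  qed
  have "symm i T f = (\<Sum>b\<in>M. \<Sum>m\<in>keys (T (mon b)). pscale (?c b m) (symm i (?U b m) f))"
  proof -
    have "symm i T f = (\<Sum>\<sigma>\<in>perms i. \<Sum>b\<in>M. \<Sum>m\<in>keys (T (mon b)).
        pscale (?c b m) (perm_act \<sigma> (?U b m (perm_act (inv \<sigma>) f))))"
      unfolding symm_def
    proof (rule sum.cong[OF refl])
      fix \<sigma> assume "\<sigma> \<in> perms i"
      then have \<sigma>: "\<sigma> permutes {1..i}" by simp
      note l = linear_perm_act[OF permutes_bij[OF \<sigma>]]
      show "perm_act \<sigma> (T (perm_act (inv \<sigma>) f)) = (\<Sum>b\<in>M. \<Sum>m\<in>keys (T (mon b)).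
        pscale (?c b m) (perm_act \<sigma> (?U b m (perm_act (inv \<sigma>) f))))"
        unfolding Tg[OF \<sigma>] pp.linear_sum[OF l] pp.linear_scale[OF l] ..
    qed
    also have "\<dots> = (\<Sum>b\<in>M. \<Sum>m\<in>keys (T (mon b)). \<Sum>\<sigma>\<in>perms i.
        pscale (?c b m) (perm_act \<sigma> (?U b m (perm_act (inv \<sigma>) f))))"
      by (subst sum.swap, rule sum.cong[OF refl], rule sum.swap)
    finally show ?thesis
      by (simp only: symm_def pv.scale_sum_right)
  qed
  also have "\<dots> \<in> X"
  proof (intro pv.subspace_sum[OF X] pv.subspace_scale[OF X] symm_munit_hw_vectors[OF f X] finite_atLeastAtMost)
    fix b m assume b: "b \<in> M" and m: "m \<in> keys (T (mon b))"
    have d: "int (deg n m) = int (deg n b) + k"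
      using homogD[OF assms(4), of b m] m by (simp add: in_keys_iff)
    show "lookup b j \<le> lookup m j" if "j \<in> {1..n} - {1..i}" for j
    proof -
      have "lookup b j = 0"
        using Mb[OF b] that by (metis DiffD2 in_keys_iff subset_iff)
      then show ?thesis by simp
    qed
    show "sum (lookup m) {1..n} \<le> sum (lookup b) {1..n}"
      "sum (lookup m) {1..n} < sum (lookup b) {1..n} \<or> typed i t f \<and> f \<in> X"
      using d k unfolding deg_def by linarith+
  qed
  finally have "symm i T f \<in> X" .
  then have "average i T f \<in> X"
    unfolding average_def by (rule pv.subspace_scale[OF X])
  moreover have "average i T f = T f"
    by (rule average_eqI) (simp only: commutant_perm[OF T, symmetric] perm_act_inv permutes_bij)
  ultimately show ?thesis by simp
qed

lemma hw_vectors_negative: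
  assumes "f \<in> hw_vectors i" "i \<le> n" "T \<in> commutant n i" "homog n k T" "k < 0"
  shows "T f = 0"
  using hw_vectors_homog_apply[OF assms(1-4) pv.subspace_single_0] assms(5) by simp

lemma hw_vectors_scalar:
  assumes "f \<in> hw_vectors i" "i \<le> n" "T \<in> commutant n i" "homog n 0 T" "typed i t f"
  shows "\<exists>c. T f = pscale c f"
proof -
  have "T f \<in> pspan {f}"
    by (rule hw_vectors_homog_apply[OF assms(1-4) pv.subspace_span, of t]) (simp add: assms(5) pv.span_base)
  then show ?thesis by (auto simp: pv.span_singleton)
qed

lemma deg_upd: "l \<in> {1..n} \<Longrightarrow> deg n (upd m l c) + lookup m l = deg n m + c"
  unfolding deg_def
  by (subst (1 2) sum.remove[of _ l]) (auto simp: lookup_upd intro!: sum.cong)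

lemma keys_upd: "keys m \<subseteq> insert l (keys (upd m l c))"
  by (auto simp: in_keys_iff lookup_upd split: if_splits)

lemma commutant_shift_op:
  assumes "i \<le> n" shows "shift_op i a b \<in> commutant n i"
proof (rule commutantI)
  fix p assume p: "p \<in> polys n"
  show "shift_op i a b p \<in> polys n"
    unfolding polys_def mem_Collect_eq
  proof (intro ballI)
    fix m assume "m \<in> keys (shift_op i a b p)"
    then have "(\<Sum>l\<in>{1..i}. if lookup m l = a then lookup p (upd m l b) else 0) \<noteq> 0"
      by (simp only: in_keys_iff lookup_shift_op not_False_eq_True)
    then obtain l where l: "l \<in> {1..i}" "lookup p (upd m l b) \<noteq> 0"
      by (rule sum.not_neutral_contains_not_neutral) (auto split: if_splits)
    have "keys (upd m l b) \<subseteq> {1..n}" by (rule polys_lookup[OF p l(2)])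
    moreover have "l \<in> {1..n}" using l(1) assms by auto
    ultimately show "keys m \<subseteq> {1..n}"
      using keys_upd[of m l b] by blast
  qed
qed (simp_all add: linear_shift_op shift_op_perm_act)

lemma homog_shift_op:
  assumes "i \<le> n" shows "homog n (int a - int b) (shift_op i a b)"
  unfolding homog_def
proof (intro allI impI)
  fix m m' assume "lookup (shift_op i a b (mon m)) m' \<noteq> 0"
  then have "(\<Sum>l\<in>{1..i}. if lookup m' l = a then lookup (mon m) (upd m' l b) else 0) \<noteq> 0"
    by (simp only: lookup_shift_op not_False_eq_True)
  then obtain l where l: "l \<in> {1..i}" "(if lookup m' l = a then lookup (mon m) (upd m' l b) else 0) \<noteq> 0"

    by (rule sum.not_neutral_contains_not_neutral)
  then have "lookup m' l = a" "upd m' l b = m"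
    by (auto simp: lookup_mon split: if_splits)
  then show "int (deg n m') = int (deg n m) + (int a - int b)"
    using deg_upd[of l n b m'] l(1) assms by auto
qed

lemma commutant_munit_single:
  assumes j: "j \<in> {1..n}" "j \<notin> {1..i}" shows "munit {j} (\<lambda>_. a) (\<lambda>_. b) \<in> commutant n i"
proof (rule commutantI)
  let ?T = "munit {j} (\<lambda>_. a) (\<lambda>_. b)"
  fix \<sigma> p assume \<sigma>: "\<sigma> permutes {1..i}"
  then have "\<sigma> j = j" using j(2) by (simp add: permutes_def)
  then show "?T (perm_act \<sigma> p) = perm_act \<sigma> (?T p)"
    using munit_conj[of "{j}" \<sigma> "\<lambda>_. a" "\<lambda>_. b" "perm_act \<sigma> p"] permutes_bij[OF \<sigma>]
    by (simp add: perm_act_inv o_def)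
next
  let ?T = "munit {j} (\<lambda>_. a) (\<lambda>_. b)"
  fix p assume p: "p \<in> polys n"
  show "?T p \<in> polys n"
    unfolding polys_def mem_Collect_eq
  proof (intro ballI)
    fix m assume "m \<in> keys (?T p)"
    then have "lookup p (upd m j b) \<noteq> 0"
      by (simp add: in_keys_iff lookup_munit split: if_splits)
    from polys_lookup[OF p this] show "keys m \<subseteq> {1..n}" using keys_upd[of m j b] j(1) by blast
  qed
qed (rule linear_munit)

lemma homog_munit_single:
  assumes j: "j \<in> {1..n}" shows "homog n (int a - int b) (munit {j} (\<lambda>_. a) (\<lambda>_. b))"
  unfolding homog_def
proof (intro allI impI)
  fix k k' assume "lookup (munit {j} (\<lambda>_. a) (\<lambda>_. b) (mon k)) k' \<noteq> 0"
  then have "lookup k' j = a" "upd k' j b = k"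
    by (auto simp: lookup_munit lookup_mon split: if_splits)
  then show "int (deg n k') = int (deg n k) + (int a - int b)"
    using deg_upd[OF j, of b k'] by simp
qed

text \<open>
  One direction is \<open>hw_vectors_negative\<close>. Conversely, the shifts lower the degree, and so does
  replacing a positive power of one of the remaining variables by 1; the latter forces \<open>f\<close> to
  involve only the variables 1 to \<open>i\<close>.
\<close>

lemma hw_vectors_iff:
  assumes "i \<le> n"
  shows "f \<in> hw_vectors i \<longleftrightarrow> f \<in> polys n \<and> (\<forall>T\<in>commutant n i. \<forall>k<0. homog n k T \<longrightarrow> T f = 0)"
proof (intro iffI conjI ballI allI impI)
  assume "f \<in> hw_vectors i"
  then show "f \<in> polys n" using hw_vectors_polys polys_mono[OF assms] by auto
next
  fix T k assume "f \<in> hw_vectors i" "T \<in> commutant n i" "k < 0" "homog n k T"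
  then show "T f = 0" using hw_vectors_negative[OF _ assms] by blast
next
  assume "f \<in> polys n \<and> (\<forall>T\<in>commutant n i. \<forall>k<0. homog n k T \<longrightarrow> T f = 0)"
  then have f: "f \<in> polys n"
    and kill: "\<And>T k. T \<in> commutant n i \<Longrightarrow> homog n k T \<Longrightarrow> k < 0 \<Longrightarrow> T f = 0" by auto
  have "keys m \<subseteq> {1..i}" if m: "m \<in> keys f" for m
  proof
    fix j assume j: "j \<in> keys m"
    then have jn: "j \<in> {1..n}" using f m unfolding polys_def by blast
    show "j \<in> {1..i}"
    proof (rule ccontr)
      assume ji: "j \<notin> {1..i}"
      let ?b = "lookup m j"
      let ?T = "munit {j} (\<lambda>_. 0) (\<lambda>_. ?b)"
      have "?T \<in> commutant n i" by (rule commutant_munit_single[OF jn ji])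
      moreover have "homog n (int 0 - int ?b) ?T" by (rule homog_munit_single[OF jn])
      moreover have "int 0 - int ?b < 0" using j by (simp add: in_keys_iff)
      ultimately have "?T f = 0" by (rule kill)
      then have "lookup (?T f) (upd m j 0) = 0" by simp
      moreover have "upd (upd m j 0) j ?b = m"
        by (rule poly_mapping_eqI) (simp add: lookup_upd)
      ultimately show False
        using m by (simp add: lookup_munit lookup_upd in_keys_iff)
    qed
  qed
  then have "f \<in> polys i" by (simp add: polys_def)
  moreover have "shift_op i a b f = 0" if "a < b" for a b
    by (rule kill[OF commutant_shift_op[OF assms] homog_shift_op[OF assms]]) (use that in simp)
  ultimately show "f \<in> hw_vectors i" by (simp add: hw_vectors_def)
qed

section \<open>Words in the Weyl algebra\<close>

abbreviation unit_exp :: "nat \<Rightarrow> (nat \<Rightarrow>\<^sub>0 nat)" where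
  "unit_exp j \<equiv> Poly_Mapping.single j 1"

lemma mulx_mon: "mulx j (mon m) = mon (m + unit_exp j)"
  by (simp add: mulx_def mon_def mult_single add.commute)

lemma linear_mulx: "plinear (mulx j)"
proof (rule plinearI)
  show "mulx j (pscale c p) = pscale c (mulx j p)" for c p
    unfolding mulx_def pscale_def by (rule mult.left_commute)
qed (simp add: mulx_def distrib_left)

lemma pdiff_mon: "pdiff j (mon m) = pscale (of_nat (lookup m j)) (mon (m - unit_exp j))"
  by (rule poly_mapping_eqI) (simp add: mon_def pdiff_single lookup_single when_def)

lemma linear_pdiff: "plinear (pdiff j)"
proof -
  have "pdiff j = lin_ext (\<lambda>m. pscale (of_nat (lookup m j)) (mon (m - unit_exp j)))"
    by (rule ext, rule poly_mapping_eqI)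
       (auto simp: pdiff_def lin_ext_def mon_def lookup_sum lookup_single when_def intro!: sum.cong)
  then show ?thesis by (simp add: linear_lin_ext)
qed

lemma lookup_unit_exp: "lookup (unit_exp j) k = (if k = j then 1 else 0)"
  by (auto simp: lookup_single when_def)

lemma deg_add_unit_exp: "j \<in> {1..n} \<Longrightarrow> deg n (m + unit_exp j) = deg n m + 1"
  by (simp add: deg_def lookup_add lookup_unit_exp sum.distrib)

lemma deg_minus_unit_exp:
  assumes "j \<in> {1..n}" "lookup m j \<noteq> 0" shows "deg n (m - unit_exp j) + 1 = deg n m"
proof -
  have "m = (m - unit_exp j) + unit_exp j"
    by (rule poly_mapping_eqI) (use assms in \<open>auto simp: lookup_add lookup_minus lookup_unit_exp\<close>)
  then show ?thesis using deg_add_unit_exp[OF assms(1), of "m - unit_exp j"] by simp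
qed

abbreviation word :: "(mop \<times> int) list \<Rightarrow> mop" where
  "word ws \<equiv> foldr (\<circ>) (map fst ws) id"

lemma weyl_part_alt: "weyl_part n k = ospan {word ws | ws. ws \<in> lists (weyl_gens n) \<and> sum_list (map snd ws) = k}"
  by (simp add: weyl_part_def)

lemma word_Cons: "word (g # ws) = fst g \<circ> word ws"
  by simp

lemma word_append: "word (ws @ ws') = word ws \<circ> word ws'"
  by (induction ws) (auto simp: o_assoc)

definition graded_op :: "nat \<Rightarrow> int \<Rightarrow> mop \<Rightarrow> bool" where
  "graded_op n k d \<longleftrightarrow> plinear d \<and> (\<forall>p\<in>polys n. d p \<in> polys n) \<and> homog n k d"

lemma homog_comp:
  assumes "plinear S" "homog n k S" "homog n l T" shows "homog n (k + l) (S \<circ> T)"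
  unfolding homog_def
proof (intro allI impI)
  fix m m' assume a: "lookup ((S \<circ> T) (mon m)) m' \<noteq> 0"
  have "lookup (S (T (mon m))) m' = (\<Sum>b\<in>keys (T (mon m)). lookup (T (mon m)) b * lookup (S (mon b)) m')"
    unfolding plinear_expand[OF assms(1) finite_keys order_refl, of "T (mon m)"]
    by (simp add: lookup_sum)
  with a have "(\<Sum>b\<in>keys (T (mon m)). lookup (T (mon m)) b * lookup (S (mon b)) m') \<noteq> 0"
    by simp
  then obtain b where "lookup (T (mon m)) b \<noteq> 0" "lookup (S (mon b)) m' \<noteq> 0"
    by (rule sum.not_neutral_contains_not_neutral) auto
  then show "int (deg n m') = int (deg n m) + (k + l)"
    using homogD[OF assms(3)] homogD[OF assms(2)] by fastforce
qed

lemma graded_op_comp: "graded_op n k S \<Longrightarrow> graded_op n l T \<Longrightarrow> graded_op n (k + l) (S \<circ> T)"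
  unfolding graded_op_def using homog_comp plinear_compose[of S T] by (auto simp: o_def)

lemma linear_preserves_polysI:
  assumes "plinear T" "\<And>m. keys m \<subseteq> {1..n} \<Longrightarrow> T (mon m) \<in> polys n" "p \<in> polys n"
  shows "T p \<in> polys n"
  unfolding plinear_expand[OF assms(1) finite_keys order_refl, of p]
  by (intro pv.subspace_sum[OF subspace_polys] pv.subspace_scale[OF subspace_polys] assms(2))
     (use assms(3) in \<open>auto simp: polys_def\<close>)

lemma keys_minus_unit_exp: "keys (m - unit_exp j) \<subseteq> keys m"
  by (auto simp: in_keys_iff lookup_minus)

lemma graded_gen:
  assumes "g \<in> weyl_gens n" shows "graded_op n (snd g) (fst g)"
proof -
  from assms consider j where "j \<in> {1..n}" "g = (mulx j, 1)" | j where "j \<in> {1..n}" "g = (pdiff j, -1)"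
    by (auto simp: weyl_gens_def)
  then show ?thesis
  proof cases
    case (1 j)
    have "mulx j (mon m) \<in> polys n" if "keys m \<subseteq> {1..n}" for m
      unfolding mulx_mon using that 1(1) Poly_Mapping.keys_add[of m "unit_exp j"]
      by (simp only: mon_in_polys_iff) (auto simp: keys_single split: if_splits)
    moreover have "homog n 1 (mulx j)"
      using deg_add_unit_exp[OF 1(1)] by (auto simp: homog_def mulx_mon lookup_mon split: if_splits)
    ultimately show ?thesis
      using linear_mulx linear_preserves_polysI[OF linear_mulx] 1 by (simp add: graded_op_def)
  next
    case (2 j)
    have "pdiff j (mon m) \<in> polys n" if "keys m \<subseteq> {1..n}" for m
      unfolding pdiff_mon using that keys_minus_unit_exp[of m j]
      by (intro pv.subspace_scale[OF subspace_polys]) (metis mon_in_polys_iff order_trans)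
    moreover have "homog n (-1) (pdiff j)"
      using deg_minus_unit_exp[OF 2(1)] by (auto simp: homog_def pdiff_mon lookup_mon split: if_splits)
         (metis add_diff_cancel_right' of_nat_1 of_nat_add)
    ultimately show ?thesis
      using linear_pdiff linear_preserves_polysI[OF linear_pdiff] 2 by (simp add: graded_op_def)
  qed
qed

lemma graded_word:
  "ws \<in> lists (weyl_gens n) \<Longrightarrow> graded_op n (sum_list (map snd ws)) (word ws)"
proof (induction ws rule: lists.induct)
  case Nil
  show ?case
    by (auto simp: graded_op_def homog_def lookup_mon id_def intro: plinearI split: if_splits)
next
  case (Cons g ws)
  have "graded_op n (snd g + sum_list (map snd ws)) (fst g \<circ> word ws)"
    by (rule graded_op_comp[OF graded_gen[OF Cons.hyps(1)] Cons.IH])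
  then show ?case by (subst word_Cons) (simp only: list.map sum_list.Cons)
qed

lemma subspace_graded: "ov.subspace {d. graded_op n k d}"
proof (rule ov.subspaceI)
  show "0 \<in> {d. graded_op n k d}"
    by (auto simp: graded_op_def homog_def pv.subspace_0[OF subspace_polys] intro: plinearI)
  show "x + y \<in> {d. graded_op n k d}" if "x \<in> {d. graded_op n k d}" "y \<in> {d. graded_op n k d}" for x y
  proof -
    have "plinear (x + y)"
      using that pp.linear_compose_add[of x y] by (auto simp: graded_op_def plus_fun_def)
    moreover have "homog n k (x + y)"
      using that by (auto simp: graded_op_def homog_def lookup_add) (metis add_0)
    ultimately show ?thesis
      using that pv.subspace_add[OF subspace_polys] by (auto simp: graded_op_def)
  qed
  show "oscale c x \<in> {d. graded_op n k d}" if "x \<in> {d. graded_op n k d}" for c x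
  proof -
    have "plinear (oscale c x)"
      using that pp.linear_compose_scale_right[of x c] by (auto simp: graded_op_def oscale_def)
    then show ?thesis
      using that pv.subspace_scale[OF subspace_polys] by (auto simp: graded_op_def oscale_def homog_def)
  qed
qed

lemma weyl_part_graded: "d \<in> weyl_part n k \<Longrightarrow> graded_op n k d"
proof -
  have "weyl_part n k \<subseteq> {d. graded_op n k d}"
    unfolding weyl_part_def
    by (rule ov.span_minimal[OF _ subspace_graded]) (use graded_word in auto)
  then show "d \<in> weyl_part n k \<Longrightarrow> graded_op n k d" by auto
qed

lemma weyl_linear_polys:
  assumes "d \<in> weyl n" shows "plinear d" "p \<in> polys n \<Longrightarrow> d p \<in> polys n"
proof -
  let ?S = "{d. plinear d \<and> (\<forall>p\<in>polys n. d p \<in> polys n)}"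
  have sub: "ov.subspace ?S"
  proof (rule ov.subspaceI)
    show "0 \<in> ?S" by (auto simp: pv.subspace_0[OF subspace_polys] intro: plinearI)
    show "x + y \<in> ?S" if "x \<in> ?S" "y \<in> ?S" for x y
      using that pp.linear_compose_add[of x y] pv.subspace_add[OF subspace_polys]
      by (auto simp: plus_fun_def)
    show "oscale c x \<in> ?S" if "x \<in> ?S" for c x
      using that pp.linear_compose_scale_right[of x c] pv.subspace_scale[OF subspace_polys]
      by (auto simp: oscale_def)
  qed
  have "foldr (\<circ>) ws id \<in> ?S" if "ws \<in> lists (fst ` weyl_gens n)" for ws
    using that
  proof (induction ws rule: lists.induct)
    case Nil
    show ?case by (auto simp: id_def intro: plinearI)
  next
    case (Cons g ws)
    then have g: "plinear g" "\<forall>p\<in>polys n. g p \<in> polys n"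
      using graded_gen[of _ n] by (auto simp: graded_op_def)
    have w: "plinear (foldr (\<circ>) ws id)" "\<forall>p\<in>polys n. foldr (\<circ>) ws id p \<in> polys n"
      using Cons.IH by blast+
    have eq: "foldr (\<circ>) (g # ws) id = (\<lambda>p. g (foldr (\<circ>) ws id p))"
      by (simp add: fun_eq_iff)
    show ?case
      unfolding eq mem_Collect_eq using plinear_compose[OF g(1) w(1)] g(2) w(2) by blast
  qed
  then have "weyl n \<subseteq> ?S"
    unfolding weyl_def op_algebra_def by (intro ov.span_minimal[OF _ sub]) auto
  then show "plinear d" "p \<in> polys n \<Longrightarrow> d p \<in> polys n" using assms by auto
qed

lemma weyl_part_subset: "weyl_part n k \<subseteq> weyl n"
  unfolding weyl_part_def weyl_def op_algebra_def
proof (rule ov.span_mono, rule subsetI)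
  fix d assume "d \<in> {word ws |ws. ws \<in> lists (weyl_gens n) \<and> sum_list (map snd ws) = k}"
  then obtain ws where ws: "d = word ws" "ws \<in> lists (weyl_gens n)" by blast
  from ws(2) have "map fst ws \<in> lists (fst ` weyl_gens n)"
    by (induction ws rule: lists.induct) auto
  with ws(1) show "d \<in> {foldr (\<circ>) vs id |vs. vs \<in> lists (fst ` weyl_gens n)}" by blast
qed

lemma subspace_weyl_part: "ov.subspace (weyl_part n k)"
  by (simp add: weyl_part_def)

lemma weyl_part_gen: "g \<in> weyl_gens n \<Longrightarrow> fst g \<in> weyl_part n (snd g)"
  unfolding weyl_part_def by (rule ov.span_base) (auto intro!: exI[of _ "[g]"])

lemma weyl_part_id: "id \<in> weyl_part n 0"
  unfolding weyl_part_def by (rule ov.span_base) (auto intro!: exI[of _ "[]"])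

lemma subspace_comp_right: "ov.subspace W \<Longrightarrow> ov.subspace {d. d \<circ> e \<in> W}"
proof (rule ov.subspaceI)
  assume W: "ov.subspace W"
  have "(0::mop) \<circ> e = 0" by (simp add: fun_eq_iff)
  then show "0 \<in> {d. d \<circ> e \<in> W}" using ov.subspace_0[OF W] by simp
  have "(x + y) \<circ> e = (x \<circ> e) + (y \<circ> e)" for x y :: mop by (simp add: fun_eq_iff)
  then show "x + y \<in> {d. d \<circ> e \<in> W}" if "x \<in> {d. d \<circ> e \<in> W}" "y \<in> {d. d \<circ> e \<in> W}" for x y
    using that ov.subspace_add[OF W] by simp
  have "oscale c x \<circ> e = oscale c (x \<circ> e)" for c x by (simp add: fun_eq_iff oscale_def)
  then show "oscale c x \<in> {d. d \<circ> e \<in> W}" if "x \<in> {d. d \<circ> e \<in> W}" for c x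
    using that ov.subspace_scale[OF W] by simp
qed

lemma subspace_comp_left: "ov.subspace W \<Longrightarrow> plinear e \<Longrightarrow> ov.subspace {d. e \<circ> d \<in> W}"
proof (rule ov.subspaceI)
  assume W: "ov.subspace W" and e: "plinear e"
  have "e \<circ> (0::mop) = 0" by (simp add: fun_eq_iff pp.linear_0[OF e])
  then show "0 \<in> {d. e \<circ> d \<in> W}" using ov.subspace_0[OF W] by simp
  have "e \<circ> (x + y) = (e \<circ> x) + (e \<circ> y)" for x y :: mop by (simp add: fun_eq_iff pp.linear_add[OF e])
  then show "x + y \<in> {d. e \<circ> d \<in> W}" if "x \<in> {d. e \<circ> d \<in> W}" "y \<in> {d. e \<circ> d \<in> W}" for x y
    using that ov.subspace_add[OF W] by simp
  have "e \<circ> oscale c x = oscale c (e \<circ> x)" for c x by (simp add: fun_eq_iff oscale_def pp.linear_scale[OF e])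
  then show "oscale c x \<in> {d. e \<circ> d \<in> W}" if "x \<in> {d. e \<circ> d \<in> W}" for c x
    using that ov.subspace_scale[OF W] by simp
qed

lemma weyl_part_comp:
  assumes "d \<in> weyl_part n k" "e \<in> weyl_part n l" shows "d \<circ> e \<in> weyl_part n (k + l)"
proof -
  have 1: "word vs \<circ> word ws \<in> weyl_part n (k + l)"
    if "vs \<in> lists (weyl_gens n)" "sum_list (map snd vs) = k"
      "ws \<in> lists (weyl_gens n)" "sum_list (map snd ws) = l" for vs ws
    unfolding weyl_part_def word_append[symmetric]
    by (rule ov.span_base) (use that in \<open>auto intro!: exI[of _ "vs @ ws"]\<close>)
  have 2: "d \<circ> word ws \<in> weyl_part n (k + l)"
    if "ws \<in> lists (weyl_gens n)" "sum_list (map snd ws) = l" for ws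
  proof -
    have "weyl_part n k \<subseteq> {d. d \<circ> word ws \<in> weyl_part n (k + l)}"
      by (subst weyl_part_def, rule ov.span_minimal[OF _ subspace_comp_right[OF subspace_weyl_part]])
         (use 1 that in auto)
    then show ?thesis using assms(1) by auto
  qed
  have "plinear d" using weyl_part_graded[OF assms(1)] by (simp add: graded_op_def)
  then have "weyl_part n l \<subseteq> {e. d \<circ> e \<in> weyl_part n (k + l)}"
    by (subst weyl_part_def, intro ov.span_minimal[OF _ subspace_comp_left[OF subspace_weyl_part]])
       (use 2 in auto)
  then show ?thesis using assms(2) by auto
qed

section \<open>Permutations acting on the Weyl algebra\<close>

lemma conj_mulx: "bij \<sigma> \<Longrightarrow> perm_act \<sigma> \<circ> mulx j \<circ> perm_act (inv \<sigma>) = mulx (\<sigma> j)"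
  and conj_pdiff: "bij \<sigma> \<Longrightarrow> perm_act \<sigma> \<circ> pdiff j \<circ> perm_act (inv \<sigma>) = pdiff (\<sigma> j)"
proof -
  assume b: "bij \<sigma>"
  have bi: "bij (inv \<sigma>)" by (rule bij_imp_bij_inv[OF b])
  have lin: "plinear (perm_act \<sigma> \<circ> T \<circ> perm_act (inv \<sigma>))" if "plinear T" for T
    unfolding o_def
    by (rule plinear_compose[OF linear_perm_act[OF b] plinear_compose[OF that linear_perm_act[OF bi]]])
  have ii: "inv (inv \<sigma>) = \<sigma>" using b by (rule inv_inv_eq)
  have add: "mperm (inv \<sigma>) (mperm \<sigma> m + unit_exp j) = m + unit_exp (\<sigma> j)" for m
    by (rule poly_mapping_eqI)
       (auto simp: lookup_mperm b bi lookup_add lookup_unit_exp bij_is_surj surj_f_inv_f bij_is_inj)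
  have sub: "mperm (inv \<sigma>) (mperm \<sigma> m - unit_exp j) = m - unit_exp (\<sigma> j)" for m
    by (rule poly_mapping_eqI)
       (auto simp: lookup_mperm b bi lookup_minus lookup_unit_exp bij_is_surj surj_f_inv_f bij_is_inj)
  show "perm_act \<sigma> \<circ> mulx j \<circ> perm_act (inv \<sigma>) = mulx (\<sigma> j)"
    by (rule plinear_eqI[OF lin[OF linear_mulx] linear_mulx])
       (simp add: perm_act_mon b bi mulx_mon ii add)
  show "perm_act \<sigma> \<circ> pdiff j \<circ> perm_act (inv \<sigma>) = pdiff (\<sigma> j)"
    by (rule plinear_eqI[OF lin[OF linear_pdiff] linear_pdiff])
       (simp add: perm_act_mon b bi pdiff_mon ii sub pp.linear_scale[OF linear_perm_act[OF b]] lookup_mperm)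
qed

lemma weyl_part_conj:
  assumes \<sigma>: "\<sigma> permutes {1..n}" and d: "d \<in> weyl_part n k"
  shows "perm_act \<sigma> \<circ> d \<circ> perm_act (inv \<sigma>) \<in> weyl_part n k"
proof -
  have b: "bij \<sigma>" by (rule permutes_bij[OF \<sigma>])
  have cancel: "perm_act (inv \<sigma>) \<circ> perm_act \<sigma> = id" "perm_act \<sigma> \<circ> perm_act (inv \<sigma>) = id"
    by (auto simp: fun_eq_iff perm_act_inv b)
  have gen: "\<exists>h\<in>weyl_gens n. snd h = snd g \<and> perm_act \<sigma> \<circ> fst g \<circ> perm_act (inv \<sigma>) = fst h"
    if "g \<in> weyl_gens n" for g
  proof -
    from that obtain j where j: "j \<in> {1..n}" "g = (mulx j, 1) \<or> g = (pdiff j, -1)"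
      by (auto simp: weyl_gens_def)
    then have "\<sigma> j \<in> {1..n}" using permutes_in_image[OF \<sigma>] by blast
    then have "(mulx (\<sigma> j), 1) \<in> weyl_gens n" "(pdiff (\<sigma> j), -1) \<in> weyl_gens n"
      unfolding weyl_gens_def by blast+
    then show ?thesis
      using j(2) conj_mulx[OF b, of j] conj_pdiff[OF b, of j] by (metis fst_conv snd_conv)
  qed
  have words: "\<exists>vs\<in>lists (weyl_gens n). sum_list (map snd vs) = sum_list (map snd ws) \<and>
      perm_act \<sigma> \<circ> word ws \<circ> perm_act (inv \<sigma>) = word vs" if "ws \<in> lists (weyl_gens n)" for ws
    using that
  proof (induction ws rule: lists.induct)
    case Nil
    show ?case by (rule bexI[of _ "[]"]) (auto simp: cancel)
  next
    case (Cons g ws)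
    from Cons.IH obtain vs where vs: "vs \<in> lists (weyl_gens n)" "sum_list (map snd vs) = sum_list (map snd ws)"
      "perm_act \<sigma> \<circ> word ws \<circ> perm_act (inv \<sigma>) = word vs" by blast
    from gen[OF Cons.hyps(1)] obtain h where h: "h \<in> weyl_gens n" "snd h = snd g"
      "perm_act \<sigma> \<circ> fst g \<circ> perm_act (inv \<sigma>) = fst h" by blast
    have "perm_act \<sigma> \<circ> word (g # ws) \<circ> perm_act (inv \<sigma>) =
       (perm_act \<sigma> \<circ> fst g \<circ> perm_act (inv \<sigma>)) \<circ> (perm_act \<sigma> \<circ> word ws \<circ> perm_act (inv \<sigma>))"
      unfolding word_Cons by (simp add: fun_eq_iff perm_act_inv b)
    also have "\<dots> = word (h # vs)"
      unfolding h(3) vs(3) word_Cons ..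
    finally have eq: "perm_act \<sigma> \<circ> word (g # ws) \<circ> perm_act (inv \<sigma>) = word (h # vs)" .
    show ?case
    proof (intro bexI[of _ "h # vs"] conjI)
      show "sum_list (map snd (h # vs)) = sum_list (map snd (g # ws))"
        by (simp add: h(2) vs(2))
      show "h # vs \<in> lists (weyl_gens n)" using h(1) vs(1) by simp
    qed (rule eq)
  qed
  have *: "perm_act \<sigma> \<circ> word ws \<circ> perm_act (inv \<sigma>) \<in> weyl_part n k"
    if ws: "ws \<in> lists (weyl_gens n)" "sum_list (map snd ws) = k" for ws
  proof -
    obtain vs where vs: "vs \<in> lists (weyl_gens n)" "sum_list (map snd vs) = k"
      "perm_act \<sigma> \<circ> word ws \<circ> perm_act (inv \<sigma>) = word vs"
      using words[OF ws(1)] ws(2) by metis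
    show ?thesis
      unfolding vs(3) weyl_part_alt by (rule ov.span_base) (use vs(1,2) in blast)
  qed
  have sub: "ov.subspace {d. perm_act \<sigma> \<circ> d \<circ> perm_act (inv \<sigma>) \<in> weyl_part n k}"
    using subspace_comp_left[OF subspace_comp_right[OF subspace_weyl_part] linear_perm_act[OF b]]
    by (simp only: mem_Collect_eq)
  have "weyl_part n k \<subseteq> {d. perm_act \<sigma> \<circ> d \<circ> perm_act (inv \<sigma>) \<in> weyl_part n k}"
    by (subst weyl_part_def, rule ov.span_minimal[OF _ sub]) (use * in auto)
  then show ?thesis using d by auto
qed

section \<open>Density of the Weyl algebra and of its invariants\<close>

lemma exponent_remove:
  assumes "lookup m j \<noteq> 0" shows "(m - unit_exp j) + unit_exp j = m"
  by (rule poly_mapping_eqI) (use assms in \<open>auto simp: lookup_add lookup_minus lookup_unit_exp\<close>)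

lemma deg_pos:
  assumes "keys m \<subseteq> {1..n}" "m \<noteq> 0" obtains j where "j \<in> {1..n}" "lookup m j \<noteq> 0"
  using assms by (metis all_not_in_conv in_keys_iff keys_eq_empty subset_iff)

text \<open>
  On monomials of no larger degree a suitable multiple of the differential monomial of \<open>m\<close> is the
  coefficient functional of \<open>m\<close>: it kills all monomials that \<open>m\<close> does not divide.
\<close>

lemma lowering_op:
  assumes "keys m \<subseteq> {1..n}"
  shows "\<exists>d\<in>weyl_part n (- int (deg n m)). d (mon m) = mon 0 \<and>
    (\<forall>m'. keys m' \<subseteq> {1..n} \<and> deg n m' \<le> deg n m \<and> m' \<noteq> m \<longrightarrow> d (mon m') = 0)"
  using assms
proof (induction "deg n m" arbitrary: m rule: less_induct)
  case less
  show ?case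
  proof (cases "m = 0")
    case True
    have "m' = 0" if "keys m' \<subseteq> {1..n}" "deg n m' \<le> 0" for m'
      using that by (metis deg_pos deg_minus_unit_exp add_is_0 le_zero_eq one_neq_zero)
    moreover have "deg n 0 = 0" by (simp add: deg_def)
    ultimately show ?thesis
      using weyl_part_id[of n] True by (intro bexI[of _ id]) auto
  next
    case False
    then obtain j where j: "j \<in> {1..n}" "lookup m j \<noteq> 0" using deg_pos less.prems by metis
    let ?m = "m - unit_exp j"
    have dm: "deg n ?m + 1 = deg n m" by (rule deg_minus_unit_exp[OF j])
    have km: "keys ?m \<subseteq> {1..n}" using keys_minus_unit_exp less.prems by blast
    obtain d where d: "d \<in> weyl_part n (- int (deg n ?m))" "d (mon ?m) = mon 0"
      "\<And>m'. keys m' \<subseteq> {1..n} \<Longrightarrow> deg n m' \<le> deg n ?m \<Longrightarrow> m' \<noteq> ?m \<Longrightarrow> d (mon m') = 0"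
      using less.hyps[of ?m] dm km by auto
    have dl: "plinear d" using weyl_part_graded[OF d(1)] by (simp add: graded_op_def)
    let ?d = "oscale (1 / of_nat (lookup m j)) (d \<circ> pdiff j)"
    have "pdiff j \<in> weyl_part n (-1)"
      using weyl_part_gen[of "(pdiff j, -1)" n] j(1) by (auto simp: weyl_gens_def)
    then have "d \<circ> pdiff j \<in> weyl_part n (- int (deg n ?m) + -1)" using weyl_part_comp[OF d(1)] by blast
    also have "- int (deg n ?m) + -1 = - int (deg n m)" using dm by simp
    finally have "?d \<in> weyl_part n (- int (deg n m))" by (rule ov.subspace_scale[OF subspace_weyl_part])
    moreover have "?d (mon m) = mon 0"
      using j(2) by (simp add: oscale_def pdiff_mon pp.linear_scale[OF dl] d(2))
    moreover have "?d (mon m') = 0" if "keys m' \<subseteq> {1..n}" "deg n m' \<le> deg n m" "m' \<noteq> m" for m'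
    proof (cases "lookup m' j = 0")
      case False
      have "deg n (m' - unit_exp j) + 1 = deg n m'" by (rule deg_minus_unit_exp[OF j(1) False])
      moreover have "m' - unit_exp j \<noteq> ?m" using exponent_remove False j(2) that(3) by metis
      moreover have "keys (m' - unit_exp j) \<subseteq> {1..n}" using keys_minus_unit_exp that(1) by blast
      ultimately have "d (mon (m' - unit_exp j)) = 0" using d(3) that(2) dm by auto
      then show ?thesis by (simp add: oscale_def pdiff_mon pp.linear_scale[OF dl])
    qed (simp add: oscale_def pdiff_mon pp.linear_0[OF dl])
    ultimately show ?thesis by blast
  qed
qed

lemma creating_op:
  assumes "keys m \<subseteq> {1..n}"
  shows "\<exists>d\<in>weyl_part n (int (deg n m)). d (mon 0) = mon m"
  using assms
proof (induction "deg n m" arbitrary: m rule: less_induct)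
  case less
  show ?case
  proof (cases "m = 0")
    case True
    then show ?thesis using weyl_part_id[of n] by (intro bexI[of _ id]) (auto simp: deg_def)
  next
    case False
    then obtain j where j: "j \<in> {1..n}" "lookup m j \<noteq> 0" using deg_pos less.prems by metis
    let ?m = "m - unit_exp j"
    have dm: "deg n ?m + 1 = deg n m" by (rule deg_minus_unit_exp[OF j])
    have km: "keys ?m \<subseteq> {1..n}" using keys_minus_unit_exp less.prems by blast
    obtain d where d: "d \<in> weyl_part n (int (deg n ?m))" "d (mon 0) = mon ?m"
      using less.hyps[of ?m] dm km by auto
    have "mulx j \<in> weyl_part n 1"
      using weyl_part_gen[of "(mulx j, 1)" n] j(1) by (auto simp: weyl_gens_def)
    then have "mulx j \<circ> d \<in> weyl_part n (1 + int (deg n ?m))" using weyl_part_comp d(1) by blast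
    also have "1 + int (deg n ?m) = int (deg n m)" using dm by simp
    finally show ?thesis
      by (rule bexI[rotated]) (simp add: d(2) mulx_mon exponent_remove[OF j(2)])
  qed
qed

lemma matrix_unit_op:
  assumes "keys m \<subseteq> {1..n}" "keys k \<subseteq> {1..n}"
  shows "\<exists>d\<in>weyl_part n (int (deg n k) - int (deg n m)). d (mon m) = mon k \<and>
    (\<forall>m'. keys m' \<subseteq> {1..n} \<and> deg n m' \<le> deg n m \<and> m' \<noteq> m \<longrightarrow> d (mon m') = 0)"
proof -
  obtain d where d: "d \<in> weyl_part n (- int (deg n m))" "d (mon m) = mon 0"
    "\<And>m'. keys m' \<subseteq> {1..n} \<Longrightarrow> deg n m' \<le> deg n m \<Longrightarrow> m' \<noteq> m \<Longrightarrow> d (mon m') = 0"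
    using lowering_op[OF assms(1)] by auto
  obtain e where e: "e \<in> weyl_part n (int (deg n k))" "e (mon 0) = mon k"
    using creating_op[OF assms(2)] by auto
  have "plinear e" using weyl_part_graded[OF e(1)] by (simp add: graded_op_def)
  then show ?thesis
    using weyl_part_comp[OF e(1) d(1)] d e
    by (intro bexI[of _ "e \<circ> d"]) (auto simp: pp.linear_0)
qed

text \<open>
  The set of monomials is built up in order of increasing degree. A correction at a new monomial \<open>m\<close> can
  then be made with the operators of \<open>matrix_unit_op\<close>, which vanish on all monomials treated before.
\<close>

lemma weyl_part_dense:
  assumes T: "graded_op n k T" and "finite M" and "\<And>m. m \<in> M \<Longrightarrow> keys m \<subseteq> {1..n}"
  shows "\<exists>d\<in>weyl_part n k. \<forall>m\<in>M. d (mon m) = T (mon m)"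
  using assms(2,3)
proof (induction M rule: finite_ranking_induct[where f = "deg n"])
  case empty
  show ?case using ov.subspace_0[OF subspace_weyl_part] by blast
next
  case (insert m M)
  then obtain d where d: "d \<in> weyl_part n k" "\<And>m'. m' \<in> M \<Longrightarrow> d (mon m') = T (mon m')" by auto
  have km: "keys m \<subseteq> {1..n}" using insert.prems by auto
  show ?case
  proof (cases "m \<in> M")
    case True
    then show ?thesis using d by (auto simp: insert_absorb)
  next
    case False
    let ?e = "T (mon m) - d (mon m)"
    have gd: "graded_op n k d" by (rule weyl_part_graded[OF d(1)])
    have e: "keys b \<subseteq> {1..n}" "int (deg n b) = int (deg n m) + k" if "b \<in> keys ?e" for b
    proof -
      have "?e \<in> polys n"
        using T gd km by (intro pv.subspace_diff[OF subspace_polys]) (auto simp: graded_op_def)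
      then show "keys b \<subseteq> {1..n}" using that by (auto simp: polys_def)
      have "lookup (T (mon m)) b \<noteq> 0 \<or> lookup (d (mon m)) b \<noteq> 0"
        using that by (auto simp: in_keys_iff lookup_minus)
      then show "int (deg n b) = int (deg n m) + k"
        using T gd by (auto simp: graded_op_def dest: homogD)
    qed
    have "\<exists>u. u \<in> weyl_part n k \<and> u (mon m) = mon b \<and>
        (\<forall>m'. keys m' \<subseteq> {1..n} \<and> deg n m' \<le> deg n m \<and> m' \<noteq> m \<longrightarrow> u (mon m') = 0)"
      if "b \<in> keys ?e" for b
      using matrix_unit_op[OF km e(1)[OF that]] e(2)[OF that] by (auto simp: algebra_simps)
    then obtain u where u: "\<And>b. b \<in> keys ?e \<Longrightarrow> u b \<in> weyl_part n k"
      "\<And>b. b \<in> keys ?e \<Longrightarrow> u b (mon m) = mon b"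
      "\<And>b m'. b \<in> keys ?e \<Longrightarrow> keys m' \<subseteq> {1..n} \<Longrightarrow> deg n m' \<le> deg n m \<Longrightarrow> m' \<noteq> m \<Longrightarrow> u b (mon m') = 0"
      by metis
    let ?d = "d + (\<Sum>b\<in>keys ?e. oscale (lookup ?e b) (u b))"
    have ap: "?d p = d p + (\<Sum>b\<in>keys ?e. pscale (lookup ?e b) (u b p))" for p
    proof -
      have "(\<Sum>b\<in>A. oscale (lookup ?e b) (u b)) p = (\<Sum>b\<in>A. pscale (lookup ?e b) (u b p))" for A
        by (induction A rule: infinite_finite_induct) (auto simp: oscale_def)
      then show ?thesis by simp
    qed
    have "?d \<in> weyl_part n k"
      by (intro ov.subspace_add[OF subspace_weyl_part] d ov.subspace_sum[OF subspace_weyl_part]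
          ov.subspace_scale[OF subspace_weyl_part] u(1))
    moreover have "?d (mon m) = T (mon m)"
    proof -
      have "(\<Sum>b\<in>keys ?e. pscale (lookup ?e b) (u b (mon m))) = (\<Sum>b\<in>keys ?e. pscale (lookup ?e b) (mon b))"
        by (rule sum.cong) (simp_all add: u(2))
      also have "\<dots> = ?e" by (rule poly_expand[OF finite_keys order_refl, symmetric])
      finally show ?thesis unfolding ap by simp
    qed
    moreover have "?d (mon m') = T (mon m')" if "m' \<in> M" for m'
    proof -
      have "u b (mon m') = 0" if "b \<in> keys ?e" for b
        using u(3)[OF that] insert.prems insert.hyps \<open>m' \<in> M\<close> False by auto
      then show ?thesis unfolding ap using d(2)[OF that] by simp
    qed
    ultimately show ?thesis by blast
  qed
qed

lemma weyl_inv_commutant: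
  assumes "d \<in> weyl_inv n i" shows "d \<in> commutant n i"
proof (rule commutantI)
  have d: "d \<in> weyl n" "\<And>\<sigma>. \<sigma> permutes {1..i} \<Longrightarrow> perm_act \<sigma> \<circ> d \<circ> perm_act (inv \<sigma>) = d"
    using assms by (auto simp: weyl_inv_def sym_invariants_def)
  show "plinear d" "\<And>p. p \<in> polys n \<Longrightarrow> d p \<in> polys n"
    using weyl_linear_polys[OF d(1)] by auto
  show "d (perm_act \<sigma> p) = perm_act \<sigma> (d p)" if "\<sigma> permutes {1..i}" for \<sigma> p
    using fun_cong[OF d(2)[OF that], of "perm_act \<sigma> p"] permutes_bij[OF that] by (simp add: perm_act_inv)
qed

lemma subspace_weyl_inv: "ov.subspace (weyl_inv n i)"
proof -
  have "ov.subspace {d. perm_act \<sigma> \<circ> d \<circ> perm_act (inv \<sigma>) = d}" if "\<sigma> permutes {1..i}" for \<sigma>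
  proof -
    note l = linear_perm_act[OF permutes_bij[OF that]]
    show ?thesis
      by (rule ov.subspaceI)
         (auto simp: fun_eq_iff oscale_def pp.linear_0[OF l] pp.linear_add[OF l] pp.linear_scale[OF l])
  qed
  then have "ov.subspace (weyl n \<inter> (\<Inter>\<sigma>\<in>perms i. {d. perm_act \<sigma> \<circ> d \<circ> perm_act (inv \<sigma>) = d}))"
    by (intro ov.subspace_inter ov.subspace_Int) (auto simp: weyl_def op_algebra_def)
  also have "weyl n \<inter> (\<Inter>\<sigma>\<in>perms i. {d. perm_act \<sigma> \<circ> d \<circ> perm_act (inv \<sigma>) = d}) = weyl_inv n i"
    by (auto simp: weyl_inv_def sym_invariants_def)
  finally show ?thesis .
qed

text \<open>
  The monomials of the whole group orbit of \<open>f\<close> are matched by an operator of the Weyl algebra, which is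
  then averaged; the result still agrees with \<open>T\<close> at \<open>f\<close> because \<open>T\<close> is equivariant.
\<close>

lemma weyl_inv_dense_homog:
  assumes "i \<le> n" and T: "T \<in> commutant n i" "homog n k T" and f: "f \<in> polys n"
  shows "\<exists>d\<in>weyl_inv n i \<inter> weyl_part n k. d f = T f"
proof -
  define M where "M = (\<Union>\<sigma>\<in>perms i. keys (perm_act (inv \<sigma>) f))"
  have M: "finite M" by (simp add: M_def)
  have "keys m \<subseteq> {1..n}" if "m \<in> M" for m
    using that perm_act_polys[OF permutes_inv assms(1) f] by (auto simp: M_def polys_def)
  moreover have "graded_op n k T"
    using T(2) commutant_linear[OF T(1)] commutant_polys[OF T(1)] by (simp add: graded_op_def)
  ultimately obtain d0 where d0: "d0 \<in> weyl_part n k" "\<And>m. m \<in> M \<Longrightarrow> d0 (mon m) = T (mon m)"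
    using weyl_part_dense[of n k T M] M by blast
  have l0: "plinear d0" using weyl_part_graded[OF d0(1)] by (simp add: graded_op_def)
  let ?d = "average i d0"
  have "?d = oscale (1 / of_nat (card (perms i))) (\<Sum>\<sigma>\<in>perms i. perm_act \<sigma> \<circ> d0 \<circ> perm_act (inv \<sigma>))"
  proof
    fix p
    have "(\<Sum>\<sigma>\<in>A. perm_act \<sigma> \<circ> d0 \<circ> perm_act (inv \<sigma>)) p = (\<Sum>\<sigma>\<in>A. perm_act \<sigma> (d0 (perm_act (inv \<sigma>) p)))" for A
      by (induction A rule: infinite_finite_induct) auto
    then show "?d p = oscale (1 / of_nat (card (perms i))) (\<Sum>\<sigma>\<in>perms i. perm_act \<sigma> \<circ> d0 \<circ> perm_act (inv \<sigma>)) p"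
      by (simp add: average_def symm_def oscale_def)
  qed
  also have "\<dots> \<in> weyl_part n k"
    by (intro ov.subspace_scale[OF subspace_weyl_part] ov.subspace_sum[OF subspace_weyl_part]
        weyl_part_conj d0(1)) (auto intro: perms_mono[OF _ assms(1)])
  finally have part: "?d \<in> weyl_part n k" .
  have "perm_act \<sigma> \<circ> ?d \<circ> perm_act (inv \<sigma>) = ?d" if "\<sigma> permutes {1..i}" for \<sigma>
    using average_equivariant[OF l0, of i] that permutes_inv[OF that]
    by (auto simp: equivariant_def fun_eq_iff perm_act_inv permutes_bij)
  then have "?d \<in> weyl_inv n i"
    using part weyl_part_subset by (auto simp: weyl_inv_def sym_invariants_def)
  moreover have "?d f = T f"
  proof (rule average_eqI)
    fix \<sigma> assume \<sigma>: "\<sigma> permutes {1..i}"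
    have "d0 (perm_act (inv \<sigma>) f) = T (perm_act (inv \<sigma>) f)"
    proof -
      have sub: "keys (perm_act (inv \<sigma>) f) \<subseteq> M" using \<sigma> by (auto simp: M_def)
      show ?thesis
        unfolding plinear_expand[OF l0 M sub] plinear_expand[OF commutant_linear[OF T(1)] M sub]
        by (rule sum.cong) (simp_all add: d0(2))
    qed
    then show "perm_act \<sigma> (d0 (perm_act (inv \<sigma>) f)) = T f"
      by (simp only: commutant_perm[OF T(1) \<sigma>, symmetric] perm_act_inv permutes_bij[OF \<sigma>])
  qed
  ultimately show ?thesis using part by blast
qed

lemma poly_sum_deg_part:
  assumes "finite D" "deg n ` keys f \<subseteq> D" shows "f = (\<Sum>d\<in>D. deg_part n d f)"
proof (rule poly_mapping_eqI)
  fix m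
  have "(\<Sum>d\<in>D. if deg n m = d then lookup f m else 0) = lookup f m"
    by (cases "lookup f m = 0") (use assms in \<open>auto simp: in_keys_iff image_subset_iff\<close>)
  then show "lookup f m = lookup (\<Sum>d\<in>D. deg_part n d f) m" by (simp add: lookup_sum)
qed

lemma commutant_component:
  assumes "i \<le> n" "T \<in> commutant n i"
  shows "(\<lambda>p. deg_part n e (T (deg_part n d p))) \<in> commutant n i"
  by (rule commutant_compose[OF commutant_deg_part[OF assms(1)] commutant_compose[OF assms(2) commutant_deg_part[OF assms(1)]]])

lemma weyl_inv_dense:
  assumes "i \<le> n" and T: "T \<in> commutant n i" and f: "f \<in> polys n"
  shows "\<exists>d\<in>weyl_inv n i. d f = T f"
proof -
  let ?A = "deg n ` keys f" and ?B = "deg n ` keys (T f)"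
  let ?T = "\<lambda>a b p. deg_part n b (T (deg_part n a p))"
  have "\<exists>d. d \<in> weyl_inv n i \<and> d f = ?T a b f" for a b
    using weyl_inv_dense_homog[OF assms(1) commutant_component[OF assms(1) T, of b a]
        homog_deg_part[OF commutant_linear[OF T], of n b a] f]
    unfolding Bex_def Int_iff by (elim exE conjE) (intro exI conjI)
  then have "\<exists>D. \<forall>a b. D a b \<in> weyl_inv n i \<and> D a b f = ?T a b f"
    by (intro choice allI)
  then obtain D where "\<forall>a b. D a b \<in> weyl_inv n i \<and> D a b f = ?T a b f" by (rule exE)
  then have D: "D a b \<in> weyl_inv n i" "D a b f = ?T a b f" for a b by simp_all
  let ?d = "\<Sum>b\<in>?B. \<Sum>a\<in>?A. D a b"
  have s: "(\<Sum>a\<in>A. D' a) p = (\<Sum>a\<in>A. D' a p)" for A :: "nat set" and D' :: "nat \<Rightarrow> mop" and p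
    by (induction A rule: infinite_finite_induct) auto
  have "?d f = (\<Sum>b\<in>?B. \<Sum>a\<in>?A. ?T a b f)"
    by (simp only: s D(2))
  also have "\<dots> = (\<Sum>b\<in>?B. deg_part n b (T (\<Sum>a\<in>?A. deg_part n a f)))"
    by (simp only: pp.linear_sum[OF linear_coeff_filter] pp.linear_sum[OF commutant_linear[OF T]])
  also have "\<dots> = T f"
    by (simp only: poly_sum_deg_part[of ?A n f, symmetric] poly_sum_deg_part[of ?B n "T f", symmetric]
        finite_imageI finite_keys order_refl)
  finally show ?thesis
    by (intro bexI[of _ ?d] ov.subspace_sum[OF subspace_weyl_inv] D(1))
qed

lemma weyl_inv_orbit:
  assumes "i \<le> n" "v \<in> polys n"
  shows "(\<lambda>d. d v) ` weyl_inv n i = (\<lambda>T. T v) ` commutant n i"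
proof (intro equalityI subsetI)
  fix y assume "y \<in> (\<lambda>d. d v) ` weyl_inv n i"
  then obtain d where "d \<in> weyl_inv n i" "y = d v" by (rule imageE)
  then show "y \<in> (\<lambda>T. T v) ` commutant n i"
    using weyl_inv_commutant[of d n i] by (intro image_eqI[of _ _ d]) simp_all
next
  fix y assume "y \<in> (\<lambda>T. T v) ` commutant n i"
  then obtain T where T: "T \<in> commutant n i" "y = T v" by (rule imageE)
  from weyl_inv_dense[OF assms(1) T(1) assms(2)] obtain d where "d \<in> weyl_inv n i" "d v = T v"
    by (rule bexE)
  then show "y \<in> (\<lambda>d. d v) ` weyl_inv n i" using T(2) by (intro image_eqI[of _ _ d]) simp_all
qed

text \<open>
  This is where differential operators disappear: from here on annihilators and orbits are described by
  the commutant alone.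
\<close>

lemma weyl_inv_neg_iff:
  assumes "i \<le> n" "f \<in> polys n"
  shows "(\<forall>d\<in>weyl_inv_neg n i. d f = 0) \<longleftrightarrow> f \<in> hw_vectors i"
proof
  assume *: "\<forall>d\<in>weyl_inv_neg n i. d f = 0"
  have "T f = 0" if T: "T \<in> commutant n i" "k < 0" "homog n k T" for T k
  proof -
    obtain d where "d \<in> weyl_inv n i \<inter> weyl_part n k" "d f = T f"
      using weyl_inv_dense_homog[OF assms(1) T(1,3) assms(2)] by blast
    moreover from this have "d \<in> weyl_inv_neg n i"
      unfolding weyl_inv_neg_def by (intro ov.span_base) (use T(2) in auto)
    ultimately show ?thesis using * by metis
  qed
  then show "f \<in> hw_vectors i" using hw_vectors_iff[OF assms(1)] assms(2) by blast
next
  assume f: "f \<in> hw_vectors i"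
  have "ov.subspace {d. d f = 0}"
    by (rule ov.subspaceI) (auto simp: oscale_def)
  moreover have "(\<Union>k\<in>{..<0}. weyl_inv n i \<inter> weyl_part n k) \<subseteq> {d. d f = 0}"
  proof (intro subsetI CollectI)
    fix d assume "d \<in> (\<Union>k\<in>{..<0}. weyl_inv n i \<inter> weyl_part n k)"
    then obtain k where k: "k < 0" "d \<in> weyl_inv n i" "d \<in> weyl_part n k" by auto
    have "homog n k d" using weyl_part_graded[OF k(3)] by (simp add: graded_op_def)
    then show "d f = 0" by (rule hw_vectors_negative[OF f assms(1) weyl_inv_commutant[OF k(2)] _ k(1)])
  qed
  ultimately have "weyl_inv_neg n i \<subseteq> {d. d f = 0}"
    unfolding weyl_inv_neg_def by (rule ov.span_minimal[rotated])
  then show "\<forall>d\<in>weyl_inv_neg n i. d f = 0" by auto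
qed

lemma ann_neg_eq: "i \<le> n \<Longrightarrow> N \<subseteq> polys n \<Longrightarrow> ann_neg n i N = N \<inter> hw_vectors i"
  unfolding ann_neg_def using weyl_inv_neg_iff by blast

lemma B_ann_eq: "B_ann n = hw_vectors n"
  unfolding B_ann_def using ann_neg_eq[of n n "polys n"] hw_vectors_polys by auto

section \<open>Sums of transpositions on highest weight vectors\<close>

definition transp_sum :: "nat \<Rightarrow> mop" where
  "transp_sum i p = (\<Sum>k\<in>{1..i}. jucys_murphy k p)"

text \<open>
  With rows of a Young diagram indexed by exponents and row lengths given by multiplicities, the first
  sum counts pairs of boxes in a common row, which adds up column indices, and the second one adds up row
  indices, so the difference is
  the sum of the contents of all boxes.
\<close>

definition content_sum :: "nat \<Rightarrow> (nat \<Rightarrow>\<^sub>0 nat) \<Rightarrow> complex" where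
  "content_sum i m = of_nat (\<Sum>k\<in>{1..i}. card {j\<in>{1..k-1}. lookup m j = lookup m k})
     - of_nat (\<Sum>k\<in>{1..i}. lookup m k)"

lemma lookup_transp_sum:
  "lookup (transp_sum i f) m =
    (\<Sum>(j,k)\<in>{(j,k). j \<in> {1..i} \<and> k \<in> {1..i} \<and> j < k}. lookup f (mperm (transpose j k) m))"
proof -
  have "lookup (transp_sum i f) m = (\<Sum>k\<in>{1..i}. \<Sum>j\<in>{1..k-1}. lookup f (mperm (transpose j k) m))"
    by (simp add: transp_sum_def jucys_murphy_def lookup_sum lookup_perm_act)
  also have "\<dots> = (\<Sum>(k,j)\<in>(SIGMA k:{1..i}. {1..k-1}). lookup f (mperm (transpose j k) m))"
    by (rule sum.Sigma) auto
  also have "\<dots> = (\<Sum>(j,k)\<in>{(j,k). j \<in> {1..i} \<and> k \<in> {1..i} \<and> j < k}. lookup f (mperm (transpose j k) m))"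
    by (rule sum.reindex_bij_witness[where i = prod.swap and j = prod.swap]) auto
  finally show ?thesis .
qed

text \<open>
  Lower the \<open>k\<close>-th entry of \<open>m\<close> to \<open>a\<close>. The highest weight equation at this exponent sums over all ways of
  changing one entry \<open>a\<close> to \<open>lookup m k\<close>: at position \<open>k\<close> this restores \<open>m\<close>, elsewhere it gives
  \<open>m\<close> with two entries exchanged.
\<close>

lemma hw_vectors_swap_sum:
  assumes f: "f \<in> hw_vectors i" and k: "k \<in> {1..i}" and a: "a < lookup m k"
  shows "(\<Sum>l\<in>{l\<in>{1..i}. lookup m l = a}. lookup f (mperm (transpose l k) m)) = - lookup f m"
proof -
  let ?b = "lookup m k" and ?m = "upd m k a"
  have "0 = (\<Sum>l\<in>{1..i}. if lookup ?m l = a then lookup f (upd ?m l ?b) else 0)"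
    using lookup_shift_op[of i a ?b f ?m] hw_vectors_shift_op[OF f a] by simp
  also have "\<dots> = lookup f (upd ?m k ?b) +
      (\<Sum>l\<in>{1..i}-{k}. if lookup ?m l = a then lookup f (upd ?m l ?b) else 0)"
    using k by (subst sum.remove[of _ k]) (auto simp: lookup_upd)
  also have "upd ?m k ?b = m"
    by (rule poly_mapping_eqI) (simp add: lookup_upd)
  also have "(\<Sum>l\<in>{1..i}-{k}. if lookup ?m l = a then lookup f (upd ?m l ?b) else 0) =
     (\<Sum>l\<in>{1..i}-{k}. if lookup m l = a then lookup f (mperm (transpose l k) m) else 0)"
  proof (rule sum.cong[OF refl])
    fix l assume l: "l \<in> {1..i}-{k}"
    have "upd ?m l ?b = mperm (transpose l k) m" if "lookup m l = a"
      by (rule poly_mapping_eqI)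
         (use l that in \<open>auto simp: lookup_upd lookup_mperm transpose_def\<close>)
    then show "(if lookup ?m l = a then lookup f (upd ?m l ?b) else 0) =
        (if lookup m l = a then lookup f (mperm (transpose l k) m) else 0)"
      using l by (simp add: lookup_upd)
  qed
  also have "\<dots> = (\<Sum>l\<in>{l\<in>{1..i}-{k}. lookup m l = a}. lookup f (mperm (transpose l k) m))"
    by (rule sum.inter_filter[symmetric]) simp
  also have "{l\<in>{1..i}-{k}. lookup m l = a} = {l\<in>{1..i}. lookup m l = a}"
    using a by auto
  finally show ?thesis by (simp add: eq_neg_iff_add_eq_0 add.commute)
qed

text \<open>
  Transpositions of equal exponents fix \<open>m\<close>. The others are grouped by the position \<open>k\<close> with the larger
  exponent and by the value \<open>a\<close> of the smaller one; by \<open>hw_vectors_swap_sum\<close> each of the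
  \<open>lookup m k\<close> possible values contributes the negative of the coefficient at \<open>m\<close>.
\<close>

lemma transp_sum_hw_vectors:
  assumes f: "f \<in> hw_vectors i" shows "lookup (transp_sum i f) m = content_sum i m * lookup f m"
proof -
  let ?g = "\<lambda>(j,k). lookup f (mperm (transpose j k) m)"
  let ?D = "{(j,k). j \<in> {1..i} \<and> k \<in> {1..i} \<and> j < k}"
  let ?E = "{(j,k). j \<in> {1..i} \<and> k \<in> {1..i} \<and> j < k \<and> lookup m j = lookup m k}"
  let ?N = "{(j,k). j \<in> {1..i} \<and> k \<in> {1..i} \<and> j < k \<and> lookup m j \<noteq> lookup m k}"
  let ?P = "{(j,k). j \<in> {1..i} \<and> k \<in> {1..i} \<and> lookup m j < lookup m k}"
  have fin: "finite ?D" "finite ?E" "finite ?N"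
    by (rule finite_subset[of _ "{1..i} \<times> {1..i}"]; auto)+
  have "sum ?g ?D = sum ?g ?E + sum ?g ?N"
    by (subst sum.union_disjoint[symmetric]) (use fin in \<open>auto intro!: sum.cong\<close>)
  moreover have "sum ?g ?E = of_nat (\<Sum>k\<in>{1..i}. card {j\<in>{1..k-1}. lookup m j = lookup m k}) * lookup f m"
  proof -
    have "sum ?g ?E = (\<Sum>x\<in>?E. lookup f m)"
    proof (rule sum.cong[OF refl])
      fix x assume "x \<in> ?E"
      then obtain j k where x: "x = (j, k)" "lookup m j = lookup m k" by auto
      have "mperm (transpose j k) m = m"
        by (rule poly_mapping_eqI) (auto simp: lookup_mperm transpose_def x(2))
      then show "?g x = lookup f m" by (simp add: x(1))
    qed
    also have "\<dots> = of_nat (card ?E) * lookup f m" by simp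
    also have "card ?E = card (SIGMA k:{1..i}. {j\<in>{1..k-1}. lookup m j = lookup m k})"
      by (rule bij_betw_same_card[of prod.swap], rule bij_betwI[where g = prod.swap]) auto
    also have "\<dots> = (\<Sum>k\<in>{1..i}. card {j\<in>{1..k-1}. lookup m j = lookup m k})"
      by (rule card_SigmaI) auto
    finally show ?thesis .
  qed
  moreover have "sum ?g ?N = sum ?g ?P"
    by (rule sum.reindex_bij_witness[where i = "\<lambda>(j,k). if j < k then (j,k) else (k,j)"
          and j = "\<lambda>(j,k). if lookup m j < lookup m k then (j,k) else (k,j)"])
       (auto simp: transpose_commute split: if_splits, metis less_irrefl nat_neq_iff)
  moreover have "sum ?g ?P = - (of_nat (\<Sum>k\<in>{1..i}. lookup m k) * lookup f m)"
  proof -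
    have "sum ?g ?P = (\<Sum>(k,l)\<in>(SIGMA k:{1..i}. {l\<in>{1..i}. lookup m l < lookup m k}). lookup f (mperm (transpose l k) m))"
      by (rule sum.reindex_bij_witness[where i = prod.swap and j = prod.swap]) auto
    also have "\<dots> = (\<Sum>k\<in>{1..i}. \<Sum>l\<in>{l\<in>{1..i}. lookup m l < lookup m k}. lookup f (mperm (transpose l k) m))"
      by (rule sum.Sigma[symmetric]) auto
    also have "\<dots> = (\<Sum>k\<in>{1..i}. - (of_nat (lookup m k) * lookup f m))"
    proof (rule sum.cong[OF refl])
      fix k assume k: "k \<in> {1..i}"
      have "(\<Sum>l\<in>{l\<in>{1..i}. lookup m l < lookup m k}. lookup f (mperm (transpose l k) m)) =
        (\<Sum>a\<in>{..<lookup m k}. \<Sum>l\<in>{l\<in>{l\<in>{1..i}. lookup m l < lookup m k}. lookup m l = a}. lookup f (mperm (transpose l k) m))"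
        by (rule sum.group[symmetric]) auto
      also have "\<dots> = (\<Sum>a\<in>{..<lookup m k}. - lookup f m)"
      proof (rule sum.cong[OF refl])
        fix a assume "a \<in> {..<lookup m k}"
        then have a: "a < lookup m k" by simp
        then have "{l\<in>{l\<in>{1..i}. lookup m l < lookup m k}. lookup m l = a} = {l\<in>{1..i}. lookup m l = a}"
          by auto
        then show "(\<Sum>l\<in>{l\<in>{l\<in>{1..i}. lookup m l < lookup m k}. lookup m l = a}. lookup f (mperm (transpose l k) m)) = - lookup f m"
          using hw_vectors_swap_sum[OF f k a] by simp
      qed
      finally show "(\<Sum>l\<in>{l\<in>{1..i}. lookup m l < lookup m k}. lookup f (mperm (transpose l k) m)) =
          - (of_nat (lookup m k) * lookup f m)" by simp
    qed
    finally show ?thesis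
      by (simp add: sum_negf sum_distrib_right)
  qed
  ultimately show ?thesis
    unfolding lookup_transp_sum content_sum_def by (simp add: algebra_simps)
qed

lemma count_exp_type: "count (exp_type i m) a = card {j\<in>{1..i}. lookup m j = a}"
  unfolding exp_type_def by (simp add: count_image_mset' ) (metis (no_types, lifting) Collect_cong)

lemma content_sum_upd:
  assumes "keys m \<subseteq> {1..i}"
  shows "content_sum (Suc i) (upd m (Suc i) c) = content_sum i m + of_nat (count (exp_type i m) c) - of_nat c"
proof -
  have "lookup (upd m (Suc i) c) k = lookup m k" if "k \<in> {1..i}" for k
    using that by (simp add: lookup_upd)
  then have 1: "(\<Sum>k\<in>{1..i}. lookup (upd m (Suc i) c) k) = (\<Sum>k\<in>{1..i}. lookup m k)"
    by (intro sum.cong) auto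
  have 2: "(\<Sum>k\<in>{1..i}. card {j\<in>{1..k-1}. lookup (upd m (Suc i) c) j = lookup (upd m (Suc i) c) k}) =
      (\<Sum>k\<in>{1..i}. card {j\<in>{1..k-1}. lookup m j = lookup m k})"
  proof (intro sum.cong refl arg_cong[of _ _ card])
    fix k assume "k \<in> {1..i}"
    then show "{j\<in>{1..k-1}. lookup (upd m (Suc i) c) j = lookup (upd m (Suc i) c) k} =
        {j\<in>{1..k-1}. lookup m j = lookup m k}"
      by (auto simp: lookup_upd)
  qed
  have 3: "card {j\<in>{1..Suc i - 1}. lookup (upd m (Suc i) c) j = lookup (upd m (Suc i) c) (Suc i)} = count (exp_type i m) c"
    unfolding count_exp_type by (rule arg_cong[of _ _ card]) (auto simp: lookup_upd)
  have r: "{1..Suc i} = insert (Suc i) {1..i}" by auto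
  show ?thesis
    unfolding content_sum_def r using 1 2 3 by (simp add: lookup_upd)
qed

section \<open>Leading coefficients in the last variable\<close>

text \<open>
  The coefficient of the \<open>c\<close>-th power of the \<open>j\<close>-th variable, as a polynomial in the other variables.
\<close>

abbreviation slice :: "nat \<Rightarrow> nat \<Rightarrow> mop" where
  "slice j c \<equiv> munit {j} (\<lambda>_. 0) (\<lambda>_. c)"

lemma lookup_slice: "lookup (slice j c f) m = (if lookup m j = 0 then lookup f (upd m j c) else 0)"
  by (simp add: lookup_munit)

text \<open>
  In a highest weight equation the shift of the last variable only contributes a coefficient of a higher
  power of this variable, which is zero above the leading one.
\<close>

lemma slice_hw_vectors:
  assumes f: "f \<in> hw_vectors (Suc i)" and top: "\<And>c'. c < c' \<Longrightarrow> slice (Suc i) c' f = 0"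
  shows "slice (Suc i) c f \<in> hw_vectors i"
  unfolding hw_vectors_def mem_Collect_eq
proof (intro conjI allI impI)
  show "slice (Suc i) c f \<in> polys i"
    unfolding polys_def mem_Collect_eq
  proof (intro ballI subsetI)
    fix m l assume m: "m \<in> keys (slice (Suc i) c f)" and l: "l \<in> keys m"
    then have 0: "lookup m (Suc i) = 0" "lookup f (upd m (Suc i) c) \<noteq> 0"
      by (auto simp: in_keys_iff lookup_slice split: if_splits)
    then have ne: "l \<noteq> Suc i" using l by (auto simp: in_keys_iff)
    have "l \<in> keys (upd m (Suc i) c)" using l ne by (simp add: in_keys_iff lookup_upd)
    then have "l \<in> {1..Suc i}" using polys_lookup[OF hw_vectors_polys[OF f] 0(2)] by blast
    then show "l \<in> {1..i}" using ne by auto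
  qed
  fix a b :: nat assume ab: "a < b"
  show "shift_op i a b (slice (Suc i) c f) = 0"
  proof (rule poly_mapping_eqI)
    fix m
    show "lookup (shift_op i a b (slice (Suc i) c f)) m = lookup 0 m"
    proof (cases "lookup m (Suc i) = 0")
      case False
      then show ?thesis
        unfolding lookup_shift_op lookup_slice by (auto simp: lookup_upd intro!: sum.neutral)
    next
      case True
      let ?m = "upd m (Suc i) c"
      have r: "{1..Suc i} = insert (Suc i) {1..i}" by auto
      have "0 = (\<Sum>l\<in>{1..Suc i}. if lookup ?m l = a then lookup f (upd ?m l b) else 0)"
        using lookup_shift_op[of "Suc i" a b f ?m] hw_vectors_shift_op[OF f ab] by simp
      also have "\<dots> = (if c = a then lookup f (upd ?m (Suc i) b) else 0) +
          (\<Sum>l\<in>{1..i}. if lookup ?m l = a then lookup f (upd ?m l b) else 0)"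
        unfolding r by (subst sum.insert) (auto simp: lookup_upd)
      also have "(if c = a then lookup f (upd ?m (Suc i) b) else 0) = 0"
      proof (cases "c = a")
        case c: True
        have "upd ?m (Suc i) b = upd m (Suc i) b"
          by (rule poly_mapping_eqI) (simp add: lookup_upd)
        then have "lookup f (upd ?m (Suc i) b) = lookup (slice (Suc i) b f) m"
          by (simp add: lookup_slice True)
        then show ?thesis using top[of b] ab c by simp
      qed simp
      also have "(\<Sum>l\<in>{1..i}. if lookup ?m l = a then lookup f (upd ?m l b) else 0) =
          (\<Sum>l\<in>{1..i}. if lookup m l = a then lookup (slice (Suc i) c f) (upd m l b) else 0)"
      proof (rule sum.cong[OF refl])
        fix l assume l: "l \<in> {1..i}"
        have "upd ?m l b = upd (upd m l b) (Suc i) c"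
          by (rule poly_mapping_eqI) (use l in \<open>simp add: lookup_upd\<close>)
        then show "(if lookup ?m l = a then lookup f (upd ?m l b) else 0) =
          (if lookup m l = a then lookup (slice (Suc i) c f) (upd m l b) else 0)"
          using l True by (simp add: lookup_upd lookup_slice)
      qed
      finally show ?thesis by (simp add: lookup_shift_op)
    qed
  qed
qed

lemma top_slice:
  assumes "f \<noteq> 0"
  obtains c where "slice j c f \<noteq> 0" "\<And>c'. c < c' \<Longrightarrow> slice j c' f = 0"
proof -
  let ?C = "(\<lambda>m. lookup m j) ` keys f"
  have fin: "finite ?C" "?C \<noteq> {}" using assms by auto
  obtain m where m: "m \<in> keys f" "lookup m j = Max ?C" using Max_in[OF fin] by auto
  have "upd (upd m j 0) j (Max ?C) = m"
    by (rule poly_mapping_eqI) (simp add: lookup_upd m(2))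
  then have "lookup (slice j (Max ?C) f) (upd m j 0) \<noteq> 0"
    using m(1) by (simp add: lookup_slice lookup_upd in_keys_iff)
  then have 1: "slice j (Max ?C) f \<noteq> 0" by auto
  have "slice j c' f = 0" if "Max ?C < c'" for c'
  proof (rule poly_mapping_eqI)
    fix k
    have "upd k j c' \<notin> keys f"
    proof
      assume "upd k j c' \<in> keys f"
      moreover have "lookup (upd k j c') j = c'" by (simp add: lookup_upd)
      ultimately have "c' \<in> ?C" by (metis image_eqI)
      with Max_ge[OF fin(1)] that show False by (meson leD)
    qed
    then show "lookup (slice j c' f) k = lookup 0 k" by (simp add: lookup_slice in_keys_iff)
  qed
  with 1 show thesis by (rule that)
qed

section \<open>The commutant on highest weight vectors\<close>

lemma hw_vectors_homog0:
  assumes "i \<le> n" "f \<in> hw_vectors i" and S: "S \<in> commutant n i" "homog n 0 S" shows "S f \<in> hw_vectors i"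
proof -
  have f: "f \<in> polys n" using hw_vectors_polys[OF assms(2)] polys_mono[OF assms(1)] by blast
  have "T (S f) = 0" if T: "T \<in> commutant n i" "k < 0" "homog n k T" for T k
  proof -
    have "homog n (k + 0) (T \<circ> S)" by (rule homog_comp[OF commutant_linear[OF T(1)] T(3) S(2)])
    then have "homog n k (\<lambda>p. T (S p))" by (simp add: o_def)
    then show ?thesis
      using hw_vectors_negative[OF assms(2,1) commutant_compose[OF T(1) S(1)]] T(2) by blast
  qed
  then show ?thesis using hw_vectors_iff[OF assms(1)] commutant_polys[OF S(1) f] by blast
qed

lemma homog_deg_part0: "homog n 0 (deg_part n d)"
  by (auto simp: homog_def coeff_filter_mon lookup_mon split: if_splits)

lemma typed_deg:
  assumes "typed i t f" "f \<in> polys i" "i \<le> n" "m \<in> keys f" shows "deg n m = sum_mset t"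
  using assms deg_exp_type[of m i n] by (auto simp: typed_def polys_def)

text \<open>
  If \<open>T\<close> raises the degree, its generalised inverse lowers it and therefore kills the highest weight
  vector \<open>T f\<close>; but \<open>T\<close> factors through the generalised inverse.
\<close>

lemma hw_vectors_positive:
  assumes "i \<le> n" "f \<in> polys n" and T: "T \<in> commutant n i" "T f \<in> hw_vectors i"
    and d: "\<And>m. m \<in> keys f \<Longrightarrow> deg n m = d" "\<And>m. m \<in> keys (T f) \<Longrightarrow> deg n m = e" "d < e"
  shows "T f = 0"
proof -
  let ?T = "\<lambda>p. deg_part n e (T (deg_part n d p))"
  have T': "?T \<in> commutant n i" by (rule commutant_component[OF assms(1) T(1)])
  have rf: "deg_part n d f = f" by (rule coeff_filter_id) (simp add: d(1))
  have Tf: "?T f = T f" unfolding rf by (rule coeff_filter_id) (simp add: d(2))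
  obtain S where S: "S \<in> commutant n i" "\<And>p. p \<in> polys n \<Longrightarrow> ?T (S (?T p)) = ?T p"
    using commutant_regular[OF assms(1) T'] by blast
  let ?S = "\<lambda>p. deg_part n d (S (deg_part n e p))"
  have "?S (T f) = 0"
    by (rule hw_vectors_negative[OF T(2) assms(1) commutant_component[OF assms(1) S(1)]
          homog_deg_part[OF commutant_linear[OF S(1)]]]) (use d(3) in simp)
  moreover have "deg_part n e (T f) = T f" by (rule coeff_filter_id) (simp add: d(2))
  ultimately have "deg_part n d (S (T f)) = 0" by simp
  then have "?T (S (T f)) = 0"
    using pp.linear_0[OF commutant_linear[OF T(1)]] pp.linear_0[OF linear_coeff_filter] by metis
  then show ?thesis using S(2)[OF assms(2)] unfolding Tf by simp
qed

text \<open>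
  In the orbit of \<open>u\<close> only the component of degree 0 survives: negative ones vanish since \<open>u\<close> is a highest
  weight vector, positive ones since \<open>T u\<close> is one. This is the simplicity of the orbit as a module.
\<close>

lemma hw_vectors_orbit:
  assumes "i \<le> n" "u \<in> hw_vectors i" "typed i t u" and T: "T \<in> commutant n i" "T u \<in> hw_vectors i"
  shows "\<exists>c. T u = pscale c u"
proof -
  have up: "u \<in> polys n" using hw_vectors_polys[OF assms(2)] polys_mono[OF assms(1)] by blast
  define d where "d = sum_mset t"
  have du: "deg n m = d" if "m \<in> keys u" for m
    unfolding d_def by (rule typed_deg[OF assms(3) hw_vectors_polys[OF assms(2)] assms(1) that])
  have ru: "deg_part n d u = u" by (rule coeff_filter_id) (simp add: du)
  let ?C = "\<lambda>e p. deg_part n e (T (deg_part n d p))"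
  have C: "?C e \<in> commutant n i" "?C e u = deg_part n e (T u)" for e
    by (rule commutant_component[OF assms(1) T(1)]) (simp add: ru)
  have hC: "homog n (int e - int d) (?C e)" for e by (rule homog_deg_part[OF commutant_linear[OF T(1)]])
  have "deg_part n e (T u) = 0" if "e \<noteq> d" for e
  proof (cases "e < d")
    case True
    then have "?C e u = 0" using hw_vectors_negative[OF assms(2,1) C(1) hC] by simp
    then show ?thesis using C(2) by simp
  next
    case False
    with that have lt: "d < e" by simp
    have "?C e u \<in> hw_vectors i"
      unfolding C(2) by (rule hw_vectors_homog0[OF assms(1) T(2) commutant_deg_part[OF assms(1)] homog_deg_part0])
    then have "?C e u = 0"
      by (rule hw_vectors_positive[OF assms(1) up C(1) _ du _ lt]) (auto simp: keys_coeff_filter)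
    then show ?thesis using C(2) by simp
  qed
  then have "lookup (T u) m = 0" if "deg n m \<noteq> d" for m
    using that lookup_coeff_filter[of "\<lambda>k. deg n k = deg n m" "T u" m] by simp
  then have "deg_part n d (T u) = T u"
    by (intro coeff_filter_id) (auto simp: in_keys_iff)
  then have "?C d u = T u" using C(2) by simp
  moreover have "homog n 0 (?C d)" using hC[of d] by simp
  ultimately show ?thesis using hw_vectors_scalar[OF assms(2,1) C(1) _ assms(3)] by metis
qed

text \<open>
  Exchanging the exponent values \<open>a\<close> and \<open>b\<close> in all monomials of one type is an injective equivariant
  operator. It would lower the degree if there were more \<open>b\<close> than \<open>a\<close>, and so kill \<open>f\<close>.
\<close>

lemma hw_vectors_count_antimono:
  assumes f: "f \<in> hw_vectors i" "typed i t f" "f \<noteq> 0" and ab: "a < b"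
  shows "count t b \<le> count t a"
proof (rule ccontr)
  assume "\<not> ?thesis"
  then have lt: "count t a < count t b" by simp
  define r where "r m = override {1..i} (\<lambda>j. transpose a b (lookup m j)) m" for m
  let ?T = "lin_ext (\<lambda>m. if exp_type i m = t \<and> keys m \<subseteq> {1..i} then mon (r m) else 0)"
  have lr: "lookup (r m) j = (if j \<in> {1..i} then transpose a b (lookup m j) else lookup m j)" for m j
    unfolding r_def by (rule lookup_override) simp
  have rr: "r (r m) = m" for m
    by (rule poly_mapping_eqI) (simp add: lr)
  have "?T \<in> commutant i i"
  proof (rule commutantI)
    fix \<sigma> p assume \<sigma>: "\<sigma> permutes {1..i}"
    have b: "bij \<sigma>" "bij (inv \<sigma>)" using \<sigma> by (auto simp: permutes_bij bij_imp_bij_inv)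
    have \<sigma>': "inv \<sigma> permutes {1..i}" by (rule permutes_inv[OF \<sigma>])
    have e: "r (mperm (inv \<sigma>) m) = mperm (inv \<sigma>) (r m)" for m
      by (rule poly_mapping_eqI)
         (simp only: lr lookup_mperm[OF b(2)] permutes_in_image[OF \<sigma>'])
    have "(\<lambda>p. ?T (perm_act \<sigma> p)) = (\<lambda>p. perm_act \<sigma> (?T p))"
    proof (rule plinear_eqI)
      show "plinear (\<lambda>p. ?T (perm_act \<sigma> p))"
        by (rule plinear_compose[OF linear_lin_ext linear_perm_act[OF b(1)]])
      show "plinear (\<lambda>p. perm_act \<sigma> (?T p))"
        by (rule plinear_compose[OF linear_perm_act[OF b(1)] linear_lin_ext])
      show "?T (perm_act \<sigma> (mon m)) = perm_act \<sigma> (?T (mon m))" for m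
        by (simp only: perm_act_mon[OF b(1)] lin_ext_mon e exp_type_mperm[OF \<sigma>']
            keys_mperm_subset[OF \<sigma>' order_refl] if_distrib[of "perm_act \<sigma>"]
            pp.linear_0[OF linear_perm_act[OF b(1)]])
    qed
    then show "?T (perm_act \<sigma> p) = perm_act \<sigma> (?T p)" by (rule fun_cong)
  next
    fix p assume "p \<in> polys i"
    then show "?T p \<in> polys i"
    proof (rule linear_preserves_polysI[OF linear_lin_ext, rotated])
      fix m :: "nat \<Rightarrow>\<^sub>0 nat" assume m: "keys m \<subseteq> {1..i}"
      have "keys (r m) \<subseteq> {1..i}"
        using m unfolding in_keys_iff subset_iff lr by metis
      then show "?T (mon m) \<in> polys i"
        using pv.subspace_0[OF subspace_polys] by (simp only: lin_ext_mon mon_in_polys_iff split: if_split) simp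
    qed
  qed (rule linear_lin_ext)
  moreover
  (* Each entry a becomes b and vice versa; this is the resulting change of the degree. *)
  let ?k = "(int (count t a) - int (count t b)) * (int b - int a)"
  have "homog i ?k ?T"
    unfolding homog_def
  proof (intro allI impI)
    fix m m' assume "lookup (?T (mon m)) m' \<noteq> 0"
    then have m: "exp_type i m = t" "m' = r m" by (auto simp: lookup_mon split: if_splits)
    have "int (deg i m') - int (deg i m) = (\<Sum>j\<in>{1..i}. int (transpose a b (lookup m j)) - int (lookup m j))"
      unfolding m(2) deg_def lr by (simp add: sum_subtractf)
    also have "\<dots> = (\<Sum>j\<in>{1..i}. (if lookup m j = a then int b - int a else 0) +
        (if lookup m j = b then int a - int b else 0))"
      by (rule sum.cong) (use ab in \<open>auto simp: transpose_def\<close>)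
    also have "\<dots> = int (count t a) * (int b - int a) + int (count t b) * (int a - int b)"
      unfolding m(1)[symmetric] count_exp_type sum.distrib by (simp add: sum.inter_filter[symmetric])
    finally show "int (deg i m') = int (deg i m) + ?k" by (simp add: algebra_simps)
  qed
  moreover have "?k < 0" using lt ab by (simp add: mult_less_0_iff)
  ultimately have T0: "?T f = 0" by (rule hw_vectors_negative[OF f(1) order_refl])
  obtain m0 where m0: "m0 \<in> keys f" using f(3) by (metis keys_eq_empty ex_in_conv)
  have "lookup (?T f) (r m0) = (\<Sum>m\<in>keys f. if m = m0 then lookup f m else 0)"
    unfolding lookup_lin_ext
  proof (rule sum.cong[OF refl])
    fix m assume m: "m \<in> keys f"
    then have "exp_type i m = t" "keys m \<subseteq> {1..i}" using f(2) hw_vectors_polys[OF f(1)] by (auto simp: typed_def polys_def)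
    moreover have "r m0 = r m \<longleftrightarrow> m = m0" using rr by metis
    ultimately show "lookup f m * lookup (if exp_type i m = t \<and> keys m \<subseteq> {1..i} then mon (r m) else 0) (r m0) =
       (if m = m0 then lookup f m else 0)" by (simp only: simp_thms if_True lookup_mon) simp
  qed
  also have "\<dots> = lookup f m0" using m0 by simp
  finally show False using T0 m0 by (simp add: in_keys_iff)
qed

section \<open>Highest weight vectors generate all polynomials\<close>

lemma linear_maps_span:
  assumes "plinear T" "\<And>x. x \<in> S \<Longrightarrow> T x \<in> pspan S" "y \<in> pspan S" shows "T y \<in> pspan S"
proof -
  have "pspan S \<subseteq> {y. T y \<in> pspan S}"
  proof (rule pv.span_minimal)
    show "psubspace {y. T y \<in> pspan S}"
      by (rule pv.subspaceI)
         (simp_all add: pp.linear_0[OF assms(1)] pp.linear_add[OF assms(1)] pp.linear_scale[OF assms(1)]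
           pv.span_zero pv.span_add pv.span_scale)
  qed (use assms(2) in auto)
  with assms(3) show ?thesis by auto
qed

text \<open>
  A homogeneous \<open>f\<close> is reduced modulo the span \<open>B\<close> of the orbits to a vector \<open>Q f\<close> in an equivariant
  complement of \<open>B\<close>. A degree-lowering \<open>N\<close> maps \<open>Q f\<close> into \<open>B\<close> by induction on the degree; writing
  \<open>N \<circ> Q = N \<circ> Q \<circ> S \<circ> N \<circ> Q\<close> and using that \<open>Q\<close> kills \<open>B\<close> gives \<open>N (Q f) = 0\<close>. So \<open>Q f\<close> is a highest weight
  vector and lies in \<open>B\<close> itself.
\<close>

lemma hw_vectors_generates:
  assumes "i \<le> n" shows "polys n \<subseteq> pspan {T f | T f. T \<in> commutant n i \<and> f \<in> hw_vectors i}"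
proof -
  let ?S = "{T f | T f. T \<in> commutant n i \<and> f \<in> hw_vectors i}"
  let ?B = "pspan ?S"
  have HWn: "hw_vectors i \<subseteq> polys n" using hw_vectors_polys polys_mono[OF assms] by blast
  have EB: "T y \<in> ?B" if T: "T \<in> commutant n i" and y: "y \<in> ?B" for T y
  proof (rule linear_maps_span[OF commutant_linear[OF T] _ y])
    fix x assume "x \<in> ?S"
    then obtain T' f where x: "x = T' f" "T' \<in> commutant n i" "f \<in> hw_vectors i" by blast
    have "T x \<in> ?S"
      unfolding x(1) mem_Collect_eq
      by (rule exI[of _ "\<lambda>p. T (T' p)"], rule exI[of _ f]) (simp add: commutant_compose[OF T x(2)] x(3))
    then show "T x \<in> ?B" by (rule pv.span_base)
  qed
  have HB: "f \<in> ?B" if "f \<in> hw_vectors i" for f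
  proof (rule pv.span_base)
    show "f \<in> ?S"
      unfolding mem_Collect_eq
      by (rule exI[of _ "\<lambda>p. p"], rule exI[of _ f]) (simp add: commutant_id that)
  qed
  have Bn: "?B \<subseteq> polys n"
    by (rule pv.span_minimal[OF _ subspace_polys]) (use commutant_polys HWn in blast)
  have permB: "perm_act \<sigma> y \<in> ?B" if \<sigma>: "\<sigma> permutes {1..i}" and y: "y \<in> ?B" for \<sigma> y
  proof (rule linear_maps_span[OF linear_perm_act[OF permutes_bij[OF \<sigma>]] _ y])
    fix x assume "x \<in> ?S"
    then obtain T f where x: "x = T f" "T \<in> commutant n i" "f \<in> hw_vectors i" by blast
    then have "perm_act \<sigma> x = T (perm_act \<sigma> f)" by (simp add: commutant_perm[OF x(2) \<sigma>])
    moreover have "perm_act \<sigma> f \<in> hw_vectors i" by (rule hw_vectors_perm_act[OF \<sigma> x(3)])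
    ultimately have "perm_act \<sigma> x \<in> ?S" using x(2) by blast
    then show "perm_act \<sigma> x \<in> ?B" by (rule pv.span_base)
  qed
  obtain P where P: "equivariant i P" "\<And>p. P p \<in> ?B" "\<And>w. w \<in> ?B \<Longrightarrow> P w = w"
    using equivariant_projection[of ?B i, OF pv.subspace_span permB] by blast
  have PE: "P \<in> commutant n i" using P(1,2) Bn by (auto simp: commutant_def)
  have hom: "f \<in> ?B" if "f \<in> polys n" "\<And>m. m \<in> keys f \<Longrightarrow> deg n m = d" for f d
    using that
  proof (induction d arbitrary: f rule: less_induct)
    case (less d)
    (* Q is the projection in degree d along the span of the orbits. *)
    define Q where "Q = (\<lambda>p. deg_part n d ((\<lambda>p. p - P p) (deg_part n d p)))"
    have Q: "Q \<in> commutant n i"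
      unfolding Q_def by (rule commutant_component[OF assms commutant_diff[OF commutant_id PE]])
    have QB: "Q y = 0" if y: "y \<in> ?B" for y
    proof -
      have "deg_part n d y \<in> ?B" by (rule EB[OF commutant_deg_part[OF assms] y])
      then show ?thesis by (simp add: Q_def P(3) pp.linear_0[OF linear_coeff_filter])
    qed
    have rf: "deg_part n d f = f" by (rule coeff_filter_id) (simp add: less.prems(2))
    have Qf: "Q f = f - deg_part n d (P f)"
      by (simp add: Q_def rf pp.linear_diff[OF linear_coeff_filter])
    have B1: "deg_part n d (P f) \<in> ?B" by (rule EB[OF commutant_deg_part[OF assms] P(2)])
    have "Q (Q f) = Q f - Q (deg_part n d (P f))"
      unfolding Qf pp.linear_diff[OF commutant_linear[OF Q]] by (simp add: Qf)
    then have QQ: "Q (Q f) = Q f" using QB[OF B1] by simp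
    have xp: "Q f \<in> polys n" by (rule commutant_polys[OF Q less.prems(1)])
    have xd: "deg n m = d" if "m \<in> keys (Q f)" for m
      using that unfolding Q_def by (simp add: keys_coeff_filter)
    have "N (Q f) = 0" if N: "N \<in> commutant n i" "k < 0" "homog n k N" for N k
    proof -
      have Np: "N (Q f) \<in> polys n" by (rule commutant_polys[OF N(1) xp])
      have Nd: "int (deg n m) = int d + k" if "m \<in> keys (N (Q f))" for m
        by (rule homog_apply[OF N(3) commutant_linear[OF N(1)] xd that])
      have NB: "N (Q f) \<in> ?B"
      proof (cases "N (Q f) = 0")
        case True
        then show ?thesis using pv.span_zero by simp
      next
        case False
        then obtain m where "m \<in> keys (N (Q f))" by (metis keys_eq_empty ex_in_conv)
        then have "nat (int d + k) < d" using Nd[of m] N(2) by linarith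
        then show ?thesis
          by (rule less.IH[OF _ Np]) (use Nd in force)
      qed
      obtain S where S: "S \<in> commutant n i" "\<And>p. p \<in> polys n \<Longrightarrow> N (Q (S (N (Q p)))) = N (Q p)"
        using commutant_regular[OF assms commutant_compose[OF N(1) Q]] by blast
      have "Q (S (N (Q f))) = 0" by (rule QB[OF EB[OF S(1) NB]])
      then show ?thesis
        using S(2)[OF less.prems(1)] pp.linear_0[OF commutant_linear[OF N(1)]] by simp
    qed
    then have "Q f \<in> hw_vectors i" using hw_vectors_iff[OF assms] xp by blast
    then have "Q f + deg_part n d (P f) \<in> ?B" using HB B1 pv.span_add by blast
    then show ?case by (simp add: Qf)
  qed
  show ?thesis
  proof
    fix f assume f: "f \<in> polys n"
    have "f = (\<Sum>m\<in>keys f. pscale (lookup f m) (mon m))" by (rule poly_expand[OF finite_keys order_refl])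
    also have "\<dots> \<in> ?B"
    proof (intro pv.span_sum pv.span_scale)
      fix m assume "m \<in> keys f"
      then have "keys m \<subseteq> {1..n}" using f by (auto simp: polys_def)
      then show "mon m \<in> ?B" by (intro hom[where d = "deg n m"]) auto
    qed
    finally show "f \<in> ?B" .
  qed
qed

section \<open>Symmetric polynomials in the Euler operators\<close>

lemma linear_nabla: "plinear (nabla j)"
  unfolding nabla_def o_def by (rule plinear_compose[OF linear_mulx linear_pdiff])

lemma nabla_mon: "nabla j (mon m) = pscale (of_nat (lookup m j)) (mon m)"
proof (cases "lookup m j = 0")
  case True
  then show ?thesis by (simp add: nabla_def pdiff_mon pp.linear_0[OF linear_mulx])
next
  case False
  then show ?thesis
    by (simp add: nabla_def pdiff_mon pp.linear_scale[OF linear_mulx] mulx_mon exponent_remove)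
qed

definition diagonal :: "((nat \<Rightarrow>\<^sub>0 nat) \<Rightarrow> complex) \<Rightarrow> mop \<Rightarrow> bool" where
  "diagonal \<chi> T \<longleftrightarrow> (\<forall>p m. lookup (T p) m = \<chi> m * lookup p m)"

lemma diagonal_comp: "diagonal \<chi> S \<Longrightarrow> diagonal \<psi> T \<Longrightarrow> diagonal (\<lambda>m. \<chi> m * \<psi> m) (S \<circ> T)"
  by (simp add: diagonal_def)

lemma diagonalI:
  assumes T: "plinear T" "\<And>m. T (mon m) = pscale (\<chi> m) (mon m)" shows "diagonal \<chi> T"
  unfolding diagonal_def
proof (intro allI)
  fix p m
  have "lookup (T p) m = (\<Sum>k\<in>keys p. if m = k then \<chi> m * lookup p m else 0)"
    unfolding plinear_expand[OF T(1) finite_keys order_refl, of p] lookup_sum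
    by (rule sum.cong) (auto simp: T(2) lookup_mon)
  then show "lookup (T p) m = \<chi> m * lookup p m" by (simp add: in_keys_iff)
qed

lemma diagonal_nabla: "diagonal (\<lambda>m. of_nat (lookup m j)) (nabla j)"
  by (rule diagonalI[OF linear_nabla nabla_mon])

lemma diagonal_op_algebra:
  assumes "a \<in> op_algebra (nabla ` J)" shows "\<exists>\<chi>. diagonal \<chi> a"
proof -
  have sub: "ov.subspace {a. \<exists>\<chi>. diagonal \<chi> a}"
  proof (rule ov.subspaceI)
    have "diagonal (\<lambda>_. 0) 0" by (simp add: diagonal_def)
    then show "0 \<in> {a. \<exists>\<chi>. diagonal \<chi> a}" by blast
    show "x + y \<in> {a. \<exists>\<chi>. diagonal \<chi> a}"
      if x: "x \<in> {a. \<exists>\<chi>. diagonal \<chi> a}" and y: "y \<in> {a. \<exists>\<chi>. diagonal \<chi> a}" for x y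
    proof -
      from x y obtain \<chi> \<psi> where "diagonal \<chi> x" "diagonal \<psi> y" by blast
      then have "diagonal (\<lambda>m. \<chi> m + \<psi> m) (x + y)"
        by (simp add: diagonal_def lookup_add distrib_right)
      then show ?thesis by blast
    qed
    show "oscale c x \<in> {a. \<exists>\<chi>. diagonal \<chi> a}" if x: "x \<in> {a. \<exists>\<chi>. diagonal \<chi> a}" for c x
    proof -
      from x obtain \<chi> where "diagonal \<chi> x" by blast
      then have "diagonal (\<lambda>m. c * \<chi> m) (oscale c x)" by (simp add: diagonal_def oscale_def)
      then show ?thesis by blast
    qed
  qed
  have words: "\<exists>\<chi>. diagonal \<chi> (foldr (\<circ>) ws id)" if "ws \<in> lists (nabla ` J)" for ws
    using that
  proof (induction ws rule: lists.induct)
    case Nil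
    have "diagonal (\<lambda>_. 1) (foldr (\<circ>) [] id)" by (simp add: diagonal_def)
    then show ?case by blast
  next
    case (Cons g ws)
    from Cons.hyps(1) obtain j where g: "g = nabla j" by blast
    from Cons.IH obtain \<chi> where "diagonal \<chi> (foldr (\<circ>) ws id)" by blast
    from diagonal_comp[OF diagonal_nabla this, of j]
    have "diagonal (\<lambda>m. of_nat (lookup m j) * \<chi> m) (foldr (\<circ>) (g # ws) id)" by (simp add: g)
    then show ?case by blast
  qed
  have "op_algebra (nabla ` J) \<subseteq> {a. \<exists>\<chi>. diagonal \<chi> a}"
    unfolding op_algebra_def by (rule ov.span_minimal[OF _ sub]) (use words in blast)
  with assms show ?thesis by blast
qed

lemma R_alg_same_scalar:
  assumes a: "a \<in> R_alg i" and v: "v \<in> polys i" "typed i t v" and w: "w \<in> polys i" "typed i t w"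
  shows "\<exists>c. a v = pscale c v \<and> a w = pscale c w"
proof -
  from a have a': "a \<in> op_algebra (nabla ` {1..i})"
    "\<And>\<sigma>. \<sigma> permutes {1..i} \<Longrightarrow> perm_act \<sigma> \<circ> a \<circ> perm_act (inv \<sigma>) = a"
    by (auto simp: R_alg_def sym_invariants_def)
  obtain \<chi> where \<chi>: "diagonal \<chi> a" using diagonal_op_algebra[OF a'(1)] by blast
  have inv: "\<chi> (mperm \<sigma> m) = \<chi> m" if \<sigma>: "\<sigma> permutes {1..i}" for \<sigma> m
  proof -
    have b: "bij \<sigma>" "bij (inv \<sigma>)" using \<sigma> by (auto simp: permutes_bij bij_imp_bij_inv)
    have "lookup (perm_act \<sigma> (a (perm_act (inv \<sigma>) (mon m)))) m = lookup (a (mon m)) m"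
      using fun_cong[OF a'(2)[OF \<sigma>], of "mon m"] by simp
    then show ?thesis
      using \<chi> by (simp add: diagonal_def lookup_perm_act b mperm_inv lookup_mon)
  qed
  have const: "\<chi> m = \<chi> m'" if "m \<in> keys v \<union> keys w" "m' \<in> keys v \<union> keys w" for m m'
  proof -
    have "exp_type i m = exp_type i m'" "keys m \<subseteq> {1..i}" "keys m' \<subseteq> {1..i}"
      using that v w by (auto simp: typed_def polys_def)
    then obtain \<tau> where "\<tau> permutes {1..i}" "mperm \<tau> m = m'" by (rule same_exp_type_perm)
    then show ?thesis using inv by metis
  qed
  define c where "c = \<chi> (SOME m. m \<in> keys v \<union> keys w)"
  have c: "\<chi> m = c" if "m \<in> keys v \<union> keys w" for m
    unfolding c_def by (rule const[OF that someI[of "\<lambda>m. m \<in> keys v \<union> keys w", OF that]])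
  have "a x = pscale c x" if "x = v \<or> x = w" for x
  proof (rule poly_mapping_eqI)
    fix m
    show "lookup (a x) m = lookup (pscale c x) m"
      using \<chi> c[of m] that by (cases "m \<in> keys x") (auto simp: diagonal_def in_keys_iff)
  qed
  then show ?thesis by blast
qed

lemma powsum_in_R_alg: "(\<lambda>p. \<Sum>j\<in>{1..i}. (nabla j ^^ k) p) \<in> R_alg i"
  (is "?R \<in> _") and diagonal_powsum:
  "diagonal (\<lambda>m. \<Sum>j\<in>{1..i}. of_nat (lookup m j) ^ k) (\<lambda>p. \<Sum>j\<in>{1..i}. (nabla j ^^ k) p)"
  (is "diagonal ?\<chi> _")
proof -
  have dk: "diagonal (\<lambda>m. of_nat (lookup m j) ^ k) (nabla j ^^ k)" for j
  proof (induction k)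
    case 0
    show ?case by (simp add: diagonal_def)
  next
    case (Suc k)
    show ?case using diagonal_comp[OF diagonal_nabla Suc.IH, of j] by (simp only: power_Suc funpow.simps)
  qed
  show D: "diagonal ?\<chi> ?R"
    using dk by (simp add: diagonal_def lookup_sum sum_distrib_right)
  have "nabla j ^^ k = foldr (\<circ>) (replicate k (nabla j)) id" for j
    by (induction k) simp_all
  then have "nabla j ^^ k \<in> op_algebra (nabla ` {1..i})" if "j \<in> {1..i}" for j
    unfolding op_algebra_def using that
    by (intro ov.span_base) (auto intro!: exI[of _ "replicate k (nabla j)"])
  then have "(\<Sum>j\<in>{1..i}. nabla j ^^ k) \<in> op_algebra (nabla ` {1..i})"
    unfolding op_algebra_def by (intro ov.span_sum)
  moreover have "(\<Sum>j\<in>{1..i}. nabla j ^^ k) = ?R"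
  proof
    fix p
    show "(\<Sum>j\<in>A. nabla j ^^ k) p = (\<Sum>j\<in>A. (nabla j ^^ k) p)" for A
      by (induction A rule: infinite_finite_induct) auto
  qed
  ultimately have "?R \<in> op_algebra (nabla ` {1..i})" by simp
  moreover have "perm_act \<sigma> \<circ> ?R \<circ> perm_act (inv \<sigma>) = ?R" if \<sigma>: "\<sigma> permutes {1..i}" for \<sigma>
  proof (rule ext, rule poly_mapping_eqI)
    fix p m
    have b: "bij \<sigma>" "bij (inv \<sigma>)" using \<sigma> by (auto simp: permutes_bij bij_imp_bij_inv)
    have "?\<chi> (mperm \<sigma> m) = ?\<chi> m"
      using sum.permute[OF \<sigma>, of "\<lambda>j. of_nat (lookup m j) ^ k :: complex"]
      by (simp add: lookup_mperm b o_def)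
    then show "lookup ((perm_act \<sigma> \<circ> ?R \<circ> perm_act (inv \<sigma>)) p) m = lookup (?R p) m"
      using D unfolding diagonal_def comp_apply by (simp only: lookup_perm_act b mperm_inv)
  qed
  ultimately show "?R \<in> R_alg i"
    by (simp add: R_alg_def sym_invariants_def)
qed

text \<open>
  The multiplicity of \<open>a\<close> is read off from the sum of the values of a polynomial that vanishes at all other
  exponents that occur.
\<close>

lemma exp_type_eqI_powsum:
  assumes "\<And>k. (\<Sum>j\<in>{1..i}. of_nat (lookup m j) ^ k :: complex) = (\<Sum>j\<in>{1..i}. of_nat (lookup m' j) ^ k)"
  shows "exp_type i m = exp_type i m'"
proof (rule multiset_eqI)
  fix a
  (* q vanishes at all entries of m and m' other than a. *)
  define S where "S = (lookup m ` {1..i} \<union> lookup m' ` {1..i}) - {a}"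
  define q where "q = (\<Prod>c\<in>S. [:- of_nat c, 1 :: complex:])"
  have S: "finite S" by (simp add: S_def)
  have pq: "poly q x = (\<Prod>c\<in>S. x - of_nat c)" for x
    by (simp add: q_def poly_prod)
  have "(\<Sum>j\<in>{1..i}. poly q (of_nat (lookup k j))) = of_nat (count (exp_type i k) a) * poly q (of_nat a)"
    if k: "lookup k ` {1..i} \<subseteq> insert a S" for k
  proof -
    have "(\<Sum>j\<in>{1..i}. poly q (of_nat (lookup k j))) = (\<Sum>j\<in>{1..i}. if lookup k j = a then poly q (of_nat a) else 0)"
    proof (rule sum.cong[OF refl])
      fix j assume "j \<in> {1..i}"
      then have "lookup k j = a \<or> lookup k j \<in> S" using k by blast
      then show "poly q (of_nat (lookup k j)) = (if lookup k j = a then poly q (of_nat a) else 0)"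
        unfolding pq using S by (auto intro!: prod_zero)
    qed
    also have "\<dots> = (\<Sum>j\<in>{j\<in>{1..i}. lookup k j = a}. poly q (of_nat a))"
      by (rule sum.inter_filter[symmetric]) simp
    finally show ?thesis by (simp add: count_exp_type)
  qed
  moreover have "(\<Sum>j\<in>{1..i}. poly q (of_nat (lookup m j))) = (\<Sum>j\<in>{1..i}. poly q (of_nat (lookup m' j)))"
  proof -
    have "(\<Sum>j\<in>{1..i}. poly q (of_nat (lookup k j))) =
        (\<Sum>e\<le>degree q. coeff q e * (\<Sum>j\<in>{1..i}. of_nat (lookup k j) ^ e))" for k
      unfolding poly_altdef sum_distrib_left by (rule sum.swap)
    then show ?thesis using assms by simp
  qed
  moreover have "lookup m ` {1..i} \<subseteq> insert a S" "lookup m' ` {1..i} \<subseteq> insert a S"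
    by (auto simp: S_def)
  ultimately have "of_nat (count (exp_type i m) a) * poly q (of_nat a) = of_nat (count (exp_type i m') a) * poly q (of_nat a)"
    by metis
  moreover have "poly q (of_nat a) \<noteq> 0"
    unfolding pq using S by (auto simp: S_def)
  ultimately show "count (exp_type i m) a = count (exp_type i m') a" by simp
qed

lemma R_line_typed:
  assumes "submod (R_alg i) (pspan {v})" shows "\<exists>t. typed i t v"
proof -
  have "exp_type i m = exp_type i m'" if "m \<in> keys v" "m' \<in> keys v" for m m'
  proof (rule exp_type_eqI_powsum)
    fix k
    let ?R = "\<lambda>p. \<Sum>j\<in>{1..i}. (nabla j ^^ k) p"
    have "\<forall>a\<in>R_alg i. \<forall>x\<in>pspan {v}. a x \<in> pspan {v}"
      using assms unfolding submod_def by (rule conjunct2)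
    then have "?R v \<in> pspan {v}"
      by (rule bspec[OF bspec[OF _ powsum_in_R_alg]]) (simp add: pv.span_base)
    then obtain c where "?R v = pscale c v" by (auto simp: pv.span_singleton)
    then have "(\<Sum>j\<in>{1..i}. of_nat (lookup x j) ^ k) * lookup v x = c * lookup v x" for x
      using diagonal_powsum[where i = i and k = k] lookup_pscale[of c v x] unfolding diagonal_def by metis
    then have "(\<Sum>j\<in>{1..i}. of_nat (lookup x j) ^ k) = c" if "x \<in> keys v" for x
      using that by (metis in_keys_iff mult_right_cancel)
    then show "(\<Sum>j\<in>{1..i}. of_nat (lookup m j) ^ k :: complex) = (\<Sum>j\<in>{1..i}. of_nat (lookup m' j) ^ k)"
      using that by metis
  qed
  then show ?thesis unfolding typed_def by blast
qed

lemma mod_iso_lines: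
  assumes "v \<noteq> 0" "w \<noteq> 0"
    and A: "\<And>a. a \<in> A \<Longrightarrow> \<exists>c. a v = pscale c v \<and> a w = pscale c w"
    and lin: "\<And>a e x. a \<in> A \<Longrightarrow> a (pscale e x) = pscale e (a x)"
  shows "mod_iso A (pspan {v}) (pspan {w})"
proof -
  define \<phi> where "\<phi> x = pscale (THE c. x = pscale c v) w" for x
  have \<phi>: "\<phi> (pscale c v) = pscale c w" for c
    unfolding \<phi>_def using assms(1) by (simp add: pv.scale_cancel_right)
  have "bij_betw \<phi> (pspan {v}) (pspan {w})"
    by (rule bij_betwI')
       (use assms(1,2) in \<open>auto simp: pv.span_singleton \<phi> pv.scale_cancel_right\<close>)
  moreover have "\<phi> (x + y) = \<phi> x + \<phi> y" if "x \<in> pspan {v}" "y \<in> pspan {v}" for x y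
    using that by (auto simp: pv.span_singleton \<phi> pv.scale_left_distrib[symmetric])
  moreover have "\<phi> (pscale c x) = pscale c (\<phi> x)" if "x \<in> pspan {v}" for c x
    using that by (auto simp: pv.span_singleton \<phi> simp del: pv.scale_scale) (simp add: \<phi>)
  moreover have "\<phi> (a x) = a (\<phi> x)" if a: "a \<in> A" and x: "x \<in> pspan {v}" for a x
  proof -
    from x obtain e where e: "x = pscale e v" by (auto simp: pv.span_singleton)
    obtain c where c: "a v = pscale c v" "a w = pscale c w" using A[OF a] by blast
    show ?thesis by (simp add: e \<phi> lin[OF a] c)
  qed
  ultimately show ?thesis unfolding mod_iso_def by blast
qed

lemma mod_iso_typed:
  assumes "v \<noteq> 0" "w \<noteq> 0" "v \<in> polys i" "typed i t v" "w \<in> polys i" "typed i t w"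
  shows "mod_iso (R_alg i) (pspan {v}) (pspan {w})"
proof (rule mod_iso_lines[OF assms(1,2) R_alg_same_scalar[OF _ assms(3-6)]])
  fix a e x assume "a \<in> R_alg i"
  then obtain \<chi> where "diagonal \<chi> a"
    using diagonal_op_algebra unfolding R_alg_def sym_invariants_def by blast
  then show "a (pscale e x) = pscale e (a x)"
    by (intro poly_mapping_eqI) (simp add: diagonal_def)
qed

section \<open>Jucys-Murphy elements\<close>

lemma transpose_permutes: "j \<in> {1..k-1} \<Longrightarrow> k \<le> i \<Longrightarrow> transpose j k permutes {1..i::nat}"
  by (rule permutes_swap_id) auto

lemma linear_jm: "plinear (jucys_murphy k)"
  unfolding jucys_murphy_def by (rule pp.linear_compose_sum) (simp add: linear_perm_act)

lemma jm_commutant: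
  assumes "T \<in> commutant n i" "k \<le> i" shows "jucys_murphy k (T p) = T (jucys_murphy k p)"
  unfolding jucys_murphy_def pp.linear_sum[OF commutant_linear[OF assms(1)]]
  by (rule sum.cong[OF refl]) (rule commutant_perm[OF assms(1) transpose_permutes[OF _ assms(2)], symmetric])

lemma jm_hw_vectors: "k \<le> i \<Longrightarrow> f \<in> hw_vectors i \<Longrightarrow> jucys_murphy k f \<in> hw_vectors i"
  unfolding jucys_murphy_def
  by (intro pv.subspace_sum[OF subspace_hw_vectors] hw_vectors_perm_act transpose_permutes)

lemma transp_sum_Suc: "transp_sum (Suc i) p = transp_sum i p + jucys_murphy (Suc i) p"
  by (simp add: transp_sum_def add.commute)

lemma transp_sum_commutant: "T \<in> commutant n i \<Longrightarrow> transp_sum i (T p) = T (transp_sum i p)"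
  unfolding transp_sum_def by (simp add: pp.linear_sum[OF commutant_linear] jm_commutant)

text \<open>
  The number of equal pairs is determined by the multiplicities: summing the multiplicity of the exponent
  over all positions counts each such pair twice and each position once.
\<close>

lemma content_sum_exp_type:
  assumes "exp_type i m = exp_type i m'" shows "content_sum i m = content_sum i m'"
proof -
  have *: "sum_mset (image_mset (count (exp_type i k)) (exp_type i k)) =
      2 * (\<Sum>x\<in>{1..i}. card {j\<in>{1..x-1}. lookup k j = lookup k x}) + i" for k
  proof -
    let ?A = "\<Sum>x\<in>{1..i}. card {j\<in>{1..x-1}. lookup k j = lookup k x}"
    let ?B = "\<Sum>x\<in>{1..i}. card {j\<in>{x+1..i}. lookup k j = lookup k x}"
    have "?A = card (SIGMA x:{1..i}. {j\<in>{1..x-1}. lookup k j = lookup k x})"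
      by (rule card_SigmaI[symmetric]) auto
    also have "\<dots> = card (SIGMA x:{1..i}. {j\<in>{x+1..i}. lookup k j = lookup k x})"
      by (rule bij_betw_same_card[of prod.swap], rule bij_betwI[where g = prod.swap]) auto
    also have "\<dots> = ?B"
      by (rule card_SigmaI) auto
    finally have AB: "?A = ?B" .
    have "sum_mset (image_mset (count (exp_type i k)) (exp_type i k)) = (\<Sum>x\<in>{1..i}. count (exp_type i k) (lookup k x))"
      by (subst (2) exp_type_def) (simp add: sum_unfold_sum_mset image_mset.compositionality o_def)
    also have "\<dots> = (\<Sum>x\<in>{1..i}. card {j\<in>{1..x-1}. lookup k j = lookup k x} +
        card {j\<in>{x+1..i}. lookup k j = lookup k x} + 1)"
    proof (rule sum.cong[OF refl])
      fix x assume x: "x \<in> {1..i}"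
      let ?L = "{j\<in>{1..x-1}. lookup k j = lookup k x}" and ?G = "{j\<in>{x+1..i}. lookup k j = lookup k x}"
      have fin: "finite ?L" "finite ?G" by simp_all
      have d: "x \<notin> ?L \<union> ?G" "?L \<inter> ?G = {}" using x by auto
      have "card (insert x (?L \<union> ?G)) = Suc (card ?L + card ?G)"
        by (simp only: card_insert_disjoint[OF finite_UnI[OF fin] d(1)] card_Un_disjoint[OF fin d(2)])
      moreover have "{j\<in>{1..i}. lookup k j = lookup k x} = insert x (?L \<union> ?G)" using x by auto
      ultimately show "count (exp_type i k) (lookup k x) = card ?L + card ?G + 1" by (simp add: count_exp_type)
    qed
    also have "\<dots> = ?A + ?B + i" by (simp add: sum.distrib)
    finally show ?thesis using AB by simp
  qed
  have "(\<Sum>x\<in>{1..i}. lookup k x) = sum_mset (exp_type i k)" for k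
    by (simp add: exp_type_def sum_unfold_sum_mset)
  moreover have "(\<Sum>x\<in>{1..i}. card {j\<in>{1..x-1}. lookup m j = lookup m x}) =
      (\<Sum>x\<in>{1..i}. card {j\<in>{1..x-1}. lookup m' j = lookup m' x})"
    using *[of m] *[of m'] assms by simp
  ultimately show ?thesis unfolding content_sum_def using assms by simp
qed

lemma transp_sum_typed:
  assumes "f \<in> hw_vectors i" "typed i t f" "m \<in> keys f" shows "transp_sum i f = pscale (content_sum i m) f"
proof (rule poly_mapping_eqI)
  fix k
  show "lookup (transp_sum i f) k = lookup (pscale (content_sum i m) f) k"
  proof (cases "k \<in> keys f")
    case True
    then have "content_sum i k = content_sum i m" using assms(2,3) by (intro content_sum_exp_type) (auto simp: typed_def)
    then show ?thesis by (simp add: transp_sum_hw_vectors[OF assms(1)])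
  qed (simp add: transp_sum_hw_vectors[OF assms(1)] in_keys_iff)
qed

section \<open>Bases of joint eigenvectors\<close>

text \<open>
  Applying \<open>L k\<close> minus the eigenvalue of one summand removes this summand and rescales the others; for a
  suitable \<open>k\<close> a given other summand survives.
\<close>

lemma joint_eigen_components:
  fixes y :: "'a \<Rightarrow> mpoly" and \<chi> :: "'k \<Rightarrow> 'a \<Rightarrow> complex"
  assumes X: "psubspace X" "\<And>k x. k \<in> K \<Longrightarrow> x \<in> X \<Longrightarrow> L k x \<in> X"
    and L: "\<And>k. k \<in> K \<Longrightarrow> plinear (L k)"
    and "finite C" and "\<And>u k. u \<in> C \<Longrightarrow> k \<in> K \<Longrightarrow> L k (y u) = pscale (\<chi> k u) (y u)"
    and "\<And>u u'. u \<in> C \<Longrightarrow> u' \<in> C \<Longrightarrow> u \<noteq> u' \<Longrightarrow> \<exists>k\<in>K. \<chi> k u \<noteq> \<chi> k u'"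
    and "(\<Sum>u\<in>C. y u) \<in> X" and "u \<in> C"
  shows "y u \<in> X"
  using assms(4-)
proof (induction C arbitrary: y u rule: finite_induct)
  case (insert a C)
  have C: "y w \<in> X" if w: "w \<in> C" for w
  proof -
    have "w \<noteq> a" using w insert.hyps by auto
    then obtain k where k: "k \<in> K" "\<chi> k w \<noteq> \<chi> k a"
      using insert.prems(2)[of w a] w by auto
    (* L k minus the eigenvalue of the summand at a. *)
    let ?y = "\<lambda>u. pscale (\<chi> k u - \<chi> k a) (y u)"
    let ?S = "\<Sum>u\<in>insert a C. y u"
    have "L k ?S - pscale (\<chi> k a) ?S = (\<Sum>u\<in>insert a C. ?y u)"
      unfolding pp.linear_sum[OF L[OF k(1)]] pv.scale_sum_right sum_subtractf[symmetric]
      by (rule sum.cong[OF refl]) (simp add: insert.prems(1) k(1) pv.scale_left_diff_distrib)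
    also have "\<dots> = (\<Sum>u\<in>C. ?y u)" using insert.hyps by simp
    finally have "(\<Sum>u\<in>C. ?y u) \<in> X"
      using pv.subspace_diff[OF X(1) X(2)[OF k(1) insert.prems(3)] pv.subspace_scale[OF X(1) insert.prems(3)]]
      by metis
    then have "?y w \<in> X"
      by (intro insert.IH[of ?y w])
         (use insert.prems w in \<open>auto simp: pp.linear_scale[OF L] mult.commute\<close>)
    then have "pscale (inverse (\<chi> k w - \<chi> k a)) (?y w) \<in> X" by (rule pv.subspace_scale[OF X(1)])
    then show ?thesis using k(2) by simp
  qed
  have "(\<Sum>u\<in>C. y u) \<in> X" by (rule pv.subspace_sum[OF X(1)]) (rule C)
  then have "(\<Sum>u\<in>insert a C. y u) - (\<Sum>u\<in>C. y u) \<in> X"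
    by (rule pv.subspace_diff[OF X(1) insert.prems(3)])
  then have "y a \<in> X" using insert.hyps by simp
  with C insert.prems(4) show ?case by auto
qed simp

definition jm_value :: "nat \<Rightarrow> mpoly \<Rightarrow> complex" where
  "jm_value k v = (THE c. jucys_murphy k v = pscale c v)"

lemma jm_valueI: "v \<noteq> 0 \<Longrightarrow> jucys_murphy k v = pscale c v \<Longrightarrow> jm_value k v = c"
  unfolding jm_value_def by (rule the_equality) (auto simp: pv.scale_cancel_right)

text \<open>
  The property of a canonical basis that is carried through its construction. Distinctness of the joint
  eigenvalues is required over the whole set, not only within one irreducible constituent.
\<close>

definition jm_basis :: "nat \<Rightarrow> mpoly set \<Rightarrow> bool" where
  "jm_basis i C \<longleftrightarrow> finite C \<and> pspan C = hw_vectors i \<and>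
     (\<forall>v\<in>C. v \<noteq> 0 \<and> (\<exists>t. typed i t v) \<and> (\<forall>k\<in>{2..i}. jucys_murphy k v = pscale (jm_value k v) v)) \<and>
     (\<forall>v\<in>C. \<forall>w\<in>C. v \<noteq> w \<longrightarrow> (\<exists>k\<in>{2..i}. jm_value k v \<noteq> jm_value k w))"

lemma jm_basisD:
  assumes "jm_basis i C"
  shows "finite C" "pspan C = hw_vectors i" "v \<in> C \<Longrightarrow> v \<noteq> 0" "v \<in> C \<Longrightarrow> v \<in> hw_vectors i" "v \<in> C \<Longrightarrow> \<exists>t. typed i t v"
    "v \<in> C \<Longrightarrow> k \<in> {2..i} \<Longrightarrow> jucys_murphy k v = pscale (jm_value k v) v"
    "v \<in> C \<Longrightarrow> w \<in> C \<Longrightarrow> v \<noteq> w \<Longrightarrow> \<exists>k\<in>{2..i}. jm_value k v \<noteq> jm_value k w"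
  using assms pv.span_base[of v C] unfolding jm_basis_def by blast+

lemma jm_basis_1: "jm_basis 1 {1}"
proof -
  (* With one variable, the shifts to exponent 0 leave only the constants. *)
  have one: "(1::mpoly) = mon 0" by (simp add: mon_def)
  have "mon 0 \<in> hw_vectors 1"
    unfolding hw_vectors_def mem_Collect_eq
  proof (intro conjI allI impI)
    fix a b :: nat assume "a < b"
    then have "upd m l b \<noteq> 0" for m l by (metis lookup_upd lookup_zero not_less_zero)
    then show "shift_op 1 a b (mon 0) = 0"
      by (intro poly_mapping_eqI) (simp add: lookup_shift_op lookup_mon cong: if_cong)
  qed simp
  moreover have "f \<in> pspan {mon 0}" if f: "f \<in> hw_vectors 1" for f
  proof -
    have "m = 0" if m: "m \<in> keys f" for m
    proof (rule ccontr)
      assume m0: "m \<noteq> 0"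
      have km: "keys m \<subseteq> {1..1}" using hw_vectors_polys[OF f] m unfolding polys_def by blast
      obtain j where "j \<in> {1..1::nat}" "lookup m j \<noteq> 0" by (rule deg_pos[OF km m0])
      then have b: "0 < lookup m 1" by simp
      have "upd (upd m 1 0) 1 (lookup m 1) = m" by (rule poly_mapping_eqI) (simp add: lookup_upd)
      then have "lookup (shift_op 1 0 (lookup m 1) f) (upd m 1 0) = lookup f m"
        by (simp add: lookup_shift_op lookup_upd)
      then show False using hw_vectors_shift_op[OF f b] m by (simp add: in_keys_iff)
    qed
    then have "f = pscale (lookup f 0) (mon 0)"
      by (intro poly_mapping_eqI) (auto simp: lookup_mon in_keys_iff)
    then show ?thesis by (metis pv.span_base pv.span_scale singletonI)
  qed
  ultimately have "pspan {mon 0} = hw_vectors 1"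
    using pv.span_minimal[OF _ subspace_hw_vectors, of "{mon 0}" 1] by auto
  then show ?thesis
    unfolding jm_basis_def one by (auto simp: typed_def mon_def)
qed

section \<open>The step of the canonical construction\<close>

lemma commutant_combination:
  assumes "S \<in> commutant n i" "T \<in> commutant n i" shows "(\<lambda>p. pscale c (S p) + pscale d (T p)) \<in> commutant n i"
proof (rule commutantI)
  note S = commutant_linear[OF assms(1)] and T = commutant_linear[OF assms(2)]
  show "plinear (\<lambda>p. pscale c (S p) + pscale d (T p))"
    by (intro pp.linear_compose_add pp.linear_compose_scale_right S T)
  show "pscale c (S p) + pscale d (T p) \<in> polys n" if "p \<in> polys n" for p
    by (intro pv.subspace_add[OF subspace_polys] pv.subspace_scale[OF subspace_polys]
        commutant_polys[OF assms(1)] commutant_polys[OF assms(2)] that)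
  show "pscale c (S (perm_act \<sigma> p)) + pscale d (T (perm_act \<sigma> p)) =
      perm_act \<sigma> (pscale c (S p) + pscale d (T p))" if "\<sigma> permutes {1..i}" for \<sigma> p
  proof -
    note l = linear_perm_act[OF permutes_bij[OF that]]
    show ?thesis
      by (simp only: commutant_perm[OF assms(1) that] commutant_perm[OF assms(2) that]
          pp.linear_add[OF l] pp.linear_scale[OF l])
  qed
qed

lemma polys_sum_orbits:
  assumes "i \<le> n" "finite C" "pspan C = hw_vectors i" "f \<in> polys n"
  shows "\<exists>T. (\<forall>u. T u \<in> commutant n i) \<and> f = (\<Sum>u\<in>C. T u u)"
proof -
  let ?S = "{f. \<exists>T. (\<forall>u. T u \<in> commutant n i) \<and> f = (\<Sum>u\<in>C. T u u)}"
  have comb: "pscale c x + pscale d y \<in> ?S" if xy: "x \<in> ?S" "y \<in> ?S" for c d x y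
  proof -
    obtain S where S: "\<forall>u. S u \<in> commutant n i" "x = (\<Sum>u\<in>C. S u u)" using xy(1) by blast
    obtain T where T: "\<forall>u. T u \<in> commutant n i" "y = (\<Sum>u\<in>C. T u u)" using xy(2) by blast
    have "pscale c x + pscale d y = (\<Sum>u\<in>C. (\<lambda>p. pscale c (S u p) + pscale d (T u p)) u)"
      unfolding S(2) T(2) by (simp add: sum.distrib pv.scale_sum_right)
    moreover have "\<forall>u. (\<lambda>p. pscale c (S u p) + pscale d (T u p)) \<in> commutant n i"
      using commutant_combination S(1) T(1) by blast
    ultimately show ?thesis unfolding mem_Collect_eq by (intro exI conjI)
  qed
  have zero: "(\<lambda>p. 0) \<in> commutant n i" using commutant_diff[OF commutant_id commutant_id] by simp
  have 0: "0 \<in> ?S"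
    unfolding mem_Collect_eq by (rule exI[of _ "\<lambda>u p. 0"]) (simp add: zero)
  have sub: "psubspace ?S"
  proof (rule pv.subspaceI[OF 0])
    show "x + y \<in> ?S" if "x \<in> ?S" "y \<in> ?S" for x y
      using comb[OF that, of 1 1] by (simp only: pv.scale_one)
    show "pscale c x \<in> ?S" if "x \<in> ?S" for c x
      using comb[OF that 0, of c 0] by (simp only: pv.scale_zero_left add_0_right)
  qed
  have "{T f | T f. T \<in> commutant n i \<and> f \<in> hw_vectors i} \<subseteq> ?S"
  proof
    fix x assume "x \<in> {T f | T f. T \<in> commutant n i \<and> f \<in> hw_vectors i}"
    then obtain T g where x: "x = T g" "T \<in> commutant n i" "g \<in> hw_vectors i" by blast
    then have "g \<in> pspan C" using assms(3) by simp
    then obtain c where g: "g = (\<Sum>u\<in>C. pscale (c u) u)"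
      unfolding pv.span_finite[OF assms(2)] by blast
    have "x = (\<Sum>u\<in>C. pscale (c u) (T u) + pscale 0 (T u))"
      unfolding x(1) g by (simp add: pp.linear_sum[OF commutant_linear[OF x(2)]] pp.linear_scale[OF commutant_linear[OF x(2)]])
    then show "x \<in> ?S"
      unfolding mem_Collect_eq
      by (intro exI[of _ "\<lambda>u p. pscale (c u) (T p) + pscale 0 (T p)"] conjI allI)
         (rule commutant_combination[OF x(2) x(2)])
  qed
  then have "pspan {T f | T f. T \<in> commutant n i \<and> f \<in> hw_vectors i} \<subseteq> ?S"
    by (rule pv.span_minimal[OF _ sub])
  then have "f \<in> ?S" using hw_vectors_generates[OF assms(1)] assms(4) by blast
  then show ?thesis by simp
qed

text \<open>
  Old Jucys-Murphy elements commute with the operator that produces \<open>v\<close> from \<open>u\<close>, so \<open>v\<close> inherits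
  their eigenvalues from \<open>u\<close> (\<open>old\<close>); the leading coefficient of \<open>v\<close> is a multiple of \<open>u\<close>
  (\<open>top\<close>), which yields the new eigenvalue (\<open>new\<close>). For the span, a highest weight
  vector is a sum of elements of the orbits, and these summands are separated by the old eigenvalues,
  so each of them is a highest weight vector.
\<close>

lemma jm_basis_step:
  assumes C: "jm_basis i C" and i: "1 \<le> i" "Suc i \<le> n"
    and F: "\<And>u. u \<in> C \<Longrightarrow> finite (F u) \<and>
        simple_line_basis (R_alg (Suc i)) (ann_neg n (Suc i) ((\<lambda>d. d u) ` weyl_inv n i)) (F u)"
  shows "jm_basis (Suc i) (\<Union>u\<in>C. F u)"
proof -
  have i': "i \<le> n" using i(2) by simp
  have up: "u \<in> polys n" if "u \<in> C" for u
    using jm_basisD(4)[OF C that] hw_vectors_polys polys_mono[OF i'] by blast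
  have spanF: "pspan (F u) = (\<lambda>T. T u) ` commutant n i \<inter> hw_vectors (Suc i)" if u: "u \<in> C" for u
  proof -
    have "(\<lambda>T. T u) ` commutant n i \<subseteq> polys n" using commutant_polys up[OF u] by blast
    then have "ann_neg n (Suc i) ((\<lambda>d. d u) ` weyl_inv n i) = (\<lambda>T. T u) ` commutant n i \<inter> hw_vectors (Suc i)"
      unfolding weyl_inv_orbit[OF i' up[OF u]] by (rule ann_neg_eq[OF i(2)])
    then show ?thesis using F[OF u] by (simp add: simple_line_basis_def)
  qed
  have nz: "v \<noteq> 0" if "u \<in> C" "v \<in> F u" for u v
    using F[OF that(1)] that(2) pv.dependent_zero[of "F u"] unfolding simple_line_basis_def by blast
  have vH: "v \<in> hw_vectors (Suc i)" and vT: "\<exists>T\<in>commutant n i. v = T u" if "u \<in> C" "v \<in> F u" for u v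
    using pv.span_base[OF that(2)] unfolding spanF[OF that(1)] by blast+
  have vt: "\<exists>t. typed (Suc i) t v" if "u \<in> C" "v \<in> F u" for u v
    by (rule R_line_typed) (use F[OF that(1)] that(2) in \<open>simp add: simple_line_basis_def\<close>)
  have old: "jucys_murphy k v = pscale (jm_value k u) v" if u: "u \<in> C" "v \<in> F u" and k: "k \<in> {2..i}" for u v k
  proof -
    obtain T where T: "T \<in> commutant n i" "v = T u" using vT[OF u] by blast
    have "jucys_murphy k v = T (pscale (jm_value k u) u)"
      unfolding T(2) using jm_commutant[OF T(1)] jm_basisD(6)[OF C u(1) k] k by simp
    then show ?thesis using T(2) pp.linear_scale[OF commutant_linear[OF T(1)]] by simp
  qed
  have top: "\<exists>c. \<forall>m\<in>keys u. upd m (Suc i) c \<in> keys v" if u: "u \<in> C" "v \<in> F u" for u v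
  proof -
    obtain T where T: "T \<in> commutant n i" "v = T u" using vT[OF u] by blast
    obtain t where t: "typed i t u" using jm_basisD(5)[OF C u(1)] by blast
    obtain c where c: "slice (Suc i) c v \<noteq> 0" "\<And>c'. c < c' \<Longrightarrow> slice (Suc i) c' v = 0"
      using top_slice[OF nz[OF u]] by blast
    have "slice (Suc i) c v \<in> hw_vectors i" by (rule slice_hw_vectors[OF vH[OF u] c(2)])
    moreover have "slice (Suc i) c \<in> commutant n i" by (rule commutant_munit_single) (use i in auto)
    ultimately obtain e where e: "slice (Suc i) c v = pscale e u"
      using hw_vectors_orbit[OF i' jm_basisD(4)[OF C u(1)] t commutant_compose[OF _ T(1)]] T(2) by blast
    have "e \<noteq> 0" using c(1) e by auto
    have "upd m (Suc i) c \<in> keys v" if "m \<in> keys u" for m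
    proof -
      have "lookup (slice (Suc i) c v) m \<noteq> 0" using e \<open>e \<noteq> 0\<close> that by (simp add: in_keys_iff)
      then show ?thesis by (simp add: lookup_slice in_keys_iff split: if_splits)
    qed
    then show ?thesis by blast
  qed
  have new: "jucys_murphy (Suc i) v = pscale (of_nat (count t c) - of_nat c) v"
    if u: "u \<in> C" "v \<in> F u" and t: "typed i t u" and m: "m \<in> keys u" "upd m (Suc i) c \<in> keys v" for u v t m c
  proof -
    obtain T where T: "T \<in> commutant n i" "v = T u" using vT[OF u] by blast
    obtain t' where t': "typed (Suc i) t' v" using vt[OF u] by blast
    have "keys m \<subseteq> {1..i}" using hw_vectors_polys[OF jm_basisD(4)[OF C u(1)]] m(1) by (auto simp: polys_def)
    then have z: "content_sum (Suc i) (upd m (Suc i) c) = content_sum i m + of_nat (count t c) - of_nat c"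
      using content_sum_upd t m(1) by (simp add: typed_def)
    have "transp_sum i v = pscale (content_sum i m) v"
      using transp_sum_commutant[OF T(1), of u] transp_sum_typed[OF jm_basisD(4)[OF C u(1)] t m(1)] T(2)
      by (simp add: pp.linear_scale[OF commutant_linear[OF T(1)]])
    moreover have "transp_sum (Suc i) v = pscale (content_sum (Suc i) (upd m (Suc i) c)) v"
      by (rule transp_sum_typed[OF vH[OF u] t' m(2)])
    ultimately have "jucys_murphy (Suc i) v =
        pscale (content_sum (Suc i) (upd m (Suc i) c)) v - pscale (content_sum i m) v"
      using transp_sum_Suc[of i v] by (simp add: algebra_simps)
    then show ?thesis unfolding z pv.scale_left_diff_distrib[symmetric] by (simp add: algebra_simps)
  qed
  have eig: "jucys_murphy k v = pscale (jm_value k v) v" if u: "u \<in> C" "v \<in> F u" and k: "k \<in> {2..Suc i}" for u v k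
  proof -
    have "\<exists>c. jucys_murphy k v = pscale c v"
    proof (cases "k = Suc i")
      case True
      obtain t where t: "typed i t u" using jm_basisD(5)[OF C u(1)] by blast
      obtain m where m: "m \<in> keys u" using jm_basisD(3)[OF C u(1)] by (metis keys_eq_empty ex_in_conv)
      obtain c where "\<forall>m\<in>keys u. upd m (Suc i) c \<in> keys v" using top[OF u] by blast
      then show ?thesis using new[OF u t m] m True by blast
    next
      case False
      then have "k \<in> {2..i}" using k by auto
      then show ?thesis using old[OF u] by blast
    qed
    then show ?thesis using jm_valueI[OF nz[OF u]] by metis
  qed
  have sep: "\<exists>k\<in>{2..Suc i}. jm_value k v \<noteq> jm_value k w"
    if v: "u \<in> C" "v \<in> F u" and w: "u' \<in> C" "w \<in> F u'" and vw: "v \<noteq> w" for u v u' w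
  proof (cases "u = u'")
    case False
    then obtain k where k: "k \<in> {2..i}" "jm_value k u \<noteq> jm_value k u'" using jm_basisD(7)[OF C v(1) w(1)] by blast
    have "jm_value k v = jm_value k u" "jm_value k w = jm_value k u'"
      using jm_valueI[OF nz[OF v] old[OF v k(1)]] jm_valueI[OF nz[OF w] old[OF w k(1)]] by auto
    then show ?thesis using k by (intro bexI[of _ k]) auto
  next
    case True
    with w have w': "w \<in> F u" by simp
    obtain t where t: "typed i t u" using jm_basisD(5)[OF C v(1)] by blast
    obtain m where m: "m \<in> keys u" using jm_basisD(3)[OF C v(1)] by (metis keys_eq_empty ex_in_conv)
    obtain c where c: "upd m (Suc i) c \<in> keys v" using top[OF v] m by blast
    obtain d where d: "upd m (Suc i) d \<in> keys w" using top[OF v(1) w'] m by blast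
    obtain tv tw where tv: "typed (Suc i) tv v" and tw: "typed (Suc i) tw w"
      using vt[OF v] vt[OF v(1) w'] by blast
    (* Equal added exponents would give equal types, hence isomorphic lines. *)
    have cd: "c \<noteq> d"
    proof
      assume "c = d"
      then have "tv = tw" using c d tv tw by (auto simp: typed_def)
      then have "mod_iso (R_alg (Suc i)) (pspan {v}) (pspan {w})"
        using mod_iso_typed[OF nz[OF v] nz[OF v(1) w'] hw_vectors_polys[OF vH[OF v]] tv hw_vectors_polys[OF vH[OF v(1) w']]] tw
        by simp
      then show False using F[OF v(1)] v(2) w' vw unfolding simple_line_basis_def by blast
    qed
    have mono: "count t b \<le> count t a" if "a < b" for a b
      by (rule hw_vectors_count_antimono[OF jm_basisD(4)[OF C v(1)] t jm_basisD(3)[OF C v(1)] that])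
    have "int (count t c) - int c \<noteq> int (count t d) - int d"
      using cd
    proof (cases c d rule: linorder_cases)
      case less
      with mono[OF less] show ?thesis by linarith
    next
      case greater
      with mono[OF greater] show ?thesis by linarith
    qed simp
    then have "(of_int (int (count t c) - int c) :: complex) \<noteq> of_int (int (count t d) - int d)"
      by (simp only: of_int_eq_iff not_False_eq_True)
    then have "(of_nat (count t c) - of_nat c :: complex) \<noteq> of_nat (count t d) - of_nat d" by simp
    moreover have "jm_value (Suc i) v = of_nat (count t c) - of_nat c"
      by (rule jm_valueI[OF nz[OF v] new[OF v t m c]])
    moreover have "jm_value (Suc i) w = of_nat (count t d) - of_nat d"
      by (rule jm_valueI[OF nz[OF v(1) w'] new[OF v(1) w' t m d]])
    ultimately show ?thesis using i(1) by (intro bexI[of _ "Suc i"]) auto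
  qed
  have "pspan (\<Union>u\<in>C. F u) = hw_vectors (Suc i)"
  proof
    show "pspan (\<Union>u\<in>C. F u) \<subseteq> hw_vectors (Suc i)"
      by (rule pv.span_minimal[OF _ subspace_hw_vectors]) (use vH in blast)
    show "hw_vectors (Suc i) \<subseteq> pspan (\<Union>u\<in>C. F u)"
    proof
      fix y assume y: "y \<in> hw_vectors (Suc i)"
      then have "y \<in> polys n" using hw_vectors_polys polys_mono[OF i(2)] by blast
      then obtain T where T: "\<And>u. T u \<in> commutant n i" "y = (\<Sum>u\<in>C. T u u)"
        using polys_sum_orbits[OF i' jm_basisD(1,2)[OF C]] by blast
      have "T u u \<in> hw_vectors (Suc i)" if u: "u \<in> C" for u
      proof (rule joint_eigen_components[where K = "{2..i}" and L = jucys_murphy and \<chi> = jm_value and C = C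
            and y = "\<lambda>u. T u u", OF subspace_hw_vectors])
        show "jucys_murphy k x \<in> hw_vectors (Suc i)" if "k \<in> {2..i}" "x \<in> hw_vectors (Suc i)" for k x
          by (rule jm_hw_vectors[OF _ that(2)]) (use that(1) in auto)
        show "jucys_murphy k (T w w) = pscale (jm_value k w) (T w w)" if "w \<in> C" "k \<in> {2..i}" for w k
          using jm_commutant[OF T(1), of k w w] jm_basisD(6)[OF C that] that(2)
          by (simp add: pp.linear_scale[OF commutant_linear[OF T(1)]])
        show "\<exists>k\<in>{2..i}. jm_value k w \<noteq> jm_value k w'" if "w \<in> C" "w' \<in> C" "w \<noteq> w'" for w w'
          by (rule jm_basisD(7)[OF C that])
        show "(\<Sum>u\<in>C. T u u) \<in> hw_vectors (Suc i)" using y T(2) by simp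
      qed (use u jm_basisD(1)[OF C] linear_jm in auto)
      then have "T u u \<in> pspan (F u)" if "u \<in> C" for u
        unfolding spanF[OF that] using T(1)[of u] that by blast
      then have "T u u \<in> pspan (\<Union>u\<in>C. F u)" if "u \<in> C" for u
        using pv.span_mono[of "F u" "\<Union>u\<in>C. F u"] that by blast
      then show "y \<in> pspan (\<Union>u\<in>C. F u)"
        unfolding T(2) by (rule pv.span_sum)
    qed
  qed
  then show ?thesis
    unfolding jm_basis_def
    using jm_basisD(1)[OF C] F nz vt eig sep by (intro conjI ballI impI) (blast+)
qed

lemma canonical_jm_basis: "canonical_upto n i C \<Longrightarrow> 1 \<le> i \<and> jm_basis i C"
proof (induction rule: canonical_upto.induct)
  case base
  show ?case using jm_basis_1 by simp
next
  case (step i C F)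
  then show ?case using jm_basis_step[of i C n F] by auto
qed

section \<open>Irreducible constituents\<close>

text \<open>
  The isotypic parts of the annihilator; they turn out to be irreducible.
\<close>

definition iso_part :: "nat \<Rightarrow> nat multiset \<Rightarrow> mpoly set" where
  "iso_part n t = {f \<in> hw_vectors n. typed n t f}"

lemma subspace_iso_part: "psubspace (iso_part n t)"
proof -
  have "psubspace {f. typed n t f}"
    by (rule pv.subspaceI)
       (auto simp: typed_def dest!: set_mp[OF Poly_Mapping.keys_add] set_mp[OF keys_pscale])
  then have "psubspace (hw_vectors n \<inter> {f. typed n t f})" by (rule pv.subspace_inter[OF subspace_hw_vectors])
  then show ?thesis by (simp add: iso_part_def Int_def)
qed

lemma iso_part_perm:
  assumes "\<sigma> permutes {1..n}" "f \<in> iso_part n t" shows "perm_act \<sigma> f \<in> iso_part n t"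
proof -
  have "exp_type n m = t" if "m \<in> keys (perm_act \<sigma> f)" for m
    using that assms(2) exp_type_mperm[OF assms(1), of m]
    by (auto simp: keys_perm_act[OF permutes_bij[OF assms(1)]] iso_part_def typed_def)
  then show ?thesis
    using assms hw_vectors_perm_act[OF assms(1)] by (auto simp: iso_part_def typed_def)
qed

lemma iso_part_deg: "f \<in> iso_part n t \<Longrightarrow> m \<in> keys f \<Longrightarrow> deg n m = sum_mset t"
  using typed_deg[of n t f n m] hw_vectors_polys by (auto simp: iso_part_def)

lemma iso_part_deg_part: "f \<in> iso_part n t \<Longrightarrow> deg_part n (sum_mset t) f = f"
  by (rule coeff_filter_id) (rule iso_part_deg)

lemma iso_part_polys: "f \<in> iso_part n t \<Longrightarrow> f \<in> polys n"
  using hw_vectors_polys by (auto simp: iso_part_def)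

lemma iso_part_0: "0 \<in> iso_part n t"
  by (rule pv.subspace_0[OF subspace_iso_part])

lemma submod_sym_iff:
  "submod (sym_ops n) V \<longleftrightarrow> psubspace V \<and> (\<forall>\<sigma> v. \<sigma> permutes {1..n} \<longrightarrow> v \<in> V \<longrightarrow> perm_act \<sigma> v \<in> V)"
  by (auto simp: submod_def sym_ops_def)

text \<open>
  An equivariant projection onto a subrepresentation multiplies each vector by a scalar, which must be
  the same for all vectors and is 1 on the subrepresentation.
\<close>

lemma iso_part_irreducible:
  assumes "iso_part n t \<noteq> {0}" shows "irreducible_mod (sym_ops n) (iso_part n t)"
  unfolding irreducible_mod_def
proof (intro conjI allI impI)
  let ?U = "iso_part n t" and ?d = "sum_mset t"
  show "submod (sym_ops n) ?U"
    unfolding submod_sym_iff using subspace_iso_part iso_part_perm by blast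
  show "?U \<noteq> {0}" by fact
  fix W assume W: "W \<subseteq> ?U \<and> submod (sym_ops n) W"
  then have Ws: "psubspace W" and Wp: "\<And>\<sigma> w. \<sigma> permutes {1..n} \<Longrightarrow> w \<in> W \<Longrightarrow> perm_act \<sigma> w \<in> W"
    and WU: "W \<subseteq> ?U"
    unfolding submod_sym_iff by blast+
  obtain P where P: "equivariant n P" "\<And>p. P p \<in> W" "\<And>w. w \<in> W \<Longrightarrow> P w = w"
    using equivariant_projection[of W n, OF Ws Wp] by blast
  have "P p \<in> polys n" for p by (rule iso_part_polys) (rule subsetD[OF WU P(2)])
  then have PE: "P \<in> commutant n n" using P(1) by (simp add: commutant_def)
  have sc: "\<exists>c. P f = pscale c f" if f: "f \<in> ?U" for f
  proof -
    have "\<exists>c. deg_part n ?d (P (deg_part n ?d f)) = pscale c f"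
    proof (rule hw_vectors_scalar[OF _ order_refl commutant_component[OF order_refl PE]])
      show "homog n 0 (\<lambda>p. deg_part n ?d (P (deg_part n ?d p)))"
        using homog_deg_part[OF commutant_linear[OF PE], of n ?d ?d] by simp
    qed (use f in \<open>auto simp: iso_part_def\<close>)
    moreover have "P f \<in> ?U" using P(2) WU by blast
    ultimately show ?thesis using iso_part_deg_part f by metis
  qed
  show "W = {0} \<or> W = ?U"
  proof (cases "W = {0}")
    case False
    then obtain w where w: "w \<in> W" "w \<noteq> 0" using pv.subspace_0[OF Ws] by blast
    have "f \<in> W" if f: "f \<in> ?U" for f
    proof -
      obtain c where c: "P f = pscale c f" using sc[OF f] by blast
      have wU: "w \<in> ?U" using w(1) WU by blast
      (* Comparing the scalars of f, of w (which is 1) and of f + w. *)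
      then obtain e where e: "P (f + w) = pscale e (f + w)"
        using sc[OF pv.subspace_add[OF subspace_iso_part f wU]] by blast
      have "pscale c f + w = pscale e f + pscale e w"
        using e c P(3)[OF w(1)] by (simp add: pp.linear_add[OF commutant_linear[OF PE]] pv.scale_right_distrib)
      then have eq: "pscale (c - e) f = pscale (e - 1) w"
        by (simp add: pv.scale_left_diff_distrib algebra_simps)
      show ?thesis
      proof (cases "c = e")
        case True
        then have "pscale (e - 1) w = 0" using eq by simp
        then have "e = 1" using w(2) by simp
        then have "P f = f" using c True by simp
        then show ?thesis using P(2)[of f] by simp
      next
        case False
        have "pscale (inverse (c - e)) (pscale (c - e) f) \<in> W"
          unfolding eq by (intro pv.subspace_scale[OF Ws] w(1))
        then show ?thesis using False by simp
      qed
    qed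
    with WU show ?thesis by blast
  qed simp
qed

text \<open>
  An isomorphism extends to a homogeneous element of the commutant. If it lowers the degree it
  kills \<open>f\<close>, if it raises the degree it cannot reach a highest weight vector, and in degree 0 it cannot
  change the type.
\<close>

lemma iso_part_not_iso:
  assumes "iso_part n t \<noteq> {0}" "t \<noteq> s" shows "\<not> mod_iso (sym_ops n) (iso_part n t) (iso_part n s)"
proof
  assume "mod_iso (sym_ops n) (iso_part n t) (iso_part n s)"
  then obtain \<phi> where bij: "bij_betw \<phi> (iso_part n t) (iso_part n s)"
    and add: "\<And>u v. u \<in> iso_part n t \<Longrightarrow> v \<in> iso_part n t \<Longrightarrow> \<phi> (u + v) = \<phi> u + \<phi> v"
    and scale: "\<And>c v. v \<in> iso_part n t \<Longrightarrow> \<phi> (pscale c v) = pscale c (\<phi> v)"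
    and act: "\<And>a v. a \<in> sym_ops n \<Longrightarrow> v \<in> iso_part n t \<Longrightarrow> \<phi> (a v) = a (\<phi> v)"
    unfolding mod_iso_def by blast
  have \<phi>in: "\<phi> u \<in> iso_part n s" if "u \<in> iso_part n t" for u
    using bij that by (auto simp: bij_betw_def)
  obtain P where P: "equivariant n P" "\<And>p. P p \<in> iso_part n t" "\<And>w. w \<in> iso_part n t \<Longrightarrow> P w = w"
    using equivariant_projection[of "iso_part n t" n, OF subspace_iso_part iso_part_perm] by blast
  have Pl: "plinear P" using P(1) by (simp add: equivariant_def)
  let ?T = "\<lambda>p. \<phi> (P p)"
  have T: "?T \<in> commutant n n"
  proof (rule commutantI)
    show "plinear ?T"
      by (rule plinearI)
         (simp_all only: pp.linear_add[OF Pl] pp.linear_scale[OF Pl] add[OF P(2) P(2)] scale[OF P(2)])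
    show "?T p \<in> polys n" for p by (rule iso_part_polys[OF \<phi>in[OF P(2)]])
    show "?T (perm_act \<sigma> p) = perm_act \<sigma> (?T p)" if "\<sigma> permutes {1..n}" for \<sigma> p
    proof -
      have "perm_act \<sigma> \<in> sym_ops n" using that by (auto simp: sym_ops_def)
      then show ?thesis using P(1) that act[OF _ P(2)] by (simp add: equivariant_def)
    qed
  qed
  obtain f where f: "f \<in> iso_part n t" "f \<noteq> 0" using assms(1) iso_part_0 by blast
  define w where "w = \<phi> f"
  have Tf: "?T f = w" using P(3)[OF f(1)] by (simp add: w_def)
  have ws: "w \<in> iso_part n s" unfolding w_def by (rule \<phi>in[OF f(1)])
  have "\<phi> 0 = 0" using scale[OF f(1), of 0] by simp
  then have w0: "w \<noteq> 0"
    using bij f iso_part_0[of n t] unfolding w_def bij_betw_def inj_on_def by metis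
  have fH: "f \<in> hw_vectors n" "typed n t f" and wH: "w \<in> hw_vectors n" "typed n s w"
    using f ws by (auto simp: iso_part_def)
  define d e where "d = sum_mset t" and "e = sum_mset s"
  have rf: "deg_part n d f = f" and rw: "deg_part n e w = w"
    unfolding d_def e_def using iso_part_deg_part f(1) ws by blast+
  let ?C = "\<lambda>p. deg_part n e (?T (deg_part n d p))"
  have C: "?C \<in> commutant n n" "?C f = w" "homog n (int e - int d) ?C"
    using commutant_component[OF order_refl T] homog_deg_part[OF commutant_linear[OF T]] by (simp_all add: rf Tf rw)
  consider "e < d" | "d < e" | "e = d" by linarith
  then show False
  proof cases
    case 1
    then show False using hw_vectors_negative[OF fH(1) order_refl C(1,3)] C(2) w0 by simp
  next
    case 2
    have "?T f = 0"
      by (rule hw_vectors_positive[OF order_refl iso_part_polys[OF f(1)] T, of d e])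
         (use wH(1) iso_part_deg f(1) ws 2 in \<open>auto simp: Tf d_def e_def\<close>)
    then show False using Tf w0 by simp
  next
    case 3
    then have "homog n 0 ?C" using C(3) by simp
    then obtain c where "w = pscale c f"
      using hw_vectors_scalar[OF fH(1) order_refl C(1) _ fH(2)] C(2) by metis
    then have "keys w \<subseteq> keys f" using keys_pscale by simp
    moreover obtain m where "m \<in> keys w" using w0 by (metis keys_eq_empty ex_in_conv)
    ultimately show False using fH(2) wH(2) assms(2) by (auto simp: typed_def)
  qed
qed

lemma jm_basis_components:
  assumes C: "jm_basis i C" and X: "psubspace X" "\<And>k x. k \<in> {2..i} \<Longrightarrow> x \<in> X \<Longrightarrow> jucys_murphy k x \<in> X"
    and "(\<Sum>v\<in>C. pscale (a v) v) \<in> X" "v \<in> C"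
  shows "pscale (a v) v \<in> X"
proof (rule joint_eigen_components[where K = "{2..i}" and L = jucys_murphy and \<chi> = jm_value and C = C
      and y = "\<lambda>v. pscale (a v) v", OF X])
  show "jucys_murphy k (pscale (a w) w) = pscale (jm_value k w) (pscale (a w) w)" if "w \<in> C" "k \<in> {2..i}" for w k
    by (simp add: pp.linear_scale[OF linear_jm] jm_basisD(6)[OF C that] mult.commute)
  show "\<exists>k\<in>{2..i}. jm_value k w \<noteq> jm_value k w'" if "w \<in> C" "w' \<in> C" "w \<noteq> w'" for w w'
    by (rule jm_basisD(7)[OF C that])
qed (use assms(4,5) jm_basisD(1)[OF C] linear_jm in auto)

section \<open>Young bases\<close>

lemma jm_basis_independent:
  assumes C: "jm_basis i C" shows "\<not> pdependent C"
proof
  assume "pdependent C"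
  then obtain a v where v: "v \<in> C" "a v \<noteq> 0" and s: "(\<Sum>v\<in>C. pscale (a v) v) = 0"
    unfolding pv.dependent_finite[OF jm_basisD(1)[OF C]] by blast
  have "pscale (a v) v \<in> {0}"
    by (rule jm_basis_components[OF C pv.subspace_single_0 _ _ v(1)])
       (simp_all add: s pp.linear_0[OF linear_jm])
  then show False using v jm_basisD(3)[OF C] by simp
qed

text \<open>
  The components of a joint eigenvector with respect to a basis with distinct joint eigenvalues lie in
  the line of this eigenvector, so only one of them is nonzero.
\<close>

lemma jm_eigenvector_multiple:
  assumes C: "jm_basis i C" and y: "y \<in> hw_vectors i" "y \<noteq> 0" "\<And>k. k \<in> {2..i} \<Longrightarrow> \<exists>c. jucys_murphy k y = pscale c y"
  shows "\<exists>v\<in>C. \<exists>c. c \<noteq> 0 \<and> y = pscale c v"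
proof -
  have "y \<in> pspan C" using y(1) jm_basisD(2)[OF C] by simp
  then obtain a where a: "y = (\<Sum>v\<in>C. pscale (a v) v)"
    unfolding pv.span_finite[OF jm_basisD(1)[OF C]] by blast
  have comp: "pscale (a v) v \<in> pspan {y}" if v: "v \<in> C" for v
  proof (rule jm_basis_components[OF C pv.subspace_span _ _ v])
    show "jucys_murphy k x \<in> pspan {y}" if k: "k \<in> {2..i}" and x: "x \<in> pspan {y}" for k x
    proof (rule linear_maps_span[OF linear_jm _ x])
      fix z assume "z \<in> {y}"
      then show "jucys_murphy k z \<in> pspan {y}"
        using y(3)[OF k] pv.span_scale[OF pv.span_base[of y "{y}"]] by auto
    qed
    show "(\<Sum>v\<in>C. pscale (a v) v) \<in> pspan {y}" using a pv.span_base[of y "{y}"] by simp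
  qed
  obtain v where v: "v \<in> C" "pscale (a v) v \<noteq> 0"
    using y(2) a by (metis (no_types, lifting) sum.neutral)
  then obtain c where c: "pscale (a v) v = pscale c y" using comp[OF v(1)] by (auto simp: pv.span_singleton)
  then have "c \<noteq> 0" using v(2) by auto
  then have "y = pscale (inverse c) (pscale c y)" by simp
  also have "\<dots> = pscale (inverse c * a v) v" unfolding c[symmetric] by simp
  finally show ?thesis using v \<open>c \<noteq> 0\<close> by (intro bexI[of _ v] exI[of _ "inverse c * a v"]) auto
qed

lemma jm_in_jm_algebra: "k \<in> {2..n} \<Longrightarrow> jucys_murphy k \<in> jm_algebra n"
  unfolding jm_algebra_def op_algebra_def
  by (rule ov.span_base) (auto intro!: exI[of _ "[jucys_murphy k]"])

lemma op_algebra_eigen: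
  assumes G: "\<And>g. g \<in> G \<Longrightarrow> plinear g \<and> (\<exists>c. g v = pscale c v)" and a: "a \<in> op_algebra G"
  shows "plinear a \<and> (\<exists>c. a v = pscale c v)"
proof -
  let ?S = "{a. plinear a \<and> a v \<in> pspan {v}}"
  have sub: "ov.subspace ?S"
  proof (rule ov.subspaceI)
    show "0 \<in> ?S" by (auto simp: pv.span_zero intro: plinearI)
    show "x + y \<in> ?S" if "x \<in> ?S" "y \<in> ?S" for x y
      using that pp.linear_compose_add[of x y] pv.span_add by (auto simp: plus_fun_def)
    show "oscale c x \<in> ?S" if "x \<in> ?S" for c x
      using that pp.linear_compose_scale_right[of x c] pv.span_scale by (auto simp: oscale_def)
  qed
  have "foldr (\<circ>) ws id \<in> ?S" if "ws \<in> lists G" for ws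
    using that
  proof (induction ws rule: lists.induct)
    case Nil
    show ?case by (auto simp: id_def pv.span_base intro: plinearI)
  next
    case (Cons g ws)
    have g: "plinear g" "\<exists>c. g v = pscale c v" using G[OF Cons.hyps(1)] by blast+
    have w: "plinear (foldr (\<circ>) ws id)" "foldr (\<circ>) ws id v \<in> pspan {v}" using Cons.IH by blast+
    have eq: "foldr (\<circ>) (g # ws) id = (\<lambda>p. g (foldr (\<circ>) ws id p))" by (simp add: fun_eq_iff)
    have "g (foldr (\<circ>) ws id v) \<in> pspan {v}"
      by (rule linear_maps_span[OF g(1) _ w(2)])
         (use g(2) pv.span_scale[OF pv.span_base[of v "{v}"]] in auto)
    then show ?case unfolding eq mem_Collect_eq using plinear_compose[OF g(1) w(1)] by blast
  qed
  then have "op_algebra G \<subseteq> ?S"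
    unfolding op_algebra_def by (intro ov.span_minimal[OF _ sub]) blast
  then show ?thesis using a by (auto simp: pv.span_singleton)
qed

lemma jm_basis_submod:
  assumes C: "jm_basis n C" and v: "v \<in> C" shows "submod (jm_algebra n) (pspan {v})"
  unfolding submod_def
proof (intro conjI ballI)
  fix a x assume a: "a \<in> jm_algebra n" and x: "x \<in> pspan {v}"
  have "plinear a \<and> (\<exists>c. a v = pscale c v)"
  proof (rule op_algebra_eigen)
    show "a \<in> op_algebra (jucys_murphy ` {2..n})" using a by (simp add: jm_algebra_def)
    show "plinear g \<and> (\<exists>c. g v = pscale c v)" if "g \<in> jucys_murphy ` {2..n}" for g
      using that linear_jm jm_basisD(6)[OF C v] by blast
  qed
  then show "a x \<in> pspan {v}"
    using linear_maps_span[OF _ _ x, of a] pv.span_scale[OF pv.span_base[of v "{v}"]] by auto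
qed simp

lemma jm_basis_not_iso:
  assumes C: "jm_basis n C" and v: "v \<in> C" and w: "w \<in> C" and "v \<noteq> w"
  shows "\<not> mod_iso (jm_algebra n) (pspan {v}) (pspan {w})"
proof
  assume "mod_iso (jm_algebra n) (pspan {v}) (pspan {w})"
  then obtain \<phi> where bij: "bij_betw \<phi> (pspan {v}) (pspan {w})"
    and scale: "\<And>c x. x \<in> pspan {v} \<Longrightarrow> \<phi> (pscale c x) = pscale c (\<phi> x)"
    and act: "\<And>a x. a \<in> jm_algebra n \<Longrightarrow> x \<in> pspan {v} \<Longrightarrow> \<phi> (a x) = a (\<phi> x)"
    unfolding mod_iso_def by blast
  have vv: "v \<in> pspan {v}" by (rule pv.span_base) simp
  obtain e where e: "\<phi> v = pscale e w" using bij vv by (auto simp: bij_betw_def pv.span_singleton)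
  have "\<phi> 0 = 0" using scale[OF vv, of 0] by simp
  then have "\<phi> v \<noteq> 0"
    using bij vv jm_basisD(3)[OF C v] pv.span_zero[of "{v}"] unfolding bij_betw_def inj_on_def by metis
  then have ew: "e \<noteq> 0" "w \<noteq> 0" using e by auto
  obtain k where k: "k \<in> {2..n}" "jm_value k v \<noteq> jm_value k w" using jm_basisD(7)[OF C v w assms(4)] by blast
  have "pscale (jm_value k v) (pscale e w) = \<phi> (jucys_murphy k v)"
    by (simp only: jm_basisD(6)[OF C v k(1)] scale[OF vv] e)
  also have "\<dots> = jucys_murphy k (pscale e w)"
    by (simp only: act[OF jm_in_jm_algebra[OF k(1)] vv] e)
  also have "\<dots> = pscale e (pscale (jm_value k w) w)"
    by (simp only: pp.linear_scale[OF linear_jm] jm_basisD(6)[OF C w k(1)])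
  finally show False using ew k(2) by (simp add: pv.scale_cancel_right mult.commute)
qed

lemma jm_basis_part:
  assumes C: "jm_basis n C" shows "pspan (C \<inter> iso_part n t) = iso_part n t"
proof
  show "pspan (C \<inter> iso_part n t) \<subseteq> iso_part n t"
    by (rule pv.span_minimal[OF _ subspace_iso_part]) simp
  show "iso_part n t \<subseteq> pspan (C \<inter> iso_part n t)"
  proof
    fix f assume f: "f \<in> iso_part n t"
    then have "f \<in> pspan C" using jm_basisD(2)[OF C] by (auto simp: iso_part_def)
    then obtain a where a: "f = (\<Sum>v\<in>C. pscale (a v) v)"
      unfolding pv.span_finite[OF jm_basisD(1)[OF C]] by blast
    let ?R = "coeff_filter (\<lambda>m. exp_type n m = t)"
    have "?R f = (\<Sum>v\<in>C. pscale (a v) (?R v))"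
      unfolding a by (simp add: pp.linear_sum[OF linear_coeff_filter] pp.linear_scale[OF linear_coeff_filter])
    moreover have "?R f = f" by (rule coeff_filter_id) (use f in \<open>auto simp: iso_part_def typed_def\<close>)
    moreover have "?R v \<in> pspan (C \<inter> iso_part n t)" if v: "v \<in> C" for v
    proof -
      obtain s where s: "typed n s v" using jm_basisD(5)[OF C v] by blast
      show ?thesis
      proof (cases "s = t")
        case True
        then have "?R v = v" by (intro coeff_filter_id) (use s in \<open>auto simp: typed_def\<close>)
        moreover have "v \<in> C \<inter> iso_part n t"
          using v s True jm_basisD(4)[OF C v] by (simp add: iso_part_def)
        ultimately show ?thesis by (metis pv.span_base)
      next
        case False
        then have "?R v = 0" by (intro coeff_filter_eq_0) (use s in \<open>auto simp: typed_def\<close>)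
        then show ?thesis by (simp add: pv.span_zero)
      qed
    qed
    ultimately show "f \<in> pspan (C \<inter> iso_part n t)"
      by (metis (no_types, lifting) pv.span_scale pv.span_sum)
  qed
qed

lemma jm_basis_young:
  assumes C: "jm_basis n C" shows "young_basis n C"
proof -
  define \<V> where "\<V> = {iso_part n t | t. iso_part n t \<noteq> {0}}"
  have memV: "iso_part n t \<in> \<V>" if "iso_part n t \<noteq> {0}" for t
    unfolding \<V>_def mem_Collect_eq by (rule exI[of _ t]) (simp add: that)
  have inV: "\<exists>t. V = iso_part n t \<and> iso_part n t \<noteq> {0}" if "V \<in> \<V>" for V
    using that by (simp only: \<V>_def mem_Collect_eq)
  have in_part: "\<exists>t. v \<in> iso_part n t \<and> iso_part n t \<noteq> {0}" if v: "v \<in> C" for v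
  proof -
    obtain t where "typed n t v" using jm_basisD(5)[OF C v] by blast
    then have "v \<in> iso_part n t" using jm_basisD(4)[OF C v] by (simp add: iso_part_def)
    then show ?thesis using jm_basisD(3)[OF C v] by blast
  qed
  have "direct_sum \<V> (B_ann n)"
    unfolding direct_sum_def B_ann_eq
  proof (intro conjI ballI)
    show "pspan (\<Union>\<V>) = hw_vectors n"
    proof
      show "pspan (\<Union>\<V>) \<subseteq> hw_vectors n"
      proof (rule pv.span_minimal[OF _ subspace_hw_vectors], rule subsetI)
        fix p assume "p \<in> \<Union>\<V>"
        then obtain t where "p \<in> iso_part n t" using inV by (metis UnionE)
        then show "p \<in> hw_vectors n" by (simp add: iso_part_def)
      qed
      have "C \<subseteq> \<Union>\<V>"
      proof
        fix v assume "v \<in> C"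
        then obtain t where "v \<in> iso_part n t" "iso_part n t \<noteq> {0}" using in_part by metis
        then show "v \<in> \<Union>\<V>" by (intro UnionI[OF memV])
      qed
      then show "hw_vectors n \<subseteq> pspan (\<Union>\<V>)"
        using pv.span_mono[of C "\<Union>\<V>"] jm_basisD(2)[OF C] by simp
    qed
    fix V assume "V \<in> \<V>"
    then obtain t where t: "V = iso_part n t" using inV by metis
    (* The other constituents contain no monomial of type t. *)
    let ?N = "{p. \<forall>m\<in>keys p. exp_type n m \<noteq> t}"
    have "psubspace ?N"
      by (rule pv.subspaceI)
         (auto dest!: set_mp[OF Poly_Mapping.keys_add] set_mp[OF keys_pscale])
    moreover have "\<Union>(\<V> - {V}) \<subseteq> ?N"
    proof (intro subsetI CollectI ballI)
      fix p m assume "p \<in> \<Union>(\<V> - {V})" and m: "m \<in> keys p"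
      then obtain W where W: "W \<in> \<V>" "W \<noteq> V" "p \<in> W" by blast
      then obtain s where s: "W = iso_part n s" using inV by metis
      then have "p \<in> iso_part n s" "s \<noteq> t" using W(2,3) t by auto
      then show "exp_type n m \<noteq> t" using m by (auto simp: iso_part_def typed_def)
    qed
    ultimately have "pspan (\<Union>(\<V> - {V})) \<subseteq> ?N" by (rule pv.span_minimal[rotated])
    moreover have "p = 0" if "p \<in> V" "p \<in> ?N" for p
    proof -
      have "keys p = {}" using that unfolding t by (auto simp: iso_part_def typed_def)
      then show ?thesis by simp
    qed
    moreover have "0 \<in> V" unfolding t by (rule iso_part_0)
    ultimately show "V \<inter> pspan (\<Union>(\<V> - {V})) = {0}" using pv.span_zero by blast
  qed
  moreover have "\<forall>V\<in>\<V>. \<forall>W\<in>\<V>. V \<noteq> W \<longrightarrow> \<not> mod_iso (sym_ops n) V W"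
  proof (intro ballI impI)
    fix V W assume V: "V \<in> \<V>" and W: "W \<in> \<V>" and ne: "V \<noteq> W"
    obtain t where t: "V = iso_part n t" "iso_part n t \<noteq> {0}" using inV[OF V] by metis
    obtain s where s: "W = iso_part n s" using inV[OF W] by metis
    show "\<not> mod_iso (sym_ops n) V W"
      unfolding t(1) s by (rule iso_part_not_iso[OF t(2)]) (use ne t(1) s in blast)
  qed
  moreover have "\<forall>V\<in>\<V>. young_basis_irr n V (C \<inter> V)"
  proof
    fix V assume "V \<in> \<V>"
    then obtain t where t: "V = iso_part n t" "iso_part n t \<noteq> {0}" using inV by metis
    have "\<not> pdependent (C \<inter> V)"
      using jm_basis_independent[OF C] pv.dependent_mono[of "C \<inter> V" C] by blast
    then show "young_basis_irr n V (C \<inter> V)"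
      unfolding young_basis_irr_def simple_line_basis_def
      using iso_part_irreducible[OF t(2)] jm_basis_part[OF C, of t] jm_basis_submod[OF C] jm_basis_not_iso[OF C]
      unfolding t(1) by blast
  qed
  moreover have "C = (\<Union>V\<in>\<V>. C \<inter> V)"
  proof (intro equalityI subsetI)
    fix v assume v: "v \<in> C"
    then obtain t where "v \<in> iso_part n t" "iso_part n t \<noteq> {0}" using in_part by metis
    then show "v \<in> (\<Union>V\<in>\<V>. C \<inter> V)" using v by (intro UN_I[OF memV]) simp_all
  qed blast
  ultimately show ?thesis unfolding young_basis_def by (intro exI[of _ \<V>] exI[of _ "\<lambda>V. C \<inter> V"]) blast
qed

text \<open>
  Each Young vector is a multiple of a basis vector. Two Young vectors on one line coincide because
  they are independent within a constituent and constituents are independent; each line is hit because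
  Young vectors span.
\<close>

lemma young_basis_unique:
  assumes C: "jm_basis n C" and Y: "young_basis n Y" shows "same_up_to_scaling C Y"
proof -
  obtain \<V> F where ds: "direct_sum \<V> (hw_vectors n)" and irr: "\<And>V. V \<in> \<V> \<Longrightarrow> simple_line_basis (jm_algebra n) V (F V)"
    and YF: "Y = (\<Union>V\<in>\<V>. F V)"
    using Y unfolding young_basis_def young_basis_irr_def B_ann_eq by blast
  have ind: "\<not> pdependent (F V)" and sp: "pspan (F V) = V"
    and sm: "\<And>y. y \<in> F V \<Longrightarrow> submod (jm_algebra n) (pspan {y})" if "V \<in> \<V>" for V
    using irr[OF that] unfolding simple_line_basis_def by blast+
  have total: "pspan (\<Union>\<V>) = hw_vectors n" and disj: "\<And>V. V \<in> \<V> \<Longrightarrow> V \<inter> pspan (\<Union>(\<V> - {V})) = {0}"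
    using ds unfolding direct_sum_def by blast+
  have nz: "y \<noteq> 0" if "V \<in> \<V>" "y \<in> F V" for V y
    using ind[OF that(1)] that(2) pv.dependent_zero by blast
  have Cind: "v \<notin> pspan (C - {v})" if "v \<in> C" for v
    using jm_basis_independent[OF C] that unfolding pv.dependent_def by blast
  have mult: "\<exists>v\<in>C. \<exists>c. c \<noteq> 0 \<and> y = pscale c v" if y: "y \<in> Y" for y
  proof -
    obtain V where V: "V \<in> \<V>" "y \<in> F V" using y YF by blast
    have "y \<in> V" using pv.span_base[OF V(2)] sp[OF V(1)] by simp
    then have yH: "y \<in> hw_vectors n" using total pv.span_base[of y "\<Union>\<V>"] V(1) by blast
    have "\<exists>c. jucys_murphy k y = pscale c y" if k: "k \<in> {2..n}" for k
      using sm[OF V] jm_in_jm_algebra[OF k] pv.span_base[of y "{y}"]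
      unfolding submod_def pv.span_singleton by blast
    then show ?thesis by (rule jm_eigenvector_multiple[OF C yH nz[OF V]])
  qed
  have uniq: "y = y'" if y: "y \<in> Y" "y' \<in> Y" and e: "y = pscale e y'" for y y' e
  proof (rule ccontr)
    assume ne: "y \<noteq> y'"
    obtain V where V: "V \<in> \<V>" "y \<in> F V" using y YF by blast
    obtain W where W: "W \<in> \<V>" "y' \<in> F W" using y YF by blast
    show False
    proof (cases "V = W")
      case True
      then have "y' \<in> F V - {y}" using W ne by blast
      then have "y \<in> pspan (F V - {y})" using e pv.span_scale[OF pv.span_base] by metis
      then show False using ind[OF V(1)] V(2) unfolding pv.dependent_def by blast
    next
      case False
      have "y' \<in> W" using pv.span_base[OF W(2)] sp[OF W(1)] by simp
      then have "y' \<in> \<Union>(\<V> - {V})" using W(1) False by blast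
      then have "y \<in> pspan (\<Union>(\<V> - {V}))" using e pv.span_scale[OF pv.span_base] by metis
      moreover have "y \<in> V" using pv.span_base[OF V(2)] sp[OF V(1)] by simp
      ultimately show False using disj[OF V(1)] nz[OF V] by blast
    qed
  qed
  have hit: "\<exists>y\<in>Y. \<exists>c. c \<noteq> 0 \<and> y = pscale c v" if v: "v \<in> C" for v
  proof (rule ccontr)
    assume no: "\<not> ?thesis"
    have "y \<in> pspan (C - {v})" if y: "y \<in> Y" for y
    proof -
      obtain w c where w: "w \<in> C" "c \<noteq> 0" "y = pscale c w" using mult[OF y] by blast
      then have "w \<noteq> v" using no y by blast
      then show ?thesis using w pv.span_scale[OF pv.span_base[of w "C - {v}"]] by blast
    qed
    then have "F V \<subseteq> pspan (C - {v})" if "V \<in> \<V>" for V using that YF by blast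
    then have "V \<subseteq> pspan (C - {v})" if "V \<in> \<V>" for V
      using that sp[OF that] pv.span_minimal[OF _ pv.subspace_span] by metis
    then have "hw_vectors n \<subseteq> pspan (C - {v})"
      unfolding total[symmetric] by (intro pv.span_minimal[OF _ pv.subspace_span]) blast
    then show False using Cind[OF v] jm_basisD(4)[OF C v] by blast
  qed
  define f where "f v = (SOME y. y \<in> Y \<and> (\<exists>c. c \<noteq> 0 \<and> y = pscale c v))" for v
  have f: "f v \<in> Y" "\<exists>c. c \<noteq> 0 \<and> f v = pscale c v" if "v \<in> C" for v
  proof -
    have "\<exists>y. y \<in> Y \<and> (\<exists>c. c \<noteq> 0 \<and> y = pscale c v)" using hit[OF that] by blast
    from someI_ex[OF this] show "f v \<in> Y" "\<exists>c. c \<noteq> 0 \<and> f v = pscale c v"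
      unfolding f_def by blast+
  qed
  have "bij_betw f C Y"
  proof (rule bij_betw_imageI)
    show "inj_on f C"
    proof (rule inj_onI, rule ccontr)
      fix v w assume v: "v \<in> C" and w: "w \<in> C" and e: "f v = f w" and ne: "v \<noteq> w"
      obtain c where c: "c \<noteq> 0" "f v = pscale c v" using f(2)[OF v] by blast
      obtain d where d: "f w = pscale d w" using f(2)[OF w] by blast
      have "v = pscale (inverse c) (pscale c v)" using c(1) by simp
      also have "pscale c v = pscale d w" using c(2) d e by metis
      also have "pscale (inverse c) (pscale d w) = pscale (inverse c * d) w" by simp
      finally have "v \<in> pspan (C - {v})"
        using pv.span_scale[OF pv.span_base[of w "C - {v}"]] w ne by (metis DiffI singletonD)
      then show False using Cind[OF v] by blast
    qed
    show "f ` C = Y"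
    proof
      show "f ` C \<subseteq> Y" using f(1) by blast
      show "Y \<subseteq> f ` C"
      proof
        fix y assume y: "y \<in> Y"
        obtain v c where v: "v \<in> C" "c \<noteq> 0" "y = pscale c v" using mult[OF y] by blast
        obtain d where d: "d \<noteq> 0" "f v = pscale d v" using f(2)[OF v(1)] by blast
        have "f v = pscale (d * inverse c) y" using v(2,3) d(2) by simp
        then have "f v = y" by (rule uniq[OF f(1)[OF v(1)] y])
        then show "y \<in> f ` C" using v(1) by blast
      qed
    qed
  qed
  then show ?thesis unfolding same_up_to_scaling_def using f(2) by blast
qed

theorem theorem5p10:
  fixes n :: nat and C :: "mpoly set"
  assumes "n \<ge> 1"
    and "canonical_basis n C"
  shows "(\<exists>Y. young_basis n Y \<and> same_up_to_scaling C Y)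
    \<and> (\<forall>Y. young_basis n Y \<longrightarrow> same_up_to_scaling C Y)
    \<and> (\<forall>v\<in>C. \<forall>i\<in>{2..n}. eigenvector (jucys_murphy i) v)"
proof -
  have C: "jm_basis n C"
    using canonical_jm_basis assms(2) unfolding canonical_basis_def by blast
  show ?thesis
    using jm_basis_young[OF C] young_basis_unique[OF C] jm_basisD(3,6)[OF C]
    unfolding eigenvector_def by blast
qed

end
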